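(* Let $X=(X_t)_{t\ge 0}$ be a stable Lévy process of index $\alpha\in(1,2)$ satisfying $$\mathsf{E}e^{i\lambda X_t}=\exp\Big(t\int_0^\infty (e^{i\lambda x}-1-i\lambda x)\frac{dx}{\Gamma(-\alpha)x^{1+\alpha}}\Big)=e^{t(-i\lambda)^\alpha}\quad(\lambda\in\mathbb{R},\ t\ge0)$$ and $$\mathsf{E}e^{-\lambda X_t}=e^{t\lambda^\alpha}\quad(\lambda\ge0,\ t\ge0),$$ and let $S_1=\sup_{0\le t\le1}X_t$ denote its supremum over the time interval $[0,1]$. Then the density function $f$ of $S_1$ can be characterized as the unique solution to the weakly singular Volterra integral equation of the first kind $$\int_0^x\Big(y+\frac{\alpha}{\Gamma(2-\alpha)}\frac{1}{(x-y)^{\alpha-1}}\Big)f(y)\,dy=\frac{\alpha}{\Gamma(1/\alpha)}\qquad(x>0)$$ or, equivalently, as the unique solution to the fractional differential equation $$xf(x)+\alpha\,\mathbb{D}^{\alpha-1}f(x)=0\qquad(x>0)$$ satisfying the boundary condition $$\lim_{x\downarrow0}x^{2-\alpha}f(x)=\frac{1}{\Gamma(\alpha-1)\Gamma(1/\alpha)},$$ where $\mathbb{D}^{\alpha-1}$ denotes the Riemann–Liouville fractional derivative of order $\alpha-1$. This yields the series representation $$f(x)=\sum_{n=1}^\infty\frac{1}{\Gamma(\alpha n-1)\,\Gamma(-n+1+1/\alpha)}\,x^{\alpha n-2}$$ for $x>0$.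
   Context: $\Gamma$ is the Euler gamma function (extended to $\mathbb{R}\setminus\{0,-1,-2,\ldots\}$). The process $X$ starts at $0$ and has no negative jumps (its Lévy measure is $dx/(\Gamma(-\alpha)x^{1+\alpha})$ on $(0,\infty)$). The Riemann–Liouville fractional derivative of order $\alpha-1$ is given by $$\mathbb{D}^{\alpha-1}f(x)=\frac{1}{\Gamma(2-\alpha)}\frac{d}{dx}\int_0^x\frac{f(y)}{(x-y)^{\alpha-1}}\,dy$$ for $x>0$ and any (admissible) function $f:\mathbb{R}_+\to\mathbb{R}$, i.e. one for which the expression makes sense. *)

theory Defs
  imports "HOL-Probability.Probability"
begin

text \<open>
  Time is indexed by \<^typ>\<open>real\<close>; only the values at times \<open>t \<ge> 0\<close> are constrained.
\<close>

locale levy_process = prob_space M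
  for M :: "'a measure" and X :: "real \<Rightarrow> 'a \<Rightarrow> real" +
  assumes measurable_X: "\<And>t. 0 \<le> t \<Longrightarrow> X t \<in> borel_measurable M"
    and starts_at_0: "AE \<omega> in M. X 0 \<omega> = 0"
    and indep_increments:
      "\<And>(n::nat) t. 0 \<le> t 0 \<Longrightarrow> (\<And>i. i < n \<Longrightarrow> t i \<le> t (Suc i)) \<Longrightarrow>
         indep_vars (\<lambda>_. borel) (\<lambda>i \<omega>. X (t (Suc i)) \<omega> - X (t i) \<omega>) {..<n}"
    and stationary_increments:
      "\<And>s t. 0 \<le> s \<Longrightarrow> 0 \<le> t \<Longrightarrow>
         distr M borel (\<lambda>\<omega>. X (s + t) \<omega> - X s \<omega>) = distr M borel (X t)"
    and right_continuous:
      "\<And>\<omega> t. \<omega> \<in> space M \<Longrightarrow> 0 \<le> t \<Longrightarrow> ((\<lambda>s. X s \<omega>) \<longlongrightarrow> X t \<omega>) (at_right t)"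
    and left_limits:
      "\<And>\<omega> t. \<omega> \<in> space M \<Longrightarrow> 0 < t \<Longrightarrow> \<exists>l. ((\<lambda>s. X s \<omega>) \<longlongrightarrow> l) (at_left t)"

locale stable_levy_process = levy_process M X
  for M :: "'a measure" and X :: "real \<Rightarrow> 'a \<Rightarrow> real" and \<alpha> :: real +
  assumes scaling:
    "\<And>c t. 0 < c \<Longrightarrow> 0 \<le> t \<Longrightarrow>
       distr M borel (X (c * t)) = distr M borel (\<lambda>\<omega>. c powr (1 / \<alpha>) * X t \<omega>)"

definition no_negative_jumps :: "'a measure \<Rightarrow> (real \<Rightarrow> 'a \<Rightarrow> real) \<Rightarrow> bool" where
  "no_negative_jumps M X \<longleftrightarrow>
     (AE \<omega> in M. \<forall>t>0. \<forall>l. ((\<lambda>s. X s \<omega>) \<longlongrightarrow> l) (at_left t) \<longrightarrow> l \<le> X t \<omega>)"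

text \<open>
  Functions on the open half-line are total functions \<^typ>\<open>real \<Rightarrow> real\<close> whose values outside
  \<open>{0<..}\<close> are irrelevant. Below, integrands are required to be absolutely integrable, so
  \<^const>\<open>integral\<close> coincides with the Lebesgue integral.
\<close>

definition volterra_kernel :: "real \<Rightarrow> real \<Rightarrow> real \<Rightarrow> real" where
  "volterra_kernel \<alpha> x y = y + \<alpha> / Gamma (2 - \<alpha>) * (1 / (x - y) powr (\<alpha> - 1))"

text \<open>
  The kernel is bounded below by a positive constant on \<open>{0<..<x}\<close>, so the integrability
  requirement entails that \<open>f\<close> itself is Lebesgue integrable on every \<open>{0<..<x}\<close>.
\<close>

definition volterra_solution :: "real \<Rightarrow> (real \<Rightarrow> real) \<Rightarrow> bool" where
  "volterra_solution \<alpha> f \<longleftrightarrow>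
     (\<forall>x>0. (\<lambda>y. volterra_kernel \<alpha> x y * f y) absolutely_integrable_on {0<..<x} \<and>
            integral {0<..<x} (\<lambda>y. volterra_kernel \<alpha> x y * f y) = \<alpha> / Gamma (1 / \<alpha>))"

text \<open>
  Riemann--Liouville fractional derivative of order \<open>\<beta>\<close>, for \<open>0 < \<beta> < 1\<close>. Since
  \<^const>\<open>integral\<close> and \<^const>\<open>deriv\<close> are total, it has its intended meaning only for functions
  satisfying \<open>rl_admissible\<close>.
\<close>

definition rl_derivative :: "real \<Rightarrow> (real \<Rightarrow> real) \<Rightarrow> real \<Rightarrow> real" where
  "rl_derivative \<beta> f x =
     1 / Gamma (1 - \<beta>) * deriv (\<lambda>u. integral {0<..<u} (\<lambda>y. f y / (u - y) powr \<beta>)) x"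

definition rl_admissible :: "real \<Rightarrow> (real \<Rightarrow> real) \<Rightarrow> bool" where
  "rl_admissible \<beta> f \<longleftrightarrow>
     (\<forall>x>0. (\<lambda>y. f y / (x - y) powr \<beta>) absolutely_integrable_on {0<..<x} \<and>
            (\<lambda>u. integral {0<..<u} (\<lambda>y. f y / (u - y) powr \<beta>)) field_differentiable (at x))"

definition fractional_solution :: "real \<Rightarrow> (real \<Rightarrow> real) \<Rightarrow> bool" where
  "fractional_solution \<alpha> f \<longleftrightarrow>
     rl_admissible (\<alpha> - 1) f \<and>
     (\<forall>x>0. x * f x + \<alpha> * rl_derivative (\<alpha> - 1) f x = 0) \<and>
     ((\<lambda>x. x powr (2 - \<alpha>) * f x) \<longlongrightarrow> 1 / (Gamma (\<alpha> - 1) * Gamma (1 / \<alpha>))) (at_right 0)"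

end

theory Submission
  imports Defs "HOL-Real_Asymp.Real_Asymp"
begin

text \<open>
  Write \<open>S\<close> for the supremum over \<open>[0, 1]\<close>, \<open>\<mu>\<close> for its law, \<open>\<phi> u\<close> for \<open>E exp (- u S)\<close> and \<open>C\<close> for
  \<open>\<alpha> / \<Gamma>(1/\<alpha>)\<close>. The proof has a probabilistic half, which computes \<open>\<phi>\<close>, and an analytic half, which
  recognises the law with this transform.

  By right-continuity \<open>S\<close> is the limit of the maxima over the grids of mesh \<open>1/n\<close>, and by scaling such
  a maximum has the law of \<open>n\<^sup>-\<^sup>1\<^sup>/\<^sup>\<alpha> M\<^sub>n\<close>, where \<open>M\<^sub>n\<close> is the maximum of \<open>0\<close> and the first \<open>n\<close> partial sums
  of a random walk whose steps are distributed as \<open>X\<^sub>1\<close>. Splitting off the first step \<open>\<xi>\<close> shows that the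
  next maximum is distributed as \<open>max 0 (\<xi> + M\<^sub>k)\<close> with independent \<open>\<xi>\<close> and \<open>M\<^sub>k\<close>. In terms of the
  discarded part \<open>D\<^sub>k = max 0 (- (\<xi> + M\<^sub>k))\<close>, its transform at \<open>u\<close> therefore is
  \<open>exp (u\<^sup>\<alpha>)\<close> times that of \<open>M\<^sub>k\<close>, minus \<open>E (exp (u D\<^sub>k) - 1)\<close>. Now replace \<open>exp (u D\<^sub>k) - 1\<close> by \<open>u D\<^sub>k\<close>.
  At arguments of the order \<open>n\<^sup>-\<^sup>1\<^sup>/\<^sup>\<alpha>\<close> this costs an error of the order \<open>n\<^sup>-\<^sup>2\<^sup>/\<^sup>\<alpha>\<close> in one step, and nothing
  in the limit after \<open>n\<close> steps, because \<open>\<alpha> < 2\<close>. Summing up and letting \<open>n\<close> tend to infinity, one finds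
  that \<open>\<phi> u\<close> is \<open>1 - c u\<close> plus \<open>u\<^sup>\<alpha>\<close> times the integral of \<open>\<phi> (u s\<^sup>1\<^sup>/\<^sup>\<alpha>)\<close> over \<open>s\<close> in \<open>[0, 1]\<close>, for some
  constant \<open>c\<close> (\<open>sup_laplace_identity\<close>). Since \<open>\<phi>\<close> is bounded, \<open>c = C\<close>, and differentiation gives
  \<open>E (S exp (- u S)) + \<alpha> u\<^sup>\<alpha>\<^sup>-\<^sup>1 \<phi> u = C\<close> (\<open>sup_laplace_size_biased\<close>).

  Let \<open>\<kappa> x = x\<^sup>\<alpha>\<^sup>-\<^sup>2 / \<Gamma>(\<alpha> - 1)\<close>, whose Laplace transform is \<open>u\<^sup>1\<^sup>-\<^sup>\<alpha>\<close>. Multiplied by this power, the last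
  identity says that the positive measures \<open>\<alpha> \<mu> + (\<kappa> * (y \<mu>)) dx\<close> and \<open>C \<kappa> dx\<close> have the same
  transform. So they agree, \<open>\<mu>\<close> has a density \<open>d\<close>, and \<open>d\<close> satisfies the equation of the second kind
  \<open>\<alpha> d + \<kappa> * (y d) = C \<kappa>\<close>, called the resolvent equation below
  (\<open>laplace_identity_imp_resolvent_density\<close>).

  Convolving the Volterra equation with \<open>\<kappa>\<close> and differentiating turns it into the resolvent equation
  (\<open>volterra_imp_resolvent_pair\<close>), which has at most one locally integrable solution by a Gronwall
  argument with an exponential weight (\<open>volterra_gronwall\<close>). The power series solves the Volterra
  equation, since its integral telescopes term by term (\<open>sup_density_volterra\<close>). Hence its sum is a
  version of \<open>d\<close>, and this is how the sum is seen to be nonnegative. Finally, the fractional equation is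
  the derivative of the Volterra equation, and the boundary condition fixes the constant of integration
  (\<open>fractional_imp_volterra\<close>, \<open>volterra_imp_fractional\<close>).
\<close>

section \<open>Maxima of random walks\<close>

text \<open>
  The recursion splits off the first step rather than the last. For independent, identically
  distributed steps the shifted walk is independent of the first step and has the law of the
  original one, so the recursion becomes a recursion for laws.
\<close>

primrec max_partial_sum :: "nat \<Rightarrow> (nat \<Rightarrow> real) \<Rightarrow> real" where
  "max_partial_sum 0 x = 0"
| "max_partial_sum (Suc k) x = max 0 (x 0 + max_partial_sum k (\<lambda>i. x (Suc i)))"

lemma max_partial_sum_nonneg: "0 \<le> max_partial_sum k x"
  by (cases k) auto

lemma max_partial_sum_cong:
  "(\<And>i. i < k \<Longrightarrow> x i = y i) \<Longrightarrow> max_partial_sum k x = max_partial_sum k y"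
proof (induction k arbitrary: x y)
  case (Suc k)
  have "max_partial_sum k (\<lambda>i. x (Suc i)) = max_partial_sum k (\<lambda>i. y (Suc i))"
    by (rule Suc.IH) (simp add: Suc.prems)
  then show ?case using Suc.prems[of 0] by simp
qed simp

lemma max_partial_sum_scale:
  assumes "0 \<le> c" shows "max_partial_sum k (\<lambda>i. c * x i) = c * max_partial_sum k x"
proof (induction k arbitrary: x)
  case (Suc k)
  have "max_partial_sum k (\<lambda>i. c * x (Suc i)) = c * max_partial_sum k (\<lambda>i. x (Suc i))" by (rule Suc.IH)
  then show ?case using assms by (simp add: max_mult_distrib_left flip: distrib_left)
qed simp

lemma max_partial_sum_increments:
  "max_partial_sum k (\<lambda>i. y (Suc i) - y i) = Max ((\<lambda>j. y j - y 0) ` {..k})"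
proof (induction k arbitrary: y)
  case (Suc k)
  have "Max ((\<lambda>j. y j - y 0) ` {..Suc k}) = Max (insert 0 ((\<lambda>j. y (Suc j) - y 0) ` {..k}))"
    by (simp add: atMost_Suc_eq_insert_0 image_image)
  also have "\<dots> = max 0 (Max ((\<lambda>j. y (Suc j) - y 0) ` {..k}))"
    by simp
  also have "(\<lambda>j. y (Suc j) - y 0) ` {..k} = (\<lambda>z. (y 1 - y 0) + z) ` (\<lambda>j. y (Suc j) - y 1) ` {..k}"
    by (simp add: image_image)
  also have "Max \<dots> = (y 1 - y 0) + Max ((\<lambda>j. y (Suc j) - y 1) ` {..k})"
    by (rule mono_Max_commute[symmetric]) (auto simp: mono_def)
  also have "Max ((\<lambda>j. y (Suc j) - y 1) ` {..k}) = max_partial_sum k (\<lambda>i. y (Suc (Suc i)) - y (Suc i))"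
    using Suc.IH[of "\<lambda>i. y (Suc i)"] by simp
  finally show ?case by simp
qed simp

lemma measurable_max_partial_sum [measurable (raw)]:
  assumes "\<And>i. Y i \<in> borel_measurable N"
  shows "(\<lambda>\<omega>. max_partial_sum k (\<lambda>i. Y i \<omega>)) \<in> borel_measurable N"
  using assms
proof (induction k arbitrary: Y)
  case (Suc k)
  have "(\<lambda>\<omega>. max_partial_sum k (\<lambda>i. Y (Suc i) \<omega>)) \<in> borel_measurable N"
    by (rule Suc.IH) (rule Suc.prems)
  then show ?case using Suc.prems[of 0] by simp
qed simp

text \<open>
  Padding the finite sequence with zeros reduces measurability on the finite product to that of
  functions of infinitely many measurable coordinates.
\<close>

lemma measurable_max_partial_sum_PiM:
  "max_partial_sum k \<in> borel_measurable (PiM {..<k} (\<lambda>_. borel))"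
proof -
  have "(\<lambda>x. max_partial_sum k (\<lambda>i. if i < k then x i else 0)) \<in> borel_measurable (PiM {..<k} (\<lambda>_. borel))"
  proof (rule measurable_max_partial_sum)
    fix i show "(\<lambda>x. if i < k then x i else 0) \<in> borel_measurable (PiM {..<k} (\<lambda>_. borel :: real measure))"
      by (cases "i < k") auto
  qed
  also have "(\<lambda>x. max_partial_sum k (\<lambda>i. if i < k then x i else 0)) = max_partial_sum k"
    by (auto intro!: max_partial_sum_cong)
  finally show ?thesis .
qed

text \<open>
  Both joint laws are the product of the common marginals. This is used twice: to shift the walk by
  one step, and to compare the increments over a grid with rescaled unit steps.
\<close>

lemma (in prob_space) max_partial_sum_law_eq:
  assumes Y: "indep_vars (\<lambda>_. borel) Y {..<k}" and Z: "indep_vars (\<lambda>_. borel) Z {..<k}"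
    and law: "\<And>i. i < k \<Longrightarrow> distr M borel (Y i) = distr M borel (Z i)"
  shows "distr M borel (\<lambda>\<omega>. max_partial_sum k (\<lambda>i. Y i \<omega>)) =
         distr M borel (\<lambda>\<omega>. max_partial_sum k (\<lambda>i. Z i \<omega>))"
proof (cases "k = 0")
  case False
  have *: "distr M borel (\<lambda>\<omega>. max_partial_sum k (\<lambda>i. V i \<omega>)) =
      distr (PiM {..<k} (\<lambda>i. distr M borel (V i))) borel (max_partial_sum k)"
    if V: "indep_vars (\<lambda>_. borel) V {..<k}" for V :: "nat \<Rightarrow> 'a \<Rightarrow> real"
  proof -
    have [measurable]: "V i \<in> borel_measurable M" if "i < k" for i
      using V that by (auto simp: indep_vars_def)
    have "distr M borel (\<lambda>\<omega>. max_partial_sum k (\<lambda>i. V i \<omega>)) =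
        distr M borel (max_partial_sum k \<circ> (\<lambda>\<omega>. \<lambda>i\<in>{..<k}. V i \<omega>))"
      by (intro distr_cong) (auto intro!: max_partial_sum_cong)
    also have "\<dots> = distr (distr M (PiM {..<k} (\<lambda>_. borel)) (\<lambda>\<omega>. \<lambda>i\<in>{..<k}. V i \<omega>)) borel (max_partial_sum k)"
      by (rule distr_distr[symmetric]) (auto intro!: measurable_max_partial_sum_PiM measurable_restrict)
    also have "distr M (PiM {..<k} (\<lambda>_. borel)) (\<lambda>\<omega>. \<lambda>i\<in>{..<k}. V i \<omega>) =
        PiM {..<k} (\<lambda>i. distr M borel (V i))"
      using indep_vars_iff_distr_eq_PiM'[of "{..<k}" V "\<lambda>_. borel"] V
      False by (auto simp: lessThan_empty_iff)
    finally show ?thesis .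
  qed
  have "PiM {..<k} (\<lambda>i. distr M borel (Y i)) = PiM {..<k} (\<lambda>i. distr M borel (Z i))"
    by (rule PiM_cong) (auto simp: law)
  then show ?thesis unfolding *[OF Y] *[OF Z] by simp
qed simp

lemma (in prob_space) indep_vars_reindex:
  assumes ind: "indep_vars N Y (h ` I)" and h: "inj_on h I"
  shows "indep_vars (\<lambda>i. N (h i)) (\<lambda>i. Y (h i)) I"
  unfolding indep_vars_def2
proof (intro conjI ballI indep_setsI)
  let ?F = "\<lambda>i. {Y i -` A \<inter> space M |A. A \<in> sets (N i)}"
  have F: "indep_sets ?F (h ` I)" and rv: "\<And>i. i \<in> I \<Longrightarrow> Y (h i) \<in> measurable M (N (h i))"
    using ind by (auto simp: indep_vars_def2)
  show "random_variable (N (h i)) (Y (h i))" if "i \<in> I" for i using rv that .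
  show "?F (h i) \<subseteq> events" if "i \<in> I" for i using rv[OF that] by auto
  fix A J assume J: "J \<noteq> {}" "J \<subseteq> I" "finite J" "\<forall>j\<in>J. A j \<in> ?F (h j)"
  let ?B = "\<lambda>j. A (the_inv_into I h j)"
  have inv: "the_inv_into I h (h j) = j" if "j \<in> J" for j
    using that J h by (auto intro: the_inv_into_f_f)
  have "prob (\<Inter>j\<in>h ` J. ?B j) = (\<Prod>j\<in>h ` J. prob (?B j))"
    using J inv by (intro indep_setsD[OF F]) auto
  moreover have "(\<Prod>j\<in>h ` J. prob (?B j)) = (\<Prod>j\<in>J. prob (A j))"
    using J inv by (subst prod.reindex) (auto intro: inj_on_subset[OF h])
  moreover have "(\<Inter>j\<in>h ` J. ?B j) = (\<Inter>j\<in>J. A j)" using inv by auto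
  ultimately show "prob (\<Inter>j\<in>J. A j) = (\<Prod>j\<in>J. prob (A j))" by simp
qed

text \<open>
  With \<open>a = \<xi>\<^sub>0 + N\<close>, where \<open>N\<close> is the maximum of the shifted walk, the recursion reads
  \<open>M = max 0 a\<close>, and \<open>exp (- u * max 0 a) = exp (- u * a) - (exp (u * max 0 (- a)) - 1)\<close>. The first
  term factorises by independence.
\<close>

lemma (in prob_space) max_partial_sum_laplace_Suc:
  fixes \<xi> :: "nat \<Rightarrow> 'a \<Rightarrow> real"
  assumes ind: "indep_vars (\<lambda>_. borel) \<xi> {..<Suc k}"
    and rv: "\<And>i. \<xi> i \<in> borel_measurable M"
    and law: "\<And>i. i < Suc k \<Longrightarrow> distr M borel (\<xi> i) = distr M borel (\<xi> 0)"
    and int: "integrable M (\<lambda>\<omega>. exp (- u * \<xi> 0 \<omega>))" and u: "0 \<le> u"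
  defines "D \<equiv> \<lambda>\<omega>. max 0 (- (\<xi> 0 \<omega> + max_partial_sum k (\<lambda>i. \<xi> (Suc i) \<omega>)))"
  shows "integrable M (\<lambda>\<omega>. exp (u * D \<omega>))"
    and "expectation (\<lambda>\<omega>. exp (- u * max_partial_sum (Suc k) (\<lambda>i. \<xi> i \<omega>))) =
         expectation (\<lambda>\<omega>. exp (- u * \<xi> 0 \<omega>)) * expectation (\<lambda>\<omega>. exp (- u * max_partial_sum k (\<lambda>i. \<xi> i \<omega>)))
         - expectation (\<lambda>\<omega>. exp (u * D \<omega>) - 1)"
proof -
  note [measurable] = rv
  let ?N = "\<lambda>\<omega>. max_partial_sum k (\<lambda>i. \<xi> (Suc i) \<omega>)"
  let ?a = "\<lambda>\<omega>. \<xi> 0 \<omega> + ?N \<omega>"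
  have D_meas [measurable]: "D \<in> borel_measurable M"
    unfolding D_def by measurable
  show iD: "integrable M (\<lambda>\<omega>. exp (u * D \<omega>))"
  proof (rule Bochner_Integration.integrable_bound)
    show "integrable M (\<lambda>\<omega>. exp (- u * \<xi> 0 \<omega>) + 1)" using int by simp
    show "AE \<omega> in M. norm (exp (u * D \<omega>)) \<le> norm (exp (- u * \<xi> 0 \<omega>) + 1)"
    proof (rule AE_I2)
      fix \<omega>
      have "u * D \<omega> \<le> max 0 (- u * \<xi> 0 \<omega>)"
        using max_partial_sum_nonneg[of k "\<lambda>i. \<xi> (Suc i) \<omega>"] u unfolding D_def
        by (smt (verit) mult_left_mono mult_minus_left mult_minus_right mult_zero_right)
      then have "exp (u * D \<omega>) \<le> exp (max 0 (- u * \<xi> 0 \<omega>))" by simp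
      also have "\<dots> \<le> exp (- u * \<xi> 0 \<omega>) + 1" by (simp add: max_def)
      finally show "norm (exp (u * D \<omega>)) \<le> norm (exp (- u * \<xi> 0 \<omega>) + 1)" by simp
    qed
  qed measurable
  have indep: "indep_var borel (\<xi> 0) borel ?N"
  proof -
    have "indep_var (PiM {0} (\<lambda>_. borel)) (\<lambda>\<omega>. restrict (\<lambda>i. \<xi> i \<omega>) {0})
        (PiM {1..<Suc k} (\<lambda>_. borel)) (\<lambda>\<omega>. restrict (\<lambda>i. \<xi> i \<omega>) {1..<Suc k})"
      by (rule indep_var_restrict[OF ind]) auto
    moreover have "(\<lambda>x. max_partial_sum k (\<lambda>i. if i < k then x (Suc i) else 0)) \<in>
       borel_measurable (PiM {1..<Suc k} (\<lambda>_. borel))"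
    proof (rule measurable_max_partial_sum)
      fix i show "(\<lambda>x. if i < k then x (Suc i) else 0) \<in> borel_measurable (PiM {1..<Suc k} (\<lambda>_. borel :: real measure))"
        by (cases "i < k") auto
    qed
    ultimately have "indep_var borel ((\<lambda>x. x 0) \<circ> (\<lambda>\<omega>. restrict (\<lambda>i. \<xi> i \<omega>) {0}))
        borel ((\<lambda>x. max_partial_sum k (\<lambda>i. if i < k then x (Suc i) else 0)) \<circ> (\<lambda>\<omega>. restrict (\<lambda>i. \<xi> i \<omega>) {1..<Suc k}))"
      by (intro indep_var_compose) auto
    also have "(\<lambda>x. x 0) \<circ> (\<lambda>\<omega>. restrict (\<lambda>i. \<xi> i \<omega>) {0}) = \<xi> 0" by (auto simp: fun_eq_iff)
    also have "(\<lambda>x. max_partial_sum k (\<lambda>i. if i < k then x (Suc i) else 0)) \<circ> (\<lambda>\<omega>. restrict (\<lambda>i. \<xi> i \<omega>) {1..<Suc k}) = ?N"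
      by (auto simp: fun_eq_iff intro!: max_partial_sum_cong)
    finally show ?thesis .
  qed
  have indep': "indep_var borel (\<lambda>\<omega>. exp (- u * \<xi> 0 \<omega>)) borel (\<lambda>\<omega>. exp (- u * ?N \<omega>))"
    using indep_var_compose[OF indep, of "\<lambda>x. exp (- u * x)" borel "\<lambda>x. exp (- u * x)" borel]
    by (simp add: o_def)
  have iN: "integrable M (\<lambda>\<omega>. exp (- u * ?N \<omega>))"
    using u max_partial_sum_nonneg
    by (intro integrable_const_bound[where B=1] AE_I2) (auto simp: mult_nonneg_nonneg)
  have shift: "distr M borel ?N = distr M borel (\<lambda>\<omega>. max_partial_sum k (\<lambda>i. \<xi> i \<omega>))"
  proof (rule max_partial_sum_law_eq)
    show "indep_vars (\<lambda>_. borel) \<xi> {..<k}" by (rule indep_vars_subset[OF ind]) auto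
    show "indep_vars (\<lambda>_. borel) (\<lambda>i \<omega>. \<xi> (Suc i) \<omega>) {..<k}"
      by (rule indep_vars_reindex[where h=Suc]) (auto intro!: indep_vars_subset[OF ind])
    show "distr M borel (\<xi> (Suc i)) = distr M borel (\<xi> i)" if "i < k" for i
      using law[of "Suc i"] law[of i] that by simp
  qed
  have "expectation (\<lambda>\<omega>. exp (- u * ?N \<omega>)) = (\<integral>x. exp (- u * x) \<partial>distr M borel ?N)"
    by (subst integral_distr) auto
  also have "\<dots> = expectation (\<lambda>\<omega>. exp (- u * max_partial_sum k (\<lambda>i. \<xi> i \<omega>)))"
    unfolding shift by (subst integral_distr) auto
  finally have EN: "expectation (\<lambda>\<omega>. exp (- u * ?N \<omega>)) = expectation (\<lambda>\<omega>. exp (- u * max_partial_sum k (\<lambda>i. \<xi> i \<omega>)))" .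
  have ia: "integrable M (\<lambda>\<omega>. exp (- u * \<xi> 0 \<omega>) * exp (- u * ?N \<omega>))"
    by (rule indep_var_integrable[OF indep' int iN])
  have "exp (- u * max_partial_sum (Suc k) (\<lambda>i. \<xi> i \<omega>)) =
      exp (- u * \<xi> 0 \<omega>) * exp (- u * ?N \<omega>) - (exp (u * D \<omega>) - 1)" for \<omega>
    unfolding D_def by (auto simp: max_def algebra_simps simp flip: exp_add)
  then have "expectation (\<lambda>\<omega>. exp (- u * max_partial_sum (Suc k) (\<lambda>i. \<xi> i \<omega>))) =
      expectation (\<lambda>\<omega>. exp (- u * \<xi> 0 \<omega>) * exp (- u * ?N \<omega>) - (exp (u * D \<omega>) - 1))"
    by presburger
  also have "\<dots> = expectation (\<lambda>\<omega>. exp (- u * \<xi> 0 \<omega>) * exp (- u * ?N \<omega>)) - expectation (\<lambda>\<omega>. exp (u * D \<omega>) - 1)"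
    using ia iD by (intro Bochner_Integration.integral_diff) auto
  also have "expectation (\<lambda>\<omega>. exp (- u * \<xi> 0 \<omega>) * exp (- u * ?N \<omega>)) =
      expectation (\<lambda>\<omega>. exp (- u * \<xi> 0 \<omega>)) * expectation (\<lambda>\<omega>. exp (- u * ?N \<omega>))"
    by (rule indep_var_lebesgue_integral[OF indep' int iN])
  finally show "expectation (\<lambda>\<omega>. exp (- u * max_partial_sum (Suc k) (\<lambda>i. \<xi> i \<omega>))) =
         expectation (\<lambda>\<omega>. exp (- u * \<xi> 0 \<omega>)) * expectation (\<lambda>\<omega>. exp (- u * max_partial_sum k (\<lambda>i. \<xi> i \<omega>)))
         - expectation (\<lambda>\<omega>. exp (u * D \<omega>) - 1)"
    unfolding EN .
qed

section \<open>Paths, grids and Riemann sums\<close>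

text \<open>
  One-sided limits bound the function near every point, and finitely many such neighbourhoods cover
  the compact interval.
\<close>

lemma right_left_limits_imp_bounded:
  fixes f :: "real \<Rightarrow> real"
  assumes r: "\<And>t. a \<le> t \<Longrightarrow> (f \<longlongrightarrow> f t) (at_right t)"
    and l: "\<And>t. a < t \<Longrightarrow> \<exists>l. (f \<longlongrightarrow> l) (at_left t)"
  shows "bounded (f ` {a..b})"
proof -
  have "\<exists>U. open U \<and> t \<in> U \<and> bounded (f ` (U \<inter> {a..b}))" if t: "t \<in> {a..b}" for t
  proof -
    have "eventually (\<lambda>s. dist (f s) (f t) < 1) (at_right t)"
      using tendstoD[OF r[of t], of 1] t by simp
    then obtain d where d: "t < d" "\<And>s. t < s \<Longrightarrow> s < d \<Longrightarrow> dist (f s) (f t) < 1"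
      unfolding eventually_at_right_field by auto
    obtain e L where e: "e < t" "\<And>s. a \<le> s \<Longrightarrow> e < s \<Longrightarrow> s < t \<Longrightarrow> dist (f s) L < 1"
    proof (cases "a < t")
      case True
      then obtain L where "(f \<longlongrightarrow> L) (at_left t)" using l by blast
      then have "eventually (\<lambda>s. dist (f s) L < 1) (at_left t)" by (rule tendstoD) simp
      then show ?thesis using that unfolding eventually_at_left_field by blast
    next
      case False
      then show ?thesis using that[of "t - 1" 0] by auto
    qed
    have "norm (f s) \<le> \<bar>f t\<bar> + \<bar>L\<bar> + 1" if s: "s \<in> {e<..<d} \<inter> {a..b}" for s
    proof -
      consider "s = t" | "t < s" | "s < t" by linarith
      then show ?thesis using d(2)[of s] e(2)[of s] s by cases (auto simp: dist_real_def)
    qed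
    then have "bounded (f ` ({e<..<d} \<inter> {a..b}))" unfolding bounded_iff by blast
    then show ?thesis using d(1) e(1) by (intro exI[of _ "{e<..<d}"]) auto
  qed
  then obtain U where U: "\<And>t. t \<in> {a..b} \<Longrightarrow> open (U t) \<and> t \<in> U t \<and> bounded (f ` (U t \<inter> {a..b}))"
    by metis
  obtain T where T: "T \<subseteq> {a..b}" "finite T" "{a..b} \<subseteq> (\<Union>t\<in>T. U t)"
    by (rule compactE_image[of "{a..b}" "{a..b}" U]) (use U in auto)
  have "f ` {a..b} \<subseteq> (\<Union>t\<in>T. f ` (U t \<inter> {a..b}))" using T by blast
  moreover have "bounded (\<Union>t\<in>T. f ` (U t \<inter> {a..b}))" using T U by (intro bounded_Union) auto
  ultimately show ?thesis by (rule bounded_subset[rotated])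
qed

text \<open>
  A point where \<open>f\<close> nearly attains the supremum is approximated from the right by the grid points
  obtained by rounding up, which is all that right-continuity controls.
\<close>

lemma grid_Max_tendsto_SUP:
  fixes f :: "real \<Rightarrow> real"
  assumes r: "\<And>t. 0 \<le> t \<Longrightarrow> (f \<longlongrightarrow> f t) (at_right t)"
    and bdd: "bdd_above (f ` {0..1})"
  shows "(\<lambda>n. Max ((\<lambda>j. f (real j / real n)) ` {..n})) \<longlonglongrightarrow> (SUP t\<in>{0..1}. f t)"
proof (rule order_tendstoI)
  let ?S = "SUP t\<in>{0..1}. f t"
  fix a assume a: "?S < a"
  show "\<forall>\<^sub>F n in sequentially. Max ((\<lambda>j. f (real j / real n)) ` {..n}) < a"
    using eventually_gt_at_top[of 0]
  proof eventually_elim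
    case (elim n)
    have "f (real j / real n) \<le> ?S" if "j \<le> n" for j
      using that elim by (intro cSUP_upper bdd) (auto simp: divide_simps)
    with a show ?case by (subst Max_less_iff) (auto intro: le_less_trans)
  qed
next
  let ?S = "SUP t\<in>{0..1}. f t"
  fix a assume "a < ?S"
  then obtain s where s: "0 \<le> s" "s \<le> 1" "a < f s"
    by (subst (asm) less_cSUP_iff) (use bdd in auto)
  have "eventually (\<lambda>r. a < f r) (at_right s)"
    using order_tendstoD(1)[OF r s(3)] s(1) by simp
  then obtain d where d: "s < d" "\<And>r. s < r \<Longrightarrow> r < d \<Longrightarrow> a < f r"
    unfolding eventually_at_right_field by auto
  have "eventually (\<lambda>n. 1 / (d - s) < real n) sequentially"
    by (rule eventually_compose_filterlim[OF eventually_gt_at_top filterlim_real_sequentially])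
  then show "\<forall>\<^sub>F n in sequentially. a < Max ((\<lambda>j. f (real j / real n)) ` {..n})"
    using eventually_gt_at_top[of 0]
  proof eventually_elim
    case (elim n)
    \<comment> \<open>Rounding up approaches s from the right, and j does not exceed n because s
      is at most 1.\<close>
    define j where "j = nat \<lceil>real n * s\<rceil>"
    have j: "real n * s \<le> real j" "real j < real n * s + 1"
      using s(1) unfolding j_def by (auto simp: of_nat_nat) linarith+
    have "real n * s \<le> real n" using s elim by (simp add: mult_left_le)
    with j(2) have "j \<le> n" by linarith
    have "s \<le> real j / real n" using j elim by (simp add: field_simps)
    moreover have "real j / real n < d"
    proof -
      have "real j / real n < s + 1 / real n" using j elim by (simp add: field_simps)
      also have "\<dots> < d" using elim d(1) by (simp add: field_simps)
      finally show ?thesis .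
    qed
    ultimately have "a < f (real j / real n)" using d(2)[of "real j / real n"] s(3) by (cases "s = real j / real n") auto
    also have "\<dots> \<le> Max ((\<lambda>j. f (real j / real n)) ` {..n})" using \<open>j \<le> n\<close> by (intro Max_ge) auto
    finally show ?case .
  qed
qed

text \<open>
  Every term of the series of \<open>exp x - 1 - x\<close> has degree at least two. This quadratic gain under
  scaling is what makes the error of linearising the undershoot negligible.
\<close>

lemma exp_second_order_scale:
  fixes s x :: real
  assumes "0 \<le> s" "s \<le> 1" "0 \<le> x"
  shows "exp (s * x) - 1 - s * x \<le> s\<^sup>2 * (exp x - 1 - x)"
proof -
  have summ: "summable (\<lambda>n. inverse (fact (n + 2)) * (y ^ (n + 2)))" for y :: real
    using summable_ignore_initial_segment[OF summable_exp[of y], of 2] by simp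
  have "(\<Sum>n. inverse (fact (n + 2)) * ((s * x) ^ (n + 2))) \<le> (\<Sum>n. s\<^sup>2 * (inverse (fact (n + 2)) * (x ^ (n + 2))))"
  proof (rule suminf_le)
    fix n
    have "s ^ (n + 2) \<le> s ^ 2" using assms by (intro power_decreasing) auto
    then have "inverse (fact (n + 2)) * (s ^ (n + 2) * x ^ (n + 2)) \<le> inverse (fact (n + 2)) * (s ^ 2 * x ^ (n + 2))"
      using assms by (intro mult_left_mono mult_right_mono) auto
    then show "inverse (fact (n + 2)) * ((s * x) ^ (n + 2)) \<le> s\<^sup>2 * (inverse (fact (n + 2)) * (x ^ (n + 2)))"
      unfolding power_mult_distrib by (simp only: ac_simps)
  qed (intro summ summable_mult)+
  also have "\<dots> = s\<^sup>2 * (\<Sum>n. inverse (fact (n + 2)) * (x ^ (n + 2)))" by (rule suminf_mult[OF summ])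
  finally show ?thesis using exp_first_two_terms[of "s * x"] exp_first_two_terms[of x] by simp
qed

lemma has_integral_floor_step:
  fixes F :: "nat \<Rightarrow> real"
  assumes n: "0 < n"
  shows "((\<lambda>s. F (nat \<lfloor>real n * s\<rfloor>)) has_integral (\<Sum>k<m. F k) / real n) {0..real m / real n}"
proof (induction m)
  case (Suc m)
  have "((\<lambda>s. F m) has_integral F m / real n) {real m / real n..real (Suc m) / real n}"
    using has_integral_const_real[of "F m" "real m / real n" "real (Suc m) / real n"] n by (simp add: field_simps)
  then have "((\<lambda>s. F (nat \<lfloor>real n * s\<rfloor>)) has_integral F m / real n) {real m / real n..real (Suc m) / real n}"
  proof (rule has_integral_spike_finite[of "{real (Suc m) / real n}", rotated 2])
    fix s assume "s \<in> {real m / real n..real (Suc m) / real n} - {real (Suc m) / real n}"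
    then have "real m \<le> real n * s" "real n * s < real (Suc m)" using n by (auto simp: field_simps)
    then have "\<lfloor>real n * s\<rfloor> = int m" by (intro floor_unique) auto
    then show "F (nat \<lfloor>real n * s\<rfloor>) = F m" by simp
  qed simp
  from has_integral_combine[OF _ _ Suc.IH this] n show ?case by (simp add: field_simps)
qed (simp add: has_integral_refl(2))

lemma floor_grid_tendsto:
  "(\<lambda>n. real (nat \<lfloor>real n * s\<rfloor>) / real n) \<longlonglongrightarrow> s" if "0 \<le> s" for s :: real
proof (rule tendsto_sandwich)
  show "eventually (\<lambda>n. s - 1 / real n \<le> real (nat \<lfloor>real n * s\<rfloor>) / real n) sequentially"
    using eventually_gt_at_top[of 0]
  proof eventually_elim
    case (elim n)
    have "real n * s - 1 \<le> real (nat \<lfloor>real n * s\<rfloor>)" using that by linarith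
    then have "(real n * s - 1) / real n \<le> real (nat \<lfloor>real n * s\<rfloor>) / real n"
      by (rule divide_right_mono) simp
    then show ?case using elim by (simp add: diff_divide_distrib)
  qed
  show "eventually (\<lambda>n. real (nat \<lfloor>real n * s\<rfloor>) / real n \<le> s) sequentially"
    using eventually_gt_at_top[of 0]
  proof eventually_elim
    case (elim n)
    have "real (nat \<lfloor>real n * s\<rfloor>) \<le> real n * s" using that by (simp add: of_nat_nat)
    then show ?case using elim by (simp add: field_simps)
  qed
  show "(\<lambda>n. s - 1 / real n) \<longlonglongrightarrow> s" by real_asymp
qed simp

section \<open>From the walk to the supremum of the process\<close>

context levy_process
begin

text \<open>
  Expressed through increments, so that its law is determined by independent, identically distributed
  variables. It is the maximum over the grid of \<open>X\<close> minus its initial value.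
\<close>

definition grid_max :: "nat \<Rightarrow> 'a \<Rightarrow> real" where
  "grid_max n \<omega> = max_partial_sum n (\<lambda>i. X (real (Suc i) / real n) \<omega> - X (real i / real n) \<omega>)"

lemma measurable_increment [measurable]:
  "0 \<le> s \<Longrightarrow> 0 \<le> t \<Longrightarrow> (\<lambda>\<omega>. X s \<omega> - X t \<omega>) \<in> borel_measurable M"
  by (intro borel_measurable_diff measurable_X)

lemma measurable_grid_max [measurable]: "grid_max n \<in> borel_measurable M"
  unfolding grid_max_def by (intro measurable_max_partial_sum measurable_increment) auto

lemma grid_max_nonneg: "0 \<le> grid_max n \<omega>"
  unfolding grid_max_def by (rule max_partial_sum_nonneg)

lemma bdd_above_path: "\<omega> \<in> space M \<Longrightarrow> bdd_above ((\<lambda>t. X t \<omega>) ` {0..1})"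
  by (intro bounded_imp_bdd_above right_left_limits_imp_bounded right_continuous left_limits)

lemma grid_max_tendsto:
  assumes \<omega>: "\<omega> \<in> space M"
  shows "(\<lambda>n. grid_max n \<omega>) \<longlonglongrightarrow> (SUP t\<in>{0..1}. X t \<omega>) - X 0 \<omega>"
proof -
  have "grid_max n \<omega> = Max ((\<lambda>j. X (real j / real n) \<omega>) ` {..n}) - X 0 \<omega>" for n
  proof -
    have "Max ((\<lambda>j. X (real j / real n) \<omega> - X (real 0 / real n) \<omega>) ` {..n}) =
        Max ((\<lambda>z. z - X 0 \<omega>) ` (\<lambda>j. X (real j / real n) \<omega>) ` {..n})"
      by (simp add: image_image)
    also have "\<dots> = Max ((\<lambda>j. X (real j / real n) \<omega>) ` {..n}) - X 0 \<omega>"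
      by (rule mono_Max_commute[symmetric]) (auto simp: mono_def)
    finally show ?thesis unfolding grid_max_def
      by (simp only: max_partial_sum_increments[of n "\<lambda>i. X (real i / real n) \<omega>"])
  qed
  moreover have "(\<lambda>n. Max ((\<lambda>j. X (real j / real n) \<omega>) ` {..n}) - X 0 \<omega>) \<longlonglongrightarrow> (SUP t\<in>{0..1}. X t \<omega>) - X 0 \<omega>"
    using \<omega> by (intro tendsto_diff tendsto_const grid_Max_tendsto_SUP right_continuous bdd_above_path)
  ultimately show ?thesis by simp
qed

lemma AE_grid_max_tendsto:
  "AE \<omega> in M. (\<lambda>n. grid_max n \<omega>) \<longlonglongrightarrow> (SUP t\<in>{0..1}. X t \<omega>)"
  using starts_at_0 by (rule AE_mp) (auto intro!: AE_I2 dest: grid_max_tendsto)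

lemma measurable_supremum [measurable]: "(\<lambda>\<omega>. SUP t\<in>{0..1}. X t \<omega>) \<in> borel_measurable M"
proof -
  have "(\<lambda>\<omega>. (SUP t\<in>{0..1}. X t \<omega>) - X 0 \<omega>) \<in> borel_measurable M"
    by (rule borel_measurable_LIMSEQ_real[OF grid_max_tendsto]) auto
  from borel_measurable_add[OF this measurable_X[of 0]] show ?thesis by simp
qed

lemma AE_supremum_nonneg: "AE \<omega> in M. 0 \<le> (SUP t\<in>{0..1}. X t \<omega>)"
  using starts_at_0
proof (rule AE_mp, intro AE_I2 impI)
  fix \<omega> assume "\<omega> \<in> space M" "X 0 \<omega> = 0"
  then show "0 \<le> (SUP t\<in>{0..1}. X t \<omega>)"
    using cSUP_upper[OF _ bdd_above_path, of 0 \<omega>] by simp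
qed

text \<open>
  The number of grid points and the argument of the transform may vary together; this is the form
  needed for Riemann sums.
\<close>

lemma grid_max_laplace_tendsto:
  assumes u: "0 \<le> u" and uk: "\<And>m. 0 \<le> v m" "v \<longlonglongrightarrow> u" and k: "filterlim k at_top sequentially"
  shows "(\<lambda>m. expectation (\<lambda>\<omega>. exp (- v m * grid_max (k m) \<omega>))) \<longlonglongrightarrow>
         expectation (\<lambda>\<omega>. exp (- u * (SUP t\<in>{0..1}. X t \<omega>)))"
proof (rule integral_dominated_convergence[where w="\<lambda>_. 1"])
  show "AE \<omega> in M. (\<lambda>m. exp (- v m * grid_max (k m) \<omega>)) \<longlonglongrightarrow> exp (- u * (SUP t\<in>{0..1}. X t \<omega>))"
    using AE_grid_max_tendsto
  proof eventually_elim
    case (elim \<omega>)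
    have "(\<lambda>m. grid_max (k m) \<omega>) \<longlonglongrightarrow> (SUP t\<in>{0..1}. X t \<omega>)"
      by (rule filterlim_compose[OF elim k])
    then show ?case by (intro tendsto_intros uk)
  qed
  show "AE \<omega> in M. norm (exp (- v m * grid_max (k m) \<omega>)) \<le> 1" for m
    using uk(1)[of m] grid_max_nonneg by (auto intro!: AE_I2)
qed auto

end

context stable_levy_process
begin

definition walk :: "nat \<Rightarrow> 'a \<Rightarrow> real" where
  "walk i \<omega> = X (real (Suc i)) \<omega> - X (real i) \<omega>"

lemma measurable_walk [measurable]: "walk i \<in> borel_measurable M"
  unfolding walk_def by (intro measurable_increment) auto

lemma indep_grid_increments:
  "0 < n \<Longrightarrow> indep_vars (\<lambda>_. borel) (\<lambda>i \<omega>. X (real (Suc i) / real n) \<omega> - X (real i / real n) \<omega>) {..<k}"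
  by (rule indep_increments) (auto simp: field_simps)

text \<open>
  Stationarity moves the increment to the origin, and scaling turns it into a unit increment.
\<close>

lemma law_grid_increment:
  assumes n: "0 < n"
  shows "distr M borel (\<lambda>\<omega>. X (real (Suc i) / real n) \<omega> - X (real i / real n) \<omega>) =
         distr M borel (\<lambda>\<omega>. real n powr (- 1 / \<alpha>) * X 1 \<omega>)"
proof -
  have "distr M borel (\<lambda>\<omega>. X (real (Suc i) / real n) \<omega> - X (real i / real n) \<omega>) =
      distr M borel (\<lambda>\<omega>. X (real i / real n + 1 / real n) \<omega> - X (real i / real n) \<omega>)"
    by (simp add: add_divide_distrib ac_simps)
  also have "\<dots> = distr M borel (X (1 / real n))" by (rule stationary_increments) auto
  also have "\<dots> = distr M borel (\<lambda>\<omega>. (1 / real n) powr (1 / \<alpha>) * X 1 \<omega>)"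
    using scaling[of "1 / real n" 1] n by simp
  also have "(1 / real n) powr (1 / \<alpha>) = real n powr (- 1 / \<alpha>)"
    using n by (simp add: powr_divide powr_minus_divide)
  finally show ?thesis .
qed

lemma indep_walk: "indep_vars (\<lambda>_. borel) walk {..<k}"
  using indep_grid_increments[of 1 k] unfolding walk_def[abs_def] by simp

lemma law_walk: "distr M borel (walk i) = distr M borel (X 1)"
  using law_grid_increment[of 1 i] unfolding walk_def[abs_def] by simp

lemma grid_max_laplace:
  assumes n: "0 < n"
  shows "expectation (\<lambda>\<omega>. exp (- u * grid_max n \<omega>)) =
    expectation (\<lambda>\<omega>. exp (- (u * real n powr (- 1 / \<alpha>)) * max_partial_sum n (\<lambda>i. walk i \<omega>)))"
proof -
  let ?c = "real n powr (- 1 / \<alpha>)"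
  have [measurable]: "X 1 \<in> borel_measurable M" by (rule measurable_X) simp
  have *: "distr M borel (grid_max n) = distr M borel (\<lambda>\<omega>. max_partial_sum n (\<lambda>i. ?c * walk i \<omega>))"
    unfolding grid_max_def[abs_def]
  proof (rule max_partial_sum_law_eq)
    show "indep_vars (\<lambda>_. borel) (\<lambda>i \<omega>. ?c * walk i \<omega>) {..<n}"
      by (rule indep_vars_compose2[OF indep_walk]) auto
    fix i
    have "distr M borel (\<lambda>\<omega>. ?c * walk i \<omega>) = distr (distr M borel (walk i)) borel (\<lambda>x. ?c * x)"
      by (subst distr_distr) (auto simp: o_def)
    also have "\<dots> = distr M borel (\<lambda>\<omega>. ?c * X 1 \<omega>)"
      unfolding law_walk by (subst distr_distr) (auto simp: o_def)
    finally show "distr M borel (\<lambda>\<omega>. X (real (Suc i) / real n) \<omega> - X (real i / real n) \<omega>) =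
        distr M borel (\<lambda>\<omega>. ?c * walk i \<omega>)"
      using law_grid_increment[OF n, of i] by simp
  qed (rule indep_grid_increments[OF n])
  have "expectation (\<lambda>\<omega>. exp (- u * grid_max n \<omega>)) = (\<integral>x. exp (- u * x) \<partial>distr M borel (grid_max n))"
    by (subst integral_distr) auto
  also have "\<dots> = expectation (\<lambda>\<omega>. exp (- u * max_partial_sum n (\<lambda>i. ?c * walk i \<omega>)))"
    unfolding * by (subst integral_distr) auto
  finally show ?thesis by (simp add: max_partial_sum_scale mult.assoc)
qed

end

text \<open>
  The standing assumptions for computing the transform of the supremum.
\<close>

locale stable_levy_laplace = stable_levy_process +
  assumes alpha_gt_1: "1 < \<alpha>" and alpha_lt_2: "\<alpha> < 2"
    and laplace: "\<And>u. 0 \<le> u \<Longrightarrow> expectation (\<lambda>\<omega>. exp (- u * X 1 \<omega>)) = exp (u powr \<alpha>)"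
begin

definition walk_laplace :: "nat \<Rightarrow> real \<Rightarrow> real" where
  "walk_laplace k u = expectation (\<lambda>\<omega>. exp (- u * max_partial_sum k (\<lambda>i. walk i \<omega>)))"

text \<open>
  What the recursion \<open>M = max 0 a\<close> of the maximum discards, namely the negative part of \<open>a\<close>.
\<close>

definition undershoot :: "nat \<Rightarrow> 'a \<Rightarrow> real" where
  "undershoot k \<omega> = max 0 (- (walk 0 \<omega> + max_partial_sum k (\<lambda>i. walk (Suc i) \<omega>)))"

lemma measurable_undershoot [measurable]: "undershoot k \<in> borel_measurable M"
  unfolding undershoot_def by measurable

lemma undershoot_nonneg: "0 \<le> undershoot k \<omega>"
  unfolding undershoot_def by simp

text \<open>
  The Bochner integral of a non-integrable function is zero, so a positive value of the transform
  entails integrability.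
\<close>

lemma walk_exp:
  assumes "0 \<le> u"
  shows "integrable M (\<lambda>\<omega>. exp (- u * walk 0 \<omega>))"
    and "expectation (\<lambda>\<omega>. exp (- u * walk 0 \<omega>)) = exp (u powr \<alpha>)"
proof -
  have [measurable]: "X 1 \<in> borel_measurable M" by (rule measurable_X) simp
  have "expectation (\<lambda>\<omega>. exp (- u * walk 0 \<omega>)) = (\<integral>x. exp (- u * x) \<partial>distr M borel (walk 0))"
    by (subst integral_distr) auto
  also have "\<dots> = expectation (\<lambda>\<omega>. exp (- u * X 1 \<omega>))"
    unfolding law_walk by (subst integral_distr) auto
  finally show *: "expectation (\<lambda>\<omega>. exp (- u * walk 0 \<omega>)) = exp (u powr \<alpha>)"
    using laplace[OF assms] by simp
  show "integrable M (\<lambda>\<omega>. exp (- u * walk 0 \<omega>))"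
    using * not_integrable_integral_eq[of M "\<lambda>\<omega>. exp (- u * walk 0 \<omega>)"] by fastforce
qed

lemma integrable_exp_undershoot: "0 \<le> u \<Longrightarrow> integrable M (\<lambda>\<omega>. exp (u * undershoot k \<omega>))"
  unfolding undershoot_def
  by (rule max_partial_sum_laplace_Suc(1)[OF indep_walk measurable_walk _ walk_exp(1)]) (auto simp: law_walk)

lemma integrable_undershoot: "integrable M (undershoot k)"
proof (rule Bochner_Integration.integrable_bound[OF integrable_exp_undershoot[of 1 k]])
  show "AE \<omega> in M. norm (undershoot k \<omega>) \<le> norm (exp (1 * undershoot k \<omega>))"
  proof (rule AE_I2)
    fix \<omega>
    show "norm (undershoot k \<omega>) \<le> norm (exp (1 * undershoot k \<omega>))"
      using undershoot_nonneg[of k \<omega>] exp_ge_add_one_self[of "undershoot k \<omega>"]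
      unfolding real_norm_def mult_1 by linarith
  qed
qed auto

text \<open>
  The term linear in \<open>u\<close> is separated because its coefficient does not depend on \<open>u\<close>: in the limit it
  becomes the single unknown constant \<open>c\<close>.
\<close>

lemma walk_laplace_Suc:
  assumes "0 \<le> u"
  shows "walk_laplace (Suc k) u = exp (u powr \<alpha>) * walk_laplace k u - u * expectation (undershoot k)
    - expectation (\<lambda>\<omega>. exp (u * undershoot k \<omega>) - 1 - u * undershoot k \<omega>)"
proof -
  have "walk_laplace (Suc k) u = exp (u powr \<alpha>) * walk_laplace k u - expectation (\<lambda>\<omega>. exp (u * undershoot k \<omega>) - 1)"
    unfolding walk_laplace_def undershoot_def walk_exp(2)[OF assms, symmetric]
    by (rule max_partial_sum_laplace_Suc(2)[OF indep_walk measurable_walk _ walk_exp(1)]) (auto simp: law_walk assms)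
  also have "expectation (\<lambda>\<omega>. exp (u * undershoot k \<omega>) - 1) =
     expectation (\<lambda>\<omega>. exp (u * undershoot k \<omega>) - 1 - u * undershoot k \<omega>) + expectation (\<lambda>\<omega>. u * undershoot k \<omega>)"
    using integrable_exp_undershoot[OF assms] integrable_undershoot
    by (subst Bochner_Integration.integral_add[symmetric]) auto
  finally show ?thesis by simp
qed

lemma undershoot_error:
  assumes u: "0 \<le> u" "u \<le> 1"
  shows "0 \<le> expectation (\<lambda>\<omega>. exp (u * undershoot k \<omega>) - 1 - u * undershoot k \<omega>)" (is ?A)
    and "expectation (\<lambda>\<omega>. exp (u * undershoot k \<omega>) - 1 - u * undershoot k \<omega>) \<le> u\<^sup>2 * (exp 1 + 1)" (is ?B)
proof -
  show ?A using exp_ge_add_one_self[of "u * undershoot k _"] by (intro integral_nonneg_AE AE_I2) (simp add: algebra_simps)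
  have "expectation (\<lambda>\<omega>. exp (u * undershoot k \<omega>) - 1 - u * undershoot k \<omega>) \<le>
      expectation (\<lambda>\<omega>. u\<^sup>2 * (exp (- 1 * walk 0 \<omega>) + 1))"
  proof (rule integral_mono)
    show "integrable M (\<lambda>\<omega>. exp (u * undershoot k \<omega>) - 1 - u * undershoot k \<omega>)"
      using integrable_exp_undershoot[OF u(1)] integrable_undershoot by auto
    show "integrable M (\<lambda>\<omega>. u\<^sup>2 * (exp (- 1 * walk 0 \<omega>) + 1))"
      using walk_exp(1)[of 1] by auto
    fix \<omega>
    have D: "0 \<le> undershoot k \<omega>" "undershoot k \<omega> \<le> max 0 (- walk 0 \<omega>)"
      using max_partial_sum_nonneg[of k "\<lambda>i. walk (Suc i) \<omega>"] unfolding undershoot_def by auto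
    have "exp (u * undershoot k \<omega>) - 1 - u * undershoot k \<omega> \<le> u\<^sup>2 * (exp (undershoot k \<omega>) - 1 - undershoot k \<omega>)"
      by (rule exp_second_order_scale[OF u D(1)])
    also have "\<dots> \<le> u\<^sup>2 * (exp (- 1 * walk 0 \<omega>) + 1)"
    proof (rule mult_left_mono)
      have "exp (undershoot k \<omega>) \<le> exp (max 0 (- walk 0 \<omega>))" using D by simp
      also have "\<dots> \<le> exp (- 1 * walk 0 \<omega>) + 1" by (simp add: max_def)
      finally show "exp (undershoot k \<omega>) - 1 - undershoot k \<omega> \<le> exp (- 1 * walk 0 \<omega>) + 1" using D by linarith
    qed simp
    finally show "exp (u * undershoot k \<omega>) - 1 - u * undershoot k \<omega> \<le> u\<^sup>2 * (exp (- 1 * walk 0 \<omega>) + 1)" .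
  qed
  also have "\<dots> = u\<^sup>2 * (exp 1 + 1)"
    using walk_exp[of 1] by (simp add: prob_space)
  finally show ?B .
qed

abbreviation sup_laplace :: "real \<Rightarrow> real" where
  "sup_laplace u \<equiv> expectation (\<lambda>\<omega>. exp (- u * (SUP t\<in>{0..1}. X t \<omega>)))"

lemma walk_laplace_le_1: "0 \<le> u \<Longrightarrow> walk_laplace k u \<le> 1" and walk_laplace_nonneg: "0 \<le> walk_laplace k u"
proof -
  show "0 \<le> walk_laplace k u" unfolding walk_laplace_def by (intro integral_nonneg_AE) auto
  assume "0 \<le> u"
  then have "walk_laplace k u \<le> expectation (\<lambda>_. 1)" unfolding walk_laplace_def
    using max_partial_sum_nonneg
    by (intro integral_mono integrable_const_bound[where B=1] AE_I2) auto
  then show "walk_laplace k u \<le> 1" by (simp add: prob_space)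
qed

text \<open>
  For \<open>k = \<lfloor>n s\<rfloor>\<close> the walk with \<open>k\<close> steps and argument \<open>u n\<^sup>-\<^sup>1\<^sup>/\<^sup>\<alpha>\<close> has the transform of the grid
  maximum with \<open>k\<close> points at \<open>u (k/n)\<^sup>1\<^sup>/\<^sup>\<alpha>\<close>. Thus scaling takes the place of the supremum over \<open>[0, s]\<close>.
\<close>

lemma walk_laplace_tendsto:
  assumes u: "0 \<le> u" and s: "0 \<le> s"
  shows "(\<lambda>n. walk_laplace (nat \<lfloor>real n * s\<rfloor>) (u * real n powr (- 1 / \<alpha>))) \<longlonglongrightarrow> sup_laplace (u * s powr (1 / \<alpha>))"
proof (cases "s = 0")
  case True
  then show ?thesis by (simp add: walk_laplace_def prob_space)
next
  case False
  with s have s: "0 < s" by simp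
  let ?k = "\<lambda>n. nat \<lfloor>real n * s\<rfloor>" and ?v = "\<lambda>n. u * (real (nat \<lfloor>real n * s\<rfloor>) / real n) powr (1 / \<alpha>)"
  have "(\<lambda>n. expectation (\<lambda>\<omega>. exp (- ?v n * grid_max (?k n) \<omega>))) \<longlonglongrightarrow> sup_laplace (u * s powr (1 / \<alpha>))"
  proof (rule grid_max_laplace_tendsto)
    show "?v \<longlonglongrightarrow> u * s powr (1 / \<alpha>)"
      using s alpha_gt_1 by (intro tendsto_intros floor_grid_tendsto) auto
    show "filterlim ?k at_top sequentially"
      by (intro filterlim_compose[OF filterlim_nat_sequentially]
          filterlim_compose[OF filterlim_floor_sequentially]
          filterlim_at_top_mult_tendsto_pos[OF tendsto_const s] filterlim_real_sequentially)
  qed (use u s in auto)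
  moreover have "eventually (\<lambda>n. expectation (\<lambda>\<omega>. exp (- ?v n * grid_max (?k n) \<omega>)) =
      walk_laplace (?k n) (u * real n powr (- 1 / \<alpha>))) sequentially"
    using eventually_gt_at_top[of "nat \<lceil>1 / s\<rceil>"]
  proof eventually_elim
    case (elim n)
    have "1 / s \<le> real n" using elim by linarith
    with s have "1 \<le> real n * s" by (simp add: field_simps)
    then have "1 \<le> \<lfloor>real n * s\<rfloor>" by linarith
    then have k: "0 < ?k n" by simp
    have n: "0 < n" using elim by simp
    have *: "u * (real m / real n) powr (1 / \<alpha>) * real m powr (- 1 / \<alpha>) = u * real n powr (- 1 / \<alpha>)" if "0 < m" for m
      using that n by (simp add: powr_divide powr_minus_divide)
    have "?v n * real (?k n) powr (- 1 / \<alpha>) = u * real n powr (- 1 / \<alpha>)"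
      using * [OF k] .
    then show ?case unfolding walk_laplace_def grid_max_laplace[OF k, of "?v n"] by (rule arg_cong)
  qed
  ultimately show ?thesis by (rule Lim_transform_eventually)
qed

text \<open>
  Summation of the recursion over \<open>k < n\<close> leaves three terms: a Riemann sum of \<open>\<phi>\<close>, an error that
  vanishes because \<open>1 - 2/\<alpha> < 0\<close>, and \<open>u\<close> times a sequence \<open>q\<close> free of \<open>u\<close>. The other terms
  converge, so \<open>q\<close> does as well, and its limit is the constant.
\<close>

lemma sup_laplace_identity:
  obtains c where "\<And>u. 0 < u \<Longrightarrow> (\<lambda>s. sup_laplace (u * s powr (1 / \<alpha>))) integrable_on {0..1}"
    "\<And>u. 0 < u \<Longrightarrow> sup_laplace u =
       1 + u powr \<alpha> * integral {0..1} (\<lambda>s. sup_laplace (u * s powr (1 / \<alpha>))) - u * c"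
proof -
  \<comment> \<open>Argument at which the walk of n unit steps has the transform of the grid
    maximum at u.\<close>
  define U where "U u n = u * real n powr (- 1 / \<alpha>)" for u :: real and n
  define q where "q n = real n powr (- 1 / \<alpha>) * (\<Sum>k<n. expectation (undershoot k))" for n
  define E where "E u n = (\<Sum>k<n. expectation (\<lambda>\<omega>. exp (U u n * undershoot k \<omega>) - 1 - U u n * undershoot k \<omega>))" for u n
  define A where "A u = integral {0..1} (\<lambda>s. sup_laplace (u * s powr (1 / \<alpha>)))" for u
  have int: "(\<lambda>s. sup_laplace (u * s powr (1 / \<alpha>))) integrable_on {0..1}"
    and A: "(\<lambda>n. (\<Sum>k<n. walk_laplace k (U u n)) / real n) \<longlonglongrightarrow> A u" if u: "0 < u" for u
  proof -
    have F: "((\<lambda>s. walk_laplace (nat \<lfloor>real (Suc n) * s\<rfloor>) (U u (Suc n))) has_integral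
        (\<Sum>k<Suc n. walk_laplace k (U u (Suc n))) / real (Suc n)) {0..1}" for n
      using has_integral_floor_step[of "Suc n" "\<lambda>k. walk_laplace k (U u (Suc n))" "Suc n"]
      by (simp del: of_nat_Suc sum.lessThan_Suc)
    have U0: "0 \<le> U u n" for n using u by (simp add: U_def)
    let ?f = "\<lambda>n s. walk_laplace (nat \<lfloor>real (Suc n) * s\<rfloor>) (U u (Suc n))"
    have f_int: "?f n integrable_on {0..1}" for n
      by (rule has_integral_integrable[OF F])
    have f_le: "norm (?f n s) \<le> 1" for n s
      using walk_laplace_le_1[OF U0] walk_laplace_nonneg by simp
    have f_lim: "(\<lambda>n. ?f n s) \<longlonglongrightarrow> sup_laplace (u * s powr (1 / \<alpha>))" if "s \<in> {0..1}" for s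
      using LIMSEQ_Suc[OF walk_laplace_tendsto[of u s]] that u unfolding U_def by auto
    note dc = dominated_convergence[where f="?f" and h="\<lambda>_. 1" and g="\<lambda>s. sup_laplace (u * s powr (1 / \<alpha>))" and S="{0..1}", OF f_int _ f_le f_lim]
    show "(\<lambda>s. sup_laplace (u * s powr (1 / \<alpha>))) integrable_on {0..1}" by (rule dc(1)) auto
    have dc2: "(\<lambda>n. integral {0..1} (?f n)) \<longlonglongrightarrow> A u" unfolding A_def by (rule dc(2)) auto
    have "(\<lambda>n. (\<Sum>k<Suc n. walk_laplace k (U u (Suc n))) / real (Suc n)) \<longlonglongrightarrow> A u"
      using dc2 unfolding integral_unique[OF F] .
    then show "(\<lambda>n. (\<Sum>k<n. walk_laplace k (U u n)) / real n) \<longlonglongrightarrow> A u"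
      by (rule LIMSEQ_imp_Suc)
  qed
  have U_powr: "U u n powr \<alpha> = u powr \<alpha> / real n" if "0 < u" "0 < n" for u n
    using that alpha_gt_1 by (simp add: U_def powr_mult powr_powr powr_minus_divide powr_divide)
  have tele: "walk_laplace n (U u n) = 1 + (exp (u powr \<alpha> / real n) - 1) * (\<Sum>k<n. walk_laplace k (U u n)) - u * q n - E u n"
    if u: "0 < u" "0 < n" for u n
  proof -
    have U0: "0 \<le> U u n" using u by (simp add: U_def)
    have "walk_laplace m (U u n) = 1 + (exp (U u n powr \<alpha>) - 1) * (\<Sum>k<m. walk_laplace k (U u n))
       - U u n * (\<Sum>k<m. expectation (undershoot k))
       - (\<Sum>k<m. expectation (\<lambda>\<omega>. exp (U u n * undershoot k \<omega>) - 1 - U u n * undershoot k \<omega>))" for m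
    proof (induction m)
      case 0 then show ?case by (simp add: walk_laplace_def prob_space)
    next
      case (Suc m)
      then show ?case using walk_laplace_Suc[OF U0, of m] by (simp add: algebra_simps)
    qed
    from this[of n] show ?thesis unfolding U_powr[OF u] by (simp add: E_def q_def U_def mult.assoc)
  qed
  have U_lim: "(\<lambda>n. U u n) \<longlonglongrightarrow> 0" for u
    unfolding U_def using alpha_gt_1
    by (intro tendsto_mult_right_zero tendsto_neg_powr filterlim_real_sequentially) simp
  have E_lim: "E u \<longlonglongrightarrow> 0" if u: "0 < u" for u
  proof (rule tendsto_sandwich[where f="\<lambda>_. 0" and h="\<lambda>n. real n * ((U u n)\<^sup>2 * (exp 1 + 1))"])
    have ev: "eventually (\<lambda>n. U u n < 1) sequentially" using order_tendstoD(2)[OF U_lim[of u], of 1] by simp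
    then show "eventually (\<lambda>n. 0 \<le> E u n) sequentially"
      by eventually_elim (use u in \<open>auto simp: E_def U_def intro!: sum_nonneg undershoot_error(1)\<close>)
    from ev show "eventually (\<lambda>n. E u n \<le> real n * ((U u n)\<^sup>2 * (exp 1 + 1))) sequentially"
    proof eventually_elim
      case (elim n)
      have "E u n \<le> (\<Sum>k<n. (U u n)\<^sup>2 * (exp 1 + 1))"
        unfolding E_def using elim u by (intro sum_mono undershoot_error(2)) (auto simp: U_def)
      then show ?case by simp
    qed
    have "(\<lambda>n. real n powr (1 - 2 / \<alpha>)) \<longlonglongrightarrow> 0"
      using alpha_gt_1 alpha_lt_2 by (intro tendsto_neg_powr filterlim_real_sequentially) (simp add: field_simps)
    then have "(\<lambda>n. u\<^sup>2 * (exp 1 + 1) * real n powr (1 - 2 / \<alpha>)) \<longlonglongrightarrow> u\<^sup>2 * (exp 1 + 1) * 0"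
      by (intro tendsto_intros)
    moreover have "eventually (\<lambda>n. u\<^sup>2 * (exp 1 + 1) * real n powr (1 - 2 / \<alpha>) = real n * ((U u n)\<^sup>2 * (exp 1 + 1))) sequentially"
      using eventually_gt_at_top[of 0]
    proof eventually_elim
      case (elim n)
      have "real n powr (1 - 2 / \<alpha>) = real n powr 1 * (real n powr (- 1 / \<alpha>) * real n powr (- 1 / \<alpha>))"
        unfolding powr_add[symmetric] by simp
      then show ?case using elim by (simp add: U_def power2_eq_square)
    qed
    ultimately show "(\<lambda>n. real n * ((U u n)\<^sup>2 * (exp 1 + 1))) \<longlonglongrightarrow> 0"
      unfolding mult_zero_right by (rule Lim_transform_eventually)
  qed simp
  have W_lim: "(\<lambda>n. walk_laplace n (U u n)) \<longlonglongrightarrow> sup_laplace u" if u: "0 < u" for u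
    using walk_laplace_tendsto[of u 1] u by (simp add: U_def)
  have q_lim: "(\<lambda>n. u * q n) \<longlonglongrightarrow> 1 + u powr \<alpha> * A u - sup_laplace u" if u: "0 < u" for u
  proof -
    \<comment> \<open>The factor of the sum of transforms, times n.\<close>
    have e: "(\<lambda>n. real n * (exp (u powr \<alpha> / real n) - 1)) \<longlonglongrightarrow> u powr \<alpha>"
    proof -
      define x where "x = u powr \<alpha>"
      show ?thesis unfolding x_def[symmetric] by real_asymp
    qed
    have "(\<lambda>n. 1 + real n * (exp (u powr \<alpha> / real n) - 1) * ((\<Sum>k<n. walk_laplace k (U u n)) / real n)
         - E u n - walk_laplace n (U u n)) \<longlonglongrightarrow> 1 + u powr \<alpha> * A u - 0 - sup_laplace u"
      by (intro tendsto_intros e A E_lim W_lim u)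
    moreover have "eventually (\<lambda>n. 1 + real n * (exp (u powr \<alpha> / real n) - 1) * ((\<Sum>k<n. walk_laplace k (U u n)) / real n)
         - E u n - walk_laplace n (U u n) = u * q n) sequentially"
      using eventually_gt_at_top[of 0]
    proof eventually_elim
      case (elim n)
      show ?case using elim by (subst tele[OF u elim]) simp
    qed
    ultimately show ?thesis unfolding diff_0_right by (rule Lim_transform_eventually)
  qed
  have q1: "q \<longlonglongrightarrow> 1 + A 1 - sup_laplace 1" using q_lim[of 1] by simp
  show ?thesis
  proof (rule that[of "1 + A 1 - sup_laplace 1"])
    fix u :: real assume u: "0 < u"
    show "(\<lambda>s. sup_laplace (u * s powr (1 / \<alpha>))) integrable_on {0..1}" by (rule int[OF u])
    have "1 + u powr \<alpha> * A u - sup_laplace u = u * (1 + A 1 - sup_laplace 1)"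
      by (rule LIMSEQ_unique[OF q_lim[OF u] tendsto_mult_left[OF q1]])
    then show "sup_laplace u = 1 + u powr \<alpha> * integral {0..1} (\<lambda>s. sup_laplace (u * s powr (1 / \<alpha>))) - u * (1 + A 1 - sup_laplace 1)"
      unfolding A_def by linarith
  qed
qed

end

section \<open>The Laplace transform of the supremum\<close>

lemma has_integral_atLeast_tendsto:
  fixes f :: "real \<Rightarrow> real"
  assumes f: "(f has_integral I) {a..}" and nn: "\<And>x. a \<le> x \<Longrightarrow> 0 \<le> f x"
  shows "((\<lambda>b. integral {a..b} f) \<longlongrightarrow> I) at_top"
proof -
  have ai: "f absolutely_integrable_on {a..}"
    using f nn by (intro nonnegative_absolutely_integrable_1) auto
  have ai': "f absolutely_integrable_on {a..b}" for b
    by (rule set_integrable_subset[OF ai]) auto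
  have "((\<lambda>b. LINT x:{a..b}|lebesgue. f x) \<longlongrightarrow> (LINT x:{a..}|lebesgue. f x)) at_top"
    using ai by (intro tendsto_set_lebesgue_integral_at_top ai') auto
  moreover have "(LINT x:{a..b}|lebesgue. f x) = integral {a..b} f" for b
    by (rule set_lebesgue_integral_eq_integral(2)[OF ai'])
  moreover have "(LINT x:{a..}|lebesgue. f x) = I"
    using set_lebesgue_integral_eq_integral(2)[OF ai] f by (simp add: integral_unique)
  ultimately show ?thesis by simp
qed

lemma mult_exp_minus_le: "x * exp (- u * x) \<le> 1 / u" if "0 < u" for u x :: real
proof -
  have "u * x \<le> exp (u * x)" using exp_ge_add_one_self[of "u * x"] by linarith
  then have "u * x * exp (- u * x) \<le> exp (u * x) * exp (- u * x)" by (intro mult_right_mono) auto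
  then show ?thesis using that by (simp add: field_simps flip: exp_add)
qed

context stable_levy_laplace
begin

abbreviation "supremum \<omega> \<equiv> (SUP t\<in>{0..1}. X t \<omega>)"

lemma sup_laplace_bounds: 
  assumes "0 \<le> u" shows "integrable M (\<lambda>\<omega>. exp (- u * supremum \<omega>))" "0 \<le> sup_laplace u" "sup_laplace u \<le> 1"
proof -
  show i: "integrable M (\<lambda>\<omega>. exp (- u * supremum \<omega>))"
    using AE_supremum_nonneg assms by (intro integrable_const_bound[where B=1]) (auto elim!: eventually_mono)
  show "0 \<le> sup_laplace u" by (intro integral_nonneg_AE) auto
  have "sup_laplace u \<le> expectation (\<lambda>_. 1)"
    using AE_supremum_nonneg assms by (intro integral_mono_AE i) (auto elim!: eventually_mono)
  then show "sup_laplace u \<le> 1" by (simp add: prob_space)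
qed

lemma continuous_on_sup_laplace: "continuous_on {0..} sup_laplace"
proof (rule continuous_on_sequentiallyI)
  fix v u assume v: "\<forall>n. v n \<in> {0..}" and u: "u \<in> {0..}" and lim: "v \<longlonglongrightarrow> (u :: real)"
  show "(\<lambda>n. sup_laplace (v n)) \<longlonglongrightarrow> sup_laplace u"
  proof (rule integral_dominated_convergence[where w="\<lambda>_. 1"])
    show "AE \<omega> in M. (\<lambda>n. exp (- v n * supremum \<omega>)) \<longlonglongrightarrow> exp (- u * supremum \<omega>)"
      by (intro AE_I2 tendsto_intros lim)
    show "AE \<omega> in M. norm (exp (- v n * supremum \<omega>)) \<le> 1" for n
      using AE_supremum_nonneg v[rule_format, of n] by (auto elim!: eventually_mono)
  qed auto
qed

text \<open>
  In the variable \<open>t = u\<^sup>\<alpha>\<close> the integral over \<open>[0, 1]\<close> becomes the primitive \<open>G\<close> of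
  \<open>g t = \<phi> (t\<^sup>1\<^sup>/\<^sup>\<alpha>)\<close>, and the identity becomes \<open>g = 1 + G - c t\<^sup>1\<^sup>/\<^sup>\<alpha>\<close> with \<open>G' = g\<close>.
\<close>

lemma sup_laplace_integral_equation:
  obtains c G where
    "\<And>t. 0 \<le> t \<Longrightarrow> sup_laplace (t powr (1 / \<alpha>)) = 1 + G t - c * t powr (1 / \<alpha>)"
    "\<And>t. 0 < t \<Longrightarrow> (G has_real_derivative sup_laplace (t powr (1 / \<alpha>))) (at t)"
    "continuous_on {0..} G" "\<And>t. 0 \<le> t \<Longrightarrow> \<bar>G t\<bar> \<le> t"
proof -
  define g where "g t = sup_laplace (t powr (1 / \<alpha>))" for t
  define G where "G t = integral {0..t} g" for t
  have g_cont: "continuous_on {0..} g" unfolding g_def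
    using alpha_gt_1
    by (intro continuous_on_compose2[OF continuous_on_sup_laplace] continuous_on_powr' continuous_intros) auto
  have g_int: "g integrable_on {0..t}" for t
    by (intro integrable_continuous_real continuous_on_subset[OF g_cont]) auto
  have G_deriv: "(G has_real_derivative g t) (at t within {0..b})" if "t \<in> {0..b}" for t b
    unfolding G_def
    by (rule integral_has_real_derivative) (use that in \<open>auto intro!: continuous_on_subset[OF g_cont]\<close>)
  have G_deriv': "(G has_real_derivative g t) (at t)" if "0 < t" for t
    using G_deriv[of t "t + 1"] that at_within_interior[of t "{0..t+1}"] by simp
  have G0: "G 0 = 0" by (simp add: G_def)
  have G_cont: "continuous_on {0..b} G" for b
    unfolding continuous_on_eq_continuous_within
    by (intro ballI DERIV_continuous[OF G_deriv])
  obtain c where "\<And>u. 0 < u \<Longrightarrow> (\<lambda>s. sup_laplace (u * s powr (1 / \<alpha>))) integrable_on {0..1}"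
    and c: "\<And>u. 0 < u \<Longrightarrow> sup_laplace u =
       1 + u powr \<alpha> * integral {0..1} (\<lambda>s. sup_laplace (u * s powr (1 / \<alpha>))) - u * c"
    by (rule sup_laplace_identity) (rule that)
  have eq: "g t = 1 + G t - c * t powr (1 / \<alpha>)" if t: "0 \<le> t" for t
  proof (cases "t = 0")
    case True then show ?thesis using G0 by (simp add: g_def prob_space)
  next
    case False
    with t have t: "0 < t" by simp
    let ?u = "t powr (1 / \<alpha>)"
    have 1: "?u * s powr (1 / \<alpha>) = (t * s) powr (1 / \<alpha>)" if "s \<in> {0..1}" for s
      using t that by (simp add: powr_mult)
    \<comment> \<open>The substitution of t s for s, by means of the antiderivative G (t s) /
      t.\<close>
    have "((\<lambda>s. g (t * s)) has_integral G (t * 1) / t - G (t * 0) / t) {0..1}"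
    proof (rule fundamental_theorem_of_calculus)
      fix s :: real assume s: "s \<in> {0..1}"
      have "((\<lambda>s. G (t * s) / t) has_real_derivative g (t * s) * t / t) (at s within {0..1})"
      proof (rule DERIV_cdivide)
        have "(*) t ` {0..1} \<subseteq> {0..t}" using t by (auto simp: mult_left_le)
        moreover have "t * s \<in> {0..t}" using s t by (simp add: mult_left_le)
        ultimately have "(G has_real_derivative g (t * s)) (at (t * s) within (*) t ` {0..1})"
          using DERIV_subset[OF G_deriv] by blast
        moreover have "((*) t has_real_derivative t) (at s within {0..1})" by (auto intro!: derivative_eq_intros)
        ultimately have "(G \<circ> (*) t has_real_derivative g (t * s) * t) (at s within {0..1})"
          by (rule DERIV_image_chain)
        then show "((\<lambda>s. G (t * s)) has_real_derivative g (t * s) * t) (at s within {0..1})"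
          by (simp add: o_def)
      qed
      then show "((\<lambda>s. G (t * s) / t) has_vector_derivative g (t * s)) (at s within {0..1})"
        using t by (simp add: has_real_derivative_iff_has_vector_derivative)
    qed simp
    then have "integral {0..1} (\<lambda>s. g (t * s)) = G t / t" using G0 by (simp add: integral_unique)
    moreover have "integral {0..1} (\<lambda>s. g (t * s)) = integral {0..1} (\<lambda>s. sup_laplace (?u * s powr (1 / \<alpha>)))"
      unfolding g_def by (intro integral_cong) (simp add: 1)
    ultimately have I: "integral {0..1} (\<lambda>s. sup_laplace (?u * s powr (1 / \<alpha>))) = G t / t" by simp
    have "?u powr \<alpha> = t" "0 < ?u" using t alpha_gt_1 by (simp_all add: powr_powr)
    then show ?thesis using c[of ?u] t unfolding I g_def by simp
  qed
  have le: "\<bar>G t\<bar> \<le> t" if "0 \<le> t" for t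
  proof -
    have "norm (integral {0..t} g) \<le> 1 * (t - 0)"
      using that sup_laplace_bounds(2,3)
      by (intro integral_bound continuous_on_subset[OF g_cont]) (auto simp: g_def)
    then show ?thesis by (simp add: G_def)
  qed
  have cont: "continuous_on {0..} G"
    unfolding continuous_on_eq_continuous_within
  proof
    fix t :: real assume "t \<in> {0..}"
    then have "continuous (at t within {0..t + 1}) G"
      using G_cont[of "t + 1"] by (auto simp: continuous_on_eq_continuous_within)
    moreover have "at t within {0..t + 1} = at t within {0..}"
      by (rule at_within_nhd[of _ "{..<t + 1}"]) auto
    ultimately show "continuous (at t within {0..}) G" by simp
  qed
  show ?thesis by (rule that[OF eq[unfolded g_def] G_deriv'[unfolded g_def] cont le])
qed

text \<open>
  Solutions of \<open>G' = 1 + G - c t\<^sup>1\<^sup>/\<^sup>\<alpha>\<close> grow exponentially unless \<open>c\<close> has the right value. As \<open>\<bar>G t\<bar> \<le> t\<close>,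
  \<open>e\<^sup>-\<^sup>t G t\<close> tends to zero, that is, the integral of \<open>e\<^sup>-\<^sup>t (1 - c t\<^sup>1\<^sup>/\<^sup>\<alpha>)\<close> over the half-line vanishes;
  this is the equation \<open>c \<Gamma>(1 + 1/\<alpha>) = 1\<close>.
\<close>

lemma sup_laplace_ode:
  assumes u: "0 < u"
  shows "(sup_laplace has_real_derivative \<alpha> * u powr (\<alpha> - 1) * sup_laplace u - \<alpha> / Gamma (1 / \<alpha>)) (at u)"
proof -
  obtain c G where
    eq: "\<And>t. 0 \<le> t \<Longrightarrow> sup_laplace (t powr (1 / \<alpha>)) = 1 + G t - c * t powr (1 / \<alpha>)" and
    dG: "\<And>t. 0 < t \<Longrightarrow> (G has_real_derivative sup_laplace (t powr (1 / \<alpha>))) (at t)" and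
    contG: "continuous_on {0..} G" and G_le: "\<And>t. 0 \<le> t \<Longrightarrow> \<bar>G t\<bar> \<le> t"
    by (rule sup_laplace_integral_equation) (rule that)
  have "((\<lambda>t. exp (- t) * (1 - c * t powr (1 / \<alpha>))) has_integral exp (- T) * G T - exp (- 0) * G 0) {0..T}"
    if T: "0 \<le> T" for T
  proof (rule fundamental_theorem_of_calculus_interior[OF T])
    show "continuous_on {0..T} (\<lambda>t. exp (- t) * G t)"
      by (intro continuous_intros continuous_on_subset[OF contG]) auto
    fix t assume t: "t \<in> {0<..<T}"
    have dexp: "((\<lambda>t. exp (- t)) has_real_derivative exp (- t) * (- 1)) (at t)"
      by (auto intro!: derivative_eq_intros)
    have "((\<lambda>t. exp (- t) * G t) has_real_derivative
        exp (- t) * (- 1) * G t + sup_laplace (t powr (1 / \<alpha>)) * exp (- t)) (at t)"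
      using t by (intro DERIV_mult dexp dG) simp
    also have "exp (- t) * (- 1) * G t + sup_laplace (t powr (1 / \<alpha>)) * exp (- t) = exp (- t) * (1 - c * t powr (1 / \<alpha>))"
      using t by (subst eq) (simp_all add: algebra_simps)
    finally have "((\<lambda>t. exp (- t) * G t) has_real_derivative exp (- t) * (1 - c * t powr (1 / \<alpha>))) (at t)" .
    then show "((\<lambda>t. exp (- t) * G t) has_vector_derivative exp (- t) * (1 - c * t powr (1 / \<alpha>))) (at t)"
      by (simp add: has_real_derivative_iff_has_vector_derivative)
  qed
  then have int1: "integral {0..T} (\<lambda>t. exp (- t) * (1 - c * t powr (1 / \<alpha>))) = exp (- T) * G T" if "0 \<le> T" for T
    using that G_le[of 0] by (simp add: integral_unique)
  have Gam: "((\<lambda>t. exp (- t) * t powr b) has_integral Gamma (1 + b)) {0..}" if "0 \<le> b" for b :: real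
    using Gamma_integral_real[of "1 + b"] that by (simp add: exp_minus divide_inverse mult.commute)
  have Gam_lim: "((\<lambda>T. integral {0..T} (\<lambda>t. exp (- t) * t powr b)) \<longlongrightarrow> Gamma (1 + b)) at_top" if "0 \<le> b" for b :: real
    by (rule has_integral_atLeast_tendsto[OF Gam[OF that]]) auto
  have Gam_int: "(\<lambda>t. exp (- t) * t powr b) integrable_on {0..T}" if "0 < b" for b T :: real
    using that by (intro integrable_continuous_real continuous_on_mult continuous_on_powr' continuous_intros) auto
  have "((\<lambda>T. exp (- T) * G T) \<longlongrightarrow> 0) at_top"
  proof (rule Lim_null_comparison)
    show "eventually (\<lambda>T. norm (exp (- T) * G T) \<le> exp (- T) * T) at_top"
      using eventually_ge_at_top[of 0] by eventually_elim (auto simp: abs_mult intro: mult_left_mono G_le)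
    show "((\<lambda>T::real. exp (- T) * T) \<longlongrightarrow> 0) at_top" by real_asymp
  qed
  moreover have "eventually (\<lambda>T. exp (- T) * G T = (1 - exp (- T)) - c * integral {0..T} (\<lambda>t. exp (- t) * t powr (1 / \<alpha>))) at_top"
    using eventually_ge_at_top[of 0]
  proof eventually_elim
    case (elim T)
    have e: "((\<lambda>t. exp (- t)) has_integral (- exp (- T)) - (- exp (- 0))) {0..T}"
      using elim by (intro fundamental_theorem_of_calculus)
        (auto intro!: derivative_eq_intros simp flip: has_real_derivative_iff_has_vector_derivative)
    have p: "((\<lambda>t. exp (- t) * t powr (1 / \<alpha>)) has_integral integral {0..T} (\<lambda>t. exp (- t) * t powr (1 / \<alpha>))) {0..T}"
      using Gam_int alpha_gt_1 by (intro integrable_integral) auto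
    have "((\<lambda>t. exp (- t) - c * (exp (- t) * t powr (1 / \<alpha>))) has_integral
       (- exp (- T)) - (- exp (- 0)) - c * integral {0..T} (\<lambda>t. exp (- t) * t powr (1 / \<alpha>))) {0..T}"
      by (intro has_integral_diff e has_integral_mult_right p)
    then show ?case using int1[OF elim] by (simp add: algebra_simps integral_unique)
  qed
  ultimately have "((\<lambda>T. (1 - exp (- T)) - c * integral {0..T} (\<lambda>t. exp (- t) * t powr (1 / \<alpha>))) \<longlongrightarrow> 0) at_top"
    by (rule Lim_transform_eventually)
  moreover have "((\<lambda>T. (1 - exp (- T)) - c * integral {0..T} (\<lambda>t. exp (- t) * t powr (1 / \<alpha>))) \<longlongrightarrow> (1 - 0) - c * Gamma (1 + 1 / \<alpha>)) at_top"
    using alpha_gt_1 by (intro tendsto_intros Gam_lim) (auto, real_asymp)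
  ultimately have "c * Gamma (1 + 1 / \<alpha>) = 1"
    using tendsto_unique[OF trivial_limit_at_top_linorder] by fastforce
  moreover have "Gamma (1 + 1 / \<alpha>) = Gamma (1 / \<alpha>) / \<alpha>"
  proof -
    have "0 < 1 / \<alpha>" using alpha_gt_1 by simp
    then have "1 / \<alpha> \<notin> \<int>\<^sub>\<le>\<^sub>0" by (auto dest: nonpos_Ints_nonpos)
    from Gamma_plus1[OF this] show ?thesis by (simp add: add.commute)
  qed
  ultimately have "c * Gamma (1 / \<alpha>) = \<alpha>" using alpha_gt_1 by (simp add: divide_eq_eq)
  moreover have "Gamma (1 / \<alpha>) > 0" using alpha_gt_1 by (intro Gamma_real_pos) auto
  ultimately have c: "c = \<alpha> / Gamma (1 / \<alpha>)" by (simp add: eq_divide_eq)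
  have *: "sup_laplace v = 1 + G (v powr \<alpha>) - c * v" if "0 < v" for v
    using eq[of "v powr \<alpha>"] that alpha_gt_1 by (simp add: powr_powr)
  have "((\<lambda>v. 1 + G (v powr \<alpha>) - c * v) has_real_derivative
      sup_laplace ((u powr \<alpha>) powr (1 / \<alpha>)) * (\<alpha> * u powr (\<alpha> - 1)) - c) (at u)"
    using u by (auto intro!: derivative_eq_intros DERIV_chain2[OF dG])
  then have "(sup_laplace has_real_derivative
      sup_laplace ((u powr \<alpha>) powr (1 / \<alpha>)) * (\<alpha> * u powr (\<alpha> - 1)) - c) (at u)"
    by (rule has_field_derivative_transform_within_open[where S="{0<..}"]) (use u * in auto)
  then show ?thesis using u alpha_gt_1 by (simp add: c powr_powr mult.commute)
qed

text \<open>
  The expectation of \<open>S e\<^sup>-\<^sup>u\<^sup>S\<close> is minus the derivative of \<open>\<phi>\<close>, by dominated convergence of the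
  difference quotients, which are bounded by \<open>1/u\<close>.
\<close>

theorem sup_laplace_size_biased:
  assumes u: "0 < u"
  shows "integrable M (\<lambda>\<omega>. supremum \<omega> * exp (- u * supremum \<omega>))"
    and "expectation (\<lambda>\<omega>. supremum \<omega> * exp (- u * supremum \<omega>)) + \<alpha> * u powr (\<alpha> - 1) * sup_laplace u = \<alpha> / Gamma (1 / \<alpha>)"
proof -
  show int: "integrable M (\<lambda>\<omega>. supremum \<omega> * exp (- u * supremum \<omega>))"
    using AE_supremum_nonneg mult_exp_minus_le[OF u]
    by (intro integrable_const_bound[where B="1 / u"]) (auto elim!: eventually_mono simp: abs_mult)
  let ?q = "\<lambda>n \<omega>. (exp (- u * supremum \<omega>) - exp (- (u + 1 / real (Suc n)) * supremum \<omega>)) * real (Suc n)"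
  have lim: "(\<lambda>n. (exp (- u * x) - exp (- (u + 1 / real (Suc n)) * x)) * real (Suc n)) \<longlonglongrightarrow> x * exp (- u * x)" for x :: real
    by real_asymp
  have "(\<lambda>n. expectation (?q n)) \<longlonglongrightarrow> expectation (\<lambda>\<omega>. supremum \<omega> * exp (- u * supremum \<omega>))"
  proof (rule integral_dominated_convergence[where w="\<lambda>_. 1 / u"])
    show "AE \<omega> in M. (\<lambda>n. ?q n \<omega>) \<longlonglongrightarrow> supremum \<omega> * exp (- u * supremum \<omega>)"
      by (intro AE_I2 lim)
    show "AE \<omega> in M. norm (?q n \<omega>) \<le> 1 / u" for n
      using AE_supremum_nonneg
    proof eventually_elim
      case (elim \<omega>)
      let ?h = "1 / real (Suc n)"
      have "?q n \<omega> = exp (- u * supremum \<omega>) * (1 - exp (- (?h * supremum \<omega>))) * real (Suc n)"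
        by (simp add: algebra_simps flip: exp_add)
      moreover have "1 - exp (- (?h * supremum \<omega>)) \<le> ?h * supremum \<omega>"
        using exp_ge_add_one_self[of "- (?h * supremum \<omega>)"] by linarith
      then have "exp (- u * supremum \<omega>) * (1 - exp (- (?h * supremum \<omega>))) * real (Suc n) \<le>
          exp (- u * supremum \<omega>) * (?h * supremum \<omega>) * real (Suc n)"
        by (intro mult_left_mono mult_right_mono) auto
      moreover have "exp (- u * supremum \<omega>) * (?h * supremum \<omega>) * real (Suc n) = supremum \<omega> * exp (- u * supremum \<omega>)"
        by (simp del: of_nat_Suc)
      moreover have "0 \<le> exp (- u * supremum \<omega>) * (1 - exp (- (?h * supremum \<omega>))) * real (Suc n)"
        using elim by (intro mult_nonneg_nonneg) auto
      ultimately show ?case using mult_exp_minus_le[OF u, of "supremum \<omega>"]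
        unfolding real_norm_def by linarith
    qed
  qed auto
  moreover have "(\<lambda>n. expectation (?q n)) \<longlonglongrightarrow> - (\<alpha> * u powr (\<alpha> - 1) * sup_laplace u - \<alpha> / Gamma (1 / \<alpha>))"
  proof -
    have "((\<lambda>h. (sup_laplace (u + h) - sup_laplace u) / h) \<longlongrightarrow> \<alpha> * u powr (\<alpha> - 1) * sup_laplace u - \<alpha> / Gamma (1 / \<alpha>)) (at 0)"
      using sup_laplace_ode[OF u] unfolding DERIV_def .
    moreover have "filterlim (\<lambda>n. 1 / real (Suc n)) (at 0) sequentially"
      unfolding filterlim_at using LIMSEQ_inverse_real_of_nat by (auto simp: inverse_eq_divide)
    ultimately have "(\<lambda>n. (sup_laplace (u + 1 / real (Suc n)) - sup_laplace u) / (1 / real (Suc n))) \<longlonglongrightarrow>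
        \<alpha> * u powr (\<alpha> - 1) * sup_laplace u - \<alpha> / Gamma (1 / \<alpha>)"
      by (rule filterlim_compose)
    from tendsto_minus[OF this] show ?thesis
    proof (rule Lim_transform_eventually, intro always_eventually allI)
      fix n
      have "expectation (?q n) = (sup_laplace u - sup_laplace (u + 1 / real (Suc n))) * real (Suc n)"
        using sup_laplace_bounds(1)[of u] sup_laplace_bounds(1)[of "u + 1 / real (Suc n)"] u
        by (simp only: Bochner_Integration.integral_mult_left_zero Bochner_Integration.integral_diff less_imp_le add_nonneg_nonneg
             divide_nonneg_nonneg of_nat_0_le_iff zero_le_one)
      then show "- ((sup_laplace (u + 1 / real (Suc n)) - sup_laplace u) / (1 / real (Suc n))) = expectation (?q n)"
        by (simp add: algebra_simps)
    qed
  qed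
  ultimately show "expectation (\<lambda>\<omega>. supremum \<omega> * exp (- u * supremum \<omega>)) + \<alpha> * u powr (\<alpha> - 1) * sup_laplace u = \<alpha> / Gamma (1 / \<alpha>)"
    using LIMSEQ_unique by fastforce
qed

end

section \<open>Convolution on the half-line and fractional kernels\<close>

text \<open>
  Values in \<open>[0, \<infinity>]\<close> make associativity and commutativity unconditional consequences of Tonelli's
  theorem; signed functions are treated as pairs of such functions.
\<close>

definition nnconv :: "(real \<Rightarrow> ennreal) \<Rightarrow> (real \<Rightarrow> ennreal) \<Rightarrow> real \<Rightarrow> ennreal" where
  "nnconv f g x = (\<integral>\<^sup>+y. f (x - y) * g y \<partial>lborel)"

abbreviation nn_laplace :: "(real \<Rightarrow> ennreal) \<Rightarrow> real \<Rightarrow> ennreal" where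
  "nn_laplace f u \<equiv> (\<integral>\<^sup>+x. f x * ennreal (exp (- u * x)) \<partial>lborel)"

abbreviation cutoff_integral :: "(real \<Rightarrow> ennreal) \<Rightarrow> real \<Rightarrow> ennreal" where
  "cutoff_integral f T \<equiv> (\<integral>\<^sup>+x. f x * indicator {..T} x \<partial>lborel)"

lemma measurable_nnconv [measurable (raw)]:
  assumes [measurable]: "f \<in> borel_measurable borel" "g \<in> borel_measurable borel" "h \<in> borel_measurable M"
  shows "(\<lambda>x. nnconv f g (h x)) \<in> borel_measurable M"
proof -
  have "nnconv f g \<in> borel_measurable borel" unfolding nnconv_def[abs_def] by measurable
  from measurable_compose[OF assms(3) this] show ?thesis by (simp add: o_def)
qed

lemma nnconv_commute:
  assumes [measurable]: "f \<in> borel_measurable borel" "g \<in> borel_measurable borel"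
  shows "nnconv f g = nnconv g f"
proof
  fix x
  have "nnconv f g x = (\<integral>\<^sup>+y. f (x - (x + -1 * y)) * g (x + -1 * y) \<partial>lborel)"
    unfolding nnconv_def by (subst nn_integral_real_affine[of _ "-1" x]) auto
  then show "nnconv f g x = nnconv g f x" by (simp add: nnconv_def mult.commute)
qed

lemma nnconv_assoc:
  assumes [measurable]: "f \<in> borel_measurable borel" "g \<in> borel_measurable borel" "h \<in> borel_measurable borel"
  shows "nnconv f (nnconv g h) = nnconv (nnconv f g) h"
proof
  fix x
  have "nnconv f (nnconv g h) x = (\<integral>\<^sup>+y. (\<integral>\<^sup>+z. f (x - y) * (g (y - z) * h z) \<partial>lborel) \<partial>lborel)"
    unfolding nnconv_def by (subst nn_integral_cmult) auto
  also have "\<dots> = (\<integral>\<^sup>+z. (\<integral>\<^sup>+y. f (x - y) * (g (y - z) * h z) \<partial>lborel) \<partial>lborel)"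
    by (rule lborel_pair.Fubini') measurable
  also have "\<dots> = (\<integral>\<^sup>+z. (\<integral>\<^sup>+y. f (x - y) * g (y - z) \<partial>lborel) * h z \<partial>lborel)"
    by (subst nn_integral_multc[symmetric]) (auto simp: ac_simps)
  also have "\<dots> = (\<integral>\<^sup>+z. nnconv f g (x - z) * h z \<partial>lborel)"
  proof (rule nn_integral_cong)
    fix z
    have "(\<integral>\<^sup>+y. f (x - y) * g (y - z) \<partial>lborel) = nnconv f g (x - z)"
      unfolding nnconv_def by (subst nn_integral_real_affine[of _ 1 z]) (auto simp: algebra_simps)
    then show "(\<integral>\<^sup>+y. f (x - y) * g (y - z) \<partial>lborel) * h z = nnconv f g (x - z) * h z" by simp
  qed
  also have "\<dots> = nnconv (nnconv f g) h x" by (simp add: nnconv_def)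
  finally show "nnconv f (nnconv g h) x = nnconv (nnconv f g) h x" .
qed

lemma nnconv_add_right:
  assumes [measurable]: "f \<in> borel_measurable borel" "g \<in> borel_measurable borel" "h \<in> borel_measurable borel"
  shows "nnconv f (\<lambda>x. g x + h x) = (\<lambda>x. nnconv f g x + nnconv f h x)"
  unfolding nnconv_def by (auto simp: distrib_left nn_integral_add)

lemma nnconv_cmult_right:
  assumes [measurable]: "f \<in> borel_measurable borel" "g \<in> borel_measurable borel"
  shows "nnconv f (\<lambda>x. c * g x) = (\<lambda>x. c * nnconv f g x)"
  unfolding nnconv_def by (auto simp: mult.left_commute[of _ c] nn_integral_cmult)

lemma nn_laplace_nnconv:
  assumes [measurable]: "f \<in> borel_measurable borel" "g \<in> borel_measurable borel"
  shows "nn_laplace (nnconv f g) u =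
    nn_laplace f u * nn_laplace g u"
proof -
  have "nn_laplace (nnconv f g) u =
      (\<integral>\<^sup>+x. (\<integral>\<^sup>+y. f (x - y) * g y * ennreal (exp (- u * x)) \<partial>lborel) \<partial>lborel)"
    unfolding nnconv_def by (subst nn_integral_multc) auto
  also have "\<dots> = (\<integral>\<^sup>+y. (\<integral>\<^sup>+x. f (x - y) * g y * ennreal (exp (- u * x)) \<partial>lborel) \<partial>lborel)"
    by (rule lborel_pair.Fubini') measurable
  also have "\<dots> = (\<integral>\<^sup>+y. nn_laplace f u * (g y * ennreal (exp (- u * y))) \<partial>lborel)"
  proof (rule nn_integral_cong)
    fix y
    have "(\<integral>\<^sup>+x. f (x - y) * g y * ennreal (exp (- u * x)) \<partial>lborel) =
        (\<integral>\<^sup>+x. f x * ennreal (exp (- u * x)) * (g y * ennreal (exp (- u * y))) \<partial>lborel)"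
      by (subst nn_integral_real_affine[of _ 1 y])
        (auto simp: algebra_simps exp_add[symmetric] ennreal_mult[symmetric] intro!: nn_integral_cong)
    then show "(\<integral>\<^sup>+x. f (x - y) * g y * ennreal (exp (- u * x)) \<partial>lborel) =
        nn_laplace f u * (g y * ennreal (exp (- u * y)))"
      by (subst (asm) nn_integral_multc) auto
  qed
  finally show ?thesis by (subst (asm) nn_integral_cmult) auto
qed

text \<open>
  Convolution with this function is the Riemann--Liouville integral of order \<open>b\<close>; extended by zero
  to the left half-line, the integral over \<open>(0, x)\<close> becomes a convolution on the whole line.
\<close>

definition rl_kernel :: "real \<Rightarrow> real \<Rightarrow> ennreal" where
  "rl_kernel b x = ennreal (if 0 < x then x powr (b - 1) / Gamma b else 0)"

lemma measurable_rl_kernel [measurable]: "rl_kernel b \<in> borel_measurable borel"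
  unfolding rl_kernel_def[abs_def] by measurable

text \<open>
  Euler's integral for \<open>\<Gamma>\<close> after the substitution \<open>t = u x\<close>.
\<close>

lemma nn_laplace_rl_kernel:
  assumes b: "0 < b" and u: "0 < u"
  shows "nn_laplace (rl_kernel b) u = ennreal (u powr (- b))"
proof -
  have G: "Gamma b > 0" using b by (rule Gamma_real_pos)
  have "ennreal (Gamma b) = (\<integral>\<^sup>+t. ennreal (indicator {0..} t * t powr (b - 1) / exp t) \<partial>lborel)"
    by (rule Gamma_conv_nn_integral_real[OF b])
  also have "\<dots> = ennreal \<bar>u\<bar> * (\<integral>\<^sup>+x. ennreal (indicator {0..} (0 + u * x) * (0 + u * x) powr (b - 1) / exp (0 + u * x)) \<partial>lborel)"
    using u by (subst nn_integral_real_affine[of _ u 0]) auto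
  also have "(\<integral>\<^sup>+x. ennreal (indicator {0..} (0 + u * x) * (0 + u * x) powr (b - 1) / exp (0 + u * x)) \<partial>lborel) =
     (\<integral>\<^sup>+x. ennreal (u powr (b - 1) * Gamma b) * (rl_kernel b x * ennreal (exp (- u * x))) \<partial>lborel)"
  proof (intro nn_integral_cong)
    fix x :: real
    consider "x < 0" | "x = 0" | "0 < x" by linarith
    then show "ennreal (indicator {0..} (0 + u * x) * (0 + u * x) powr (b - 1) / exp (0 + u * x)) =
      ennreal (u powr (b - 1) * Gamma b) * (rl_kernel b x * ennreal (exp (- u * x)))"
    proof cases
      case 3
      then show ?thesis using u G by (simp add: rl_kernel_def powr_mult exp_minus field_simps flip: ennreal_mult)
    qed (use u in \<open>auto simp: rl_kernel_def mult_less_0_iff zero_le_mult_iff\<close>)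
  qed
  also have "\<dots> = ennreal (u powr (b - 1) * Gamma b) * nn_laplace (rl_kernel b) u"
    by (rule nn_integral_cmult) measurable
  finally have "ennreal (Gamma b) = ennreal (u * u powr (b - 1) * Gamma b) * nn_laplace (rl_kernel b) u"
    using u G by (simp add: ennreal_mult mult.assoc)
  also have "u * u powr (b - 1) = u powr b" using u by (simp add: powr_mult_base)
  finally have *: "ennreal (Gamma b) = ennreal (u powr b * Gamma b) * nn_laplace (rl_kernel b) u" .
  have "ennreal (u powr (- b)) = ennreal (u powr (- b) / Gamma b) * ennreal (Gamma b)"
    using G by (subst ennreal_mult[symmetric]) auto
  also have "\<dots> = ennreal (u powr (- b) / Gamma b * (u powr b * Gamma b)) * nn_laplace (rl_kernel b) u"
    using G by (subst *, subst mult.assoc[symmetric], subst ennreal_mult[symmetric]) auto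
  also have "u powr (- b) / Gamma b * (u powr b * Gamma b) = 1"
    using u G by (simp add: powr_minus field_simps)
  finally show ?thesis by simp
qed

text \<open>
  Euler's Beta integral after the substitution \<open>y = x t\<close>.
\<close>

lemma nn_integral_beta:
  assumes a: "0 < a" and b: "0 < b" and x: "0 < x"
  shows "(\<integral>\<^sup>+y. ennreal ((x - y) powr (a - 1) * y powr (b - 1)) * indicator {0<..<x} y \<partial>lborel) =
    ennreal (x powr (a + b - 1) * (Gamma a * Gamma b / Gamma (a + b)))"
proof -
  have B: "Beta b a \<ge> 0" using a b unfolding Beta_def by (intro divide_nonneg_nonneg mult_nonneg_nonneg) (auto simp: Gamma_real_pos less_imp_le)
  have "(\<integral>\<^sup>+y. ennreal ((x - y) powr (a - 1) * y powr (b - 1)) * indicator {0<..<x} y \<partial>lborel) =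
      ennreal \<bar>x\<bar> * (\<integral>\<^sup>+t. ennreal ((x - (0 + x * t)) powr (a - 1) * (0 + x * t) powr (b - 1)) * indicator {0<..<x} (0 + x * t) \<partial>lborel)"
    using x by (subst nn_integral_real_affine[of _ x 0]) auto
  also have "(\<integral>\<^sup>+t. ennreal ((x - (0 + x * t)) powr (a - 1) * (0 + x * t) powr (b - 1)) * indicator {0<..<x} (0 + x * t) \<partial>lborel) =
      (\<integral>\<^sup>+t. ennreal (x powr (a + b - 2)) * (ennreal (t powr (b - 1) * (1 - t) powr (a - 1)) * indicator {0..1} t) \<partial>lborel)"
  proof (rule nn_integral_cong_AE)
    have ne: "AE t in lborel. t \<noteq> (0::real) \<and> t \<noteq> 1" by (intro AE_conjI AE_lborel_singleton)
    show "AE t in lborel. ennreal ((x - (0 + x * t)) powr (a - 1) * (0 + x * t) powr (b - 1)) * indicator {0<..<x} (0 + x * t) =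
      ennreal (x powr (a + b - 2)) * (ennreal (t powr (b - 1) * (1 - t) powr (a - 1)) * indicator {0..1} t)"
      using ne
    proof eventually_elim
      case (elim t)
      show ?case
      proof (cases "0 < t \<and> t < 1")
        case True
        have "(x - (0 + x * t)) powr (a - 1) * (0 + x * t) powr (b - 1) = (x * (1 - t)) powr (a - 1) * (x * t) powr (b - 1)"
          by (simp add: algebra_simps)
        also have "\<dots> = (x powr (a - 1) * x powr (b - 1)) * (t powr (b - 1) * (1 - t) powr (a - 1))"
          using x True by (simp add: powr_mult)
        also have "x powr (a - 1) * x powr (b - 1) = x powr (a + b - 2)" by (simp flip: powr_add)
        finally show ?thesis using True x by (simp add: ennreal_mult indicator_def)
      next
        case False
        then have "\<not> (0 < x * t \<and> x * t < x)" using x by (auto simp: zero_less_mult_iff)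
        then show ?thesis using False elim by (auto simp: indicator_def)
      qed
    qed
  qed
  also have "\<dots> = ennreal (x powr (a + b - 2)) * ennreal (Beta b a)"
  proof (subst nn_integral_cmult)
    have "(\<integral>\<^sup>+t. ennreal (indicator {0..1} t * (t powr (b - 1) * (1 - t) powr (a - 1))) \<partial>lborel) = ennreal (Beta b a)"
      using has_integral_Beta_real[OF b a] by (intro nn_integral_has_integral_lebesgue) auto
    also have "(\<integral>\<^sup>+t. ennreal (indicator {0..1} t * (t powr (b - 1) * (1 - t) powr (a - 1))) \<partial>lborel) =
       (\<integral>\<^sup>+t. ennreal (t powr (b - 1) * (1 - t) powr (a - 1)) * indicator {0..1} t \<partial>lborel)"
      by (intro nn_integral_cong) (auto simp: indicator_def)
    finally show "ennreal (x powr (a + b - 2)) * (\<integral>\<^sup>+t. ennreal (t powr (b - 1) * (1 - t) powr (a - 1)) * indicator {0..1} t \<partial>lborel)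
       = ennreal (x powr (a + b - 2)) * ennreal (Beta b a)" by simp
  qed auto
  also have "ennreal \<bar>x\<bar> * (ennreal (x powr (a + b - 2)) * ennreal (Beta b a)) = ennreal (x * x powr (a + b - 2) * Beta b a)"
    using x B by (simp add: ennreal_mult mult.assoc)
  also have "x * x powr (a + b - 2) = x powr (a + b - 1)" using x by (simp add: powr_mult_base)
  also have "Beta b a = Gamma a * Gamma b / Gamma (a + b)" by (simp add: Beta_def add.commute mult.commute)
  finally show ?thesis .
qed

lemma nnconv_rl_kernel:
  assumes a: "0 < a" and b: "0 < b"
  shows "nnconv (rl_kernel a) (rl_kernel b) = rl_kernel (a + b)"
proof
  fix x :: real
  have G: "Gamma a > 0" "Gamma b > 0" "Gamma (a + b) > 0" using a b by (auto intro: Gamma_real_pos)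
  show "nnconv (rl_kernel a) (rl_kernel b) x = rl_kernel (a + b) x"
  proof (cases "0 < x")
    case False
    then have "nnconv (rl_kernel a) (rl_kernel b) x = (\<integral>\<^sup>+(y::real). 0 \<partial>lborel)"
      unfolding nnconv_def by (intro nn_integral_cong) (auto simp: rl_kernel_def)
    then show ?thesis using False by (simp add: rl_kernel_def)
  next
    case True
    have "nnconv (rl_kernel a) (rl_kernel b) x =
        (\<integral>\<^sup>+y. ennreal (1 / (Gamma a * Gamma b)) * (ennreal ((x - y) powr (a - 1) * y powr (b - 1)) * indicator {0<..<x} y) \<partial>lborel)"
      unfolding nnconv_def using G
      by (intro nn_integral_cong) (auto simp: rl_kernel_def indicator_def ennreal_mult[symmetric])
    also have "\<dots> = ennreal (1 / (Gamma a * Gamma b)) * ennreal (x powr (a + b - 1) * (Gamma a * Gamma b / Gamma (a + b)))"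
      by (subst nn_integral_cmult) (auto simp: nn_integral_beta[OF a b True])
    also have "\<dots> = rl_kernel (a + b) x"
      using G True by (simp add: rl_kernel_def ennreal_mult[symmetric])
    finally show ?thesis .
  qed
qed

lemma rl_kernel_1: "rl_kernel 1 = indicator {0<..}"
  by (auto simp: rl_kernel_def indicator_def)

lemma nnconv_step: "nnconv (rl_kernel 1) g x = (\<integral>\<^sup>+y. g y * indicator {..<x} y \<partial>lborel)"
  unfolding nnconv_def rl_kernel_1 by (intro nn_integral_cong) (auto simp: indicator_def)

text \<open>
  The hypothesis says that the measures with densities \<open>f\<close> and \<open>g\<close> agree on all half-lines
  \<open>(-\<infinity>, x)\<close>.
\<close>

lemma AE_eq_if_nnconv_step_eq:
  assumes [measurable]: "f \<in> borel_measurable borel" "g \<in> borel_measurable borel"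
    and eq: "\<And>x. nnconv (rl_kernel 1) f x = nnconv (rl_kernel 1) g x"
    and fin: "\<And>x. nnconv (rl_kernel 1) f x < \<infinity>"
  shows "AE x in lborel. f x = g x"
proof -
  have *: "emeasure (density lborel h) {..<x} = nnconv (rl_kernel 1) h x" if [measurable]: "h \<in> borel_measurable borel" for h x
    unfolding nnconv_step by (subst emeasure_density) auto
  have "density lborel f = density lborel g"
  proof (rule measure_eqI_generator_eq[where E="range (\<lambda>x::real. {..<x})" and \<Omega>=UNIV and A="\<lambda>n. {..<real n}"])
    show "Int_stable (range (\<lambda>x::real. {..<x}))"
      unfolding Int_stable_def
    proof safe
      fix a b :: real
      have "{..<a} \<inter> {..<b} = {..<min a b}" by auto
      then show "{..<a} \<inter> {..<b} \<in> range (\<lambda>x. {..<x})" by blast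
    qed
    show "sets (density lborel f) = sigma_sets UNIV (range (\<lambda>x::real. {..<x}))"
      by (simp add: borel_Iio)
    show "sets (density lborel g) = sigma_sets UNIV (range (\<lambda>x::real. {..<x}))"
      by (simp add: borel_Iio)
    show "(\<Union>n. {..<real n}) = UNIV" using reals_Archimedean2 by auto
    show "emeasure (density lborel f) {..<real n} \<noteq> \<infinity>" for n
      using fin[of "real n"] by (simp add: *)
  qed (use eq in \<open>auto simp: *\<close>)
  then show ?thesis using sigma_finite_lborel
    by (subst (asm) sigma_finite_measure.density_unique_iff) auto
qed

text \<open>
  If \<open>x = (x - y) + y \<le> T\<close> with both summands positive, then both are at most \<open>T\<close>. So the cut-off may
  be moved to the two factors.
\<close>

lemma nn_integral_cutoff_nnconv_le:
  assumes [measurable]: "f \<in> borel_measurable borel" "g \<in> borel_measurable borel"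
    and f: "\<And>y. y \<le> 0 \<Longrightarrow> f y = 0" and g: "\<And>y. y \<le> 0 \<Longrightarrow> g y = 0"
  shows "cutoff_integral (nnconv f g) T \<le>
     cutoff_integral f T * cutoff_integral g T"
proof -
  have "cutoff_integral (nnconv f g) T \<le>
      (\<integral>\<^sup>+x. nnconv (\<lambda>x. f x * indicator {..T} x) (\<lambda>x. g x * indicator {..T} x) x * ennreal (exp (- 0 * x)) \<partial>lborel)"
  proof (rule nn_integral_mono)
    fix x
    show "nnconv f g x * indicator {..T} x \<le> nnconv (\<lambda>x. f x * indicator {..T} x) (\<lambda>x. g x * indicator {..T} x) x * ennreal (exp (- 0 * x))"
    proof (cases "x \<le> T")
      case True
      have "f (x - y) * g y \<le> f (x - y) * indicator {..T} (x - y) * (g y * indicator {..T} y)" for y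
        using True f[of "x - y"] g[of y] by (cases "0 < y \<and> y < x") (auto simp: indicator_def not_less)
      then show ?thesis using True unfolding nnconv_def by (auto intro!: nn_integral_mono)
    qed simp
  qed
  also have "\<dots> = cutoff_integral f T * cutoff_integral g T"
    by (subst nn_laplace_nnconv) auto
  finally show ?thesis .
qed

lemma rl_kernel_cutoff_finite:
  assumes "0 < b" shows "cutoff_integral (rl_kernel b) T < \<infinity>"
proof -
  have "cutoff_integral (rl_kernel b) T \<le> (\<integral>\<^sup>+x. rl_kernel b x * ennreal (exp (- 1 * x)) * ennreal (exp T) \<partial>lborel)"
  proof (intro nn_integral_mono)
    fix x
    have "indicator {..T} x \<le> ennreal (exp (- 1 * x) * exp T)"
      by (auto simp: indicator_def simp flip: exp_add)
    then have "rl_kernel b x * indicator {..T} x \<le> rl_kernel b x * ennreal (exp (- 1 * x) * exp T)"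
      by (rule mult_left_mono) simp
    then show "rl_kernel b x * indicator {..T} x \<le> rl_kernel b x * ennreal (exp (- 1 * x)) * ennreal (exp T)"
      by (simp add: ennreal_mult mult.assoc)
  qed
  also have "\<dots> = ennreal (1 powr (- b)) * ennreal (exp T)"
    using nn_laplace_rl_kernel[OF assms, of 1] by (subst nn_integral_multc) auto
  also have "\<dots> < \<infinity>" by (simp add: ennreal_mult_less_top)
  finally show ?thesis .
qed

text \<open>
  Multiply by \<open>e\<^sup>-\<^sup>u\<^sup>x\<close> and integrate over \<open>x \<le> T\<close>. The kernel contributes its transform \<open>u\<^sup>-\<^sup>b\<close> and the
  factor \<open>y\<close> at most \<open>T\<close>, so for large \<open>u\<close> the weighted norm of \<open>H\<close> is at most half of itself.
\<close>

lemma volterra_gronwall: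
  assumes [measurable]: "H \<in> borel_measurable borel" and b: "0 < b"
    and pos: "\<And>x. x \<le> 0 \<Longrightarrow> H x = 0"
    and fin: "\<And>T. cutoff_integral H T < \<infinity>"
    and le: "AE x in lborel. H x \<le> nnconv (rl_kernel b) (\<lambda>y. ennreal y * H y) x"
  shows "AE x in lborel. H x = 0"
proof -
  have "AE x in lborel. H x * indicator {..T} x = 0" if T: "0 < T" for T
  proof -
    \<comment> \<open>Chosen so that the contraction factor, T times the transform of the
      kernel, equals one half.\<close>
    define u where "u = (2 * T) powr (1 / b)"
    have u: "0 < u" "T * u powr (- b) = 1 / 2" using T b by (auto simp: u_def powr_powr powr_minus_divide)
    define I where "I = (\<integral>\<^sup>+x. H x * indicator {..T} x * ennreal (exp (- u * x)) \<partial>lborel)"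
    have "I \<le> (\<integral>\<^sup>+x. nnconv (rl_kernel b) (\<lambda>y. ennreal T * (H y * indicator {..T} y)) x * ennreal (exp (- u * x)) \<partial>lborel)"
      unfolding I_def
    proof (rule nn_integral_mono_AE)
      show "AE x in lborel. H x * indicator {..T} x * ennreal (exp (- u * x)) \<le>
        nnconv (rl_kernel b) (\<lambda>y. ennreal T * (H y * indicator {..T} y)) x * ennreal (exp (- u * x))"
        using le
      proof eventually_elim
        case (elim x)
        show ?case
        proof (cases "x \<le> T")
          case True
          have "nnconv (rl_kernel b) (\<lambda>y. ennreal y * H y) x \<le> nnconv (rl_kernel b) (\<lambda>y. ennreal T * (H y * indicator {..T} y)) x"
            unfolding nnconv_def
          proof (rule nn_integral_mono)
            fix y
            show "rl_kernel b (x - y) * (ennreal y * H y) \<le> rl_kernel b (x - y) * (ennreal T * (H y * indicator {..T} y))"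
              using True by (cases "y \<le> T") (auto simp: rl_kernel_def intro!: mult_left_mono mult_right_mono ennreal_leI)
          qed
          with elim have "H x \<le> nnconv (rl_kernel b) (\<lambda>y. ennreal T * (H y * indicator {..T} y)) x" by (rule order_trans)
          then show ?thesis using True by (intro mult_right_mono) auto
        qed simp
      qed
    qed
    also have "\<dots> = ennreal (u powr (- b)) * (ennreal T * I)"
    proof -
      have "(\<integral>\<^sup>+x. ennreal T * (H x * indicator {..T} x) * ennreal (exp (- u * x)) \<partial>lborel) = ennreal T * I"
        unfolding I_def mult.assoc by (rule nn_integral_cmult) measurable
      then show ?thesis using nn_laplace_rl_kernel[OF b u(1)] by (subst nn_laplace_nnconv) auto
    qed
    also have "\<dots> = ennreal (1 / 2) * I"
    proof -
      have "ennreal (u powr (- b)) * (ennreal T * I) = ennreal (u powr (- b) * T) * I"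
        using T by (subst ennreal_mult) (auto simp: mult.assoc)
      also have "u powr (- b) * T = 1 / 2" using u(2) by (simp only: mult.commute)
      finally show ?thesis .
    qed
    finally have I_le: "I \<le> ennreal (1 / 2) * I" .
    have "I \<le> cutoff_integral H T"
      unfolding I_def
    proof (rule nn_integral_mono)
      fix x show "H x * indicator {..T} x * ennreal (exp (- u * x)) \<le> H x * indicator {..T} x"
      proof (cases "x \<le> 0")
        case False
        then have "ennreal (exp (- u * x)) \<le> 1" using u by (simp add: ennreal_le_1)
        from mult_left_mono[OF this, of "H x * indicator {..T} x"] show ?thesis by simp
      qed (simp add: pos)
    qed
    with fin[of T] have "I < \<infinity>" by (rule le_less_trans[rotated])
    then obtain r where r: "0 \<le> r" "I = ennreal r" by (cases I) auto
    have "ennreal r \<le> ennreal (1 / 2 * r)" using I_le r by (subst ennreal_mult) auto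
    then have "r \<le> 1 / 2 * r" using r(1) by (subst (asm) ennreal_le_iff) auto
    with r have "I = 0" by simp
    then have "AE x in lborel. H x * indicator {..T} x * ennreal (exp (- u * x)) = 0"
      unfolding I_def by (subst (asm) nn_integral_0_iff_AE) auto
    then show ?thesis by (auto elim!: eventually_mono)
  qed
  then have "AE x in lborel. \<forall>n. H x * indicator {..real (Suc n)} x = 0"
    unfolding AE_all_countable by simp
  then show ?thesis
  proof eventually_elim
    case (elim x)
    obtain n where "x \<le> real n" using real_arch_simple by blast
    then have "x \<le> real (Suc n)" by simp
    with elim[rule_format, of n] show ?case by simp
  qed
qed

section \<open>The resolvent equation\<close>

locale resolvent_setting =
  fixes \<alpha> C :: real
  assumes alpha_gt_1: "1 < \<alpha>" and alpha_lt_2: "\<alpha> < 2" and C_pos: "0 < C"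
begin

abbreviation "\<kappa> \<equiv> rl_kernel (\<alpha> - 1)"

definition locally_finite :: "(real \<Rightarrow> ennreal) \<Rightarrow> bool" where
  "locally_finite p \<longleftrightarrow> p \<in> borel_measurable borel \<and> (\<forall>x\<le>0. p x = 0) \<and>
     (\<forall>T. cutoff_integral p T < \<infinity>)"

text \<open>
  The pair \<open>(p, q)\<close> stands for the signed function \<open>h = p - q\<close>, and the equation is
  \<open>\<alpha> h + \<kappa> * (y h) = C \<kappa>\<close> with all terms moved to the side where they are positive.
\<close>

definition resolvent_pair :: "(real \<Rightarrow> ennreal) \<Rightarrow> (real \<Rightarrow> ennreal) \<Rightarrow> bool" where
  "resolvent_pair p q \<longleftrightarrow> locally_finite p \<and> locally_finite q \<and>
     (AE x in lborel. ennreal \<alpha> * p x + nnconv \<kappa> (\<lambda>y. ennreal y * p y) x =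
        ennreal C * \<kappa> x + (ennreal \<alpha> * q x + nnconv \<kappa> (\<lambda>y. ennreal y * q y) x))"

lemma locally_finite_moment:
  assumes "locally_finite p"
  shows "locally_finite (\<lambda>y. ennreal y * p y)"
  unfolding locally_finite_def
proof (intro conjI allI impI)
  have [measurable]: "p \<in> borel_measurable borel" using assms by (simp add: locally_finite_def)
  show "(\<lambda>y. ennreal y * p y) \<in> borel_measurable borel" by measurable
  fix T
  have "(\<integral>\<^sup>+x. ennreal x * p x * indicator {..T} x \<partial>lborel) \<le> (\<integral>\<^sup>+x. ennreal T * (p x * indicator {..T} x) \<partial>lborel)"
    by (intro nn_integral_mono) (auto simp: indicator_def intro!: mult_right_mono ennreal_leI)
  also have "\<dots> = ennreal T * cutoff_integral p T" by (rule nn_integral_cmult) measurable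
  also have "\<dots> < \<infinity>" using assms by (simp add: locally_finite_def ennreal_mult_less_top)
  finally show "(\<integral>\<^sup>+x. ennreal x * p x * indicator {..T} x \<partial>lborel) < \<infinity>" .
qed (use assms in \<open>auto simp: locally_finite_def\<close>)

lemma locally_finite_add:
  "locally_finite p \<Longrightarrow> locally_finite q \<Longrightarrow> locally_finite (\<lambda>x. p x + q x)"
  unfolding locally_finite_def by (auto simp: distrib_right nn_integral_add)

lemma locally_finite_AE:
  assumes "locally_finite p" shows "AE x in lborel. p x < \<infinity>"
proof -
  have [measurable]: "p \<in> borel_measurable borel" using assms by (simp add: locally_finite_def)
  have "AE x in lborel. p x * indicator {..real n} x \<noteq> \<infinity>" for n
    by (rule nn_integral_PInf_AE) (use assms in \<open>auto simp: locally_finite_def less_top\<close>)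
  then have "AE x in lborel. \<forall>n. p x * indicator {..real n} x \<noteq> \<infinity>" unfolding AE_all_countable by simp
  then show ?thesis
  proof eventually_elim
    case (elim x)
    obtain n where "x \<le> real n" using real_arch_simple by blast
    with elim[rule_format, of n] show ?case by (simp add: less_top)
  qed
qed

lemma locally_finite_nnconv:
  assumes "locally_finite p" "0 < b" shows "locally_finite (nnconv (rl_kernel b) p)"
  unfolding locally_finite_def
proof (intro conjI allI impI)
  have [measurable]: "p \<in> borel_measurable borel" using assms by (simp add: locally_finite_def)
  show "nnconv (rl_kernel b) p \<in> borel_measurable borel" by measurable
  fix x :: real assume x: "x \<le> 0"
  have "nnconv (rl_kernel b) p x = (\<integral>\<^sup>+(y::real). 0 \<partial>lborel)"
    unfolding nnconv_def
  proof (rule nn_integral_cong)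
    fix y show "rl_kernel b (x - y) * p y = 0"
      using x assms(1) by (cases "y \<le> 0") (auto simp: rl_kernel_def locally_finite_def)
  qed
  then show "nnconv (rl_kernel b) p x = 0" by simp
next
  have [measurable]: "p \<in> borel_measurable borel" using assms by (simp add: locally_finite_def)
  fix T
  have "(\<integral>\<^sup>+x. nnconv (rl_kernel b) p x * indicator {..T} x \<partial>lborel) \<le>
      cutoff_integral (rl_kernel b) T * cutoff_integral p T"
    by (rule nn_integral_cutoff_nnconv_le) (use assms in \<open>auto simp: locally_finite_def rl_kernel_def\<close>)
  also have "\<dots> < \<infinity>" using assms rl_kernel_cutoff_finite[of b T] by (simp add: locally_finite_def ennreal_mult_less_top)
  finally show "(\<integral>\<^sup>+x. nnconv (rl_kernel b) p x * indicator {..T} x \<partial>lborel) < \<infinity>" .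
qed

text \<open>
  The difference \<open>H = |p - q|\<close> satisfies \<open>\<alpha> H \<le> \<kappa> * (y H)\<close>, and \<open>\<alpha> > 1\<close>, so the Gronwall lemma
  applies.
\<close>

lemma homogeneous_resolvent_unique:
  assumes p: "locally_finite p" and q: "locally_finite q"
    and eq: "AE x in lborel. ennreal \<alpha> * p x + nnconv \<kappa> (\<lambda>y. ennreal y * p y) x =
        ennreal \<alpha> * q x + nnconv \<kappa> (\<lambda>y. ennreal y * q y) x"
  shows "AE x in lborel. p x = q x"
proof -
  have [measurable]: "p \<in> borel_measurable borel" "q \<in> borel_measurable borel"
    using p q by (auto simp: locally_finite_def)
  define H where "H x = (p x - q x) + (q x - p x)" for x
  have H_meas [measurable]: "H \<in> borel_measurable borel" unfolding H_def[abs_def] by measurable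
  have kpos: "0 < \<alpha> - 1" using alpha_gt_1 by simp
  have Hle: "H x \<le> p x + q x" for x
    unfolding H_def by (intro add_mono) (auto simp: diff_le_self_ennreal)
  have pq: "p x \<le> q x + H x" "q x \<le> p x + H x" for x
  proof -
    have *: "a \<le> b + (a - b)" for a b :: ennreal using ennreal_minus_le_iff[of a b "a - b"] by simp
    show "p x \<le> q x + H x" unfolding H_def by (rule order_trans[OF *[of _ "q x"]]) (auto intro!: add_left_mono)
    show "q x \<le> p x + H x" unfolding H_def by (rule order_trans[OF *[of _ "p x"]]) (auto intro!: add_left_mono)
  qed
  have "AE x in lborel. H x = 0"
  proof (rule volterra_gronwall[of H "\<alpha> - 1"])
    show "H x = 0" if "x \<le> 0" for x using that p q by (simp add: H_def locally_finite_def)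
    show "cutoff_integral H T < \<infinity>" for T
    proof -
      have "cutoff_integral H T \<le> (\<integral>\<^sup>+x. (p x + q x) * indicator {..T} x \<partial>lborel)"
        by (intro nn_integral_mono mult_right_mono Hle) auto
      also have "\<dots> < \<infinity>" using locally_finite_add[OF p q] by (simp add: locally_finite_def)
      finally show ?thesis .
    qed
    have fin: "AE x in lborel. nnconv \<kappa> (\<lambda>y. ennreal y * r y) x < \<infinity>" if "locally_finite r" for r
      by (rule locally_finite_AE[OF locally_finite_nnconv[OF locally_finite_moment[OF that] kpos]])
    show "AE x in lborel. H x \<le> nnconv \<kappa> (\<lambda>y. ennreal y * H y) x"
      using eq fin[OF p] fin[OF q] locally_finite_AE[OF p] locally_finite_AE[OF q]
    proof eventually_elim
      case (elim x)
      let ?K = "\<lambda>r. nnconv \<kappa> (\<lambda>y. ennreal y * r y) x"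
      have K: "?K r \<le> ?K s + ?K H" if rs: "\<And>y. r y \<le> s y + H y" and [measurable]: "s \<in> borel_measurable borel" for r s
      proof -
        have "?K r \<le> nnconv \<kappa> (\<lambda>y. ennreal y * s y + ennreal y * H y) x"
          unfolding nnconv_def distrib_left[symmetric] by (intro nn_integral_mono mult_left_mono rs) auto
        also have "\<dots> = ?K s + ?K H" by (subst nnconv_add_right) auto
        finally show ?thesis .
      qed
      show "H x \<le> ?K H"
      proof (cases "?K H = \<infinity>")
        case False
        have real: "\<exists>r\<ge>0. z = ennreal r" if "z < \<infinity>" for z using that by (cases z) auto
        obtain a where a: "p x = ennreal a" "0 \<le> a" using real[OF elim(4)] by auto
        obtain b where b: "q x = ennreal b" "0 \<le> b" using real[OF elim(5)] by auto
        obtain A where A: "?K p = ennreal A" "0 \<le> A" using real[OF elim(2)] by auto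
        obtain B where B: "?K q = ennreal B" "0 \<le> B" using real[OF elim(3)] by auto
        obtain h where h: "?K H = ennreal h" "0 \<le> h" using real[of "?K H"] False by (auto simp: less_top)
        note r = a(1) b(1) A(1) B(1) h(1) and nn = a(2) b(2) A(2) B(2) h(2)
        have "\<alpha> * a + A = \<alpha> * b + B"
          using elim(1) nn alpha_gt_1 unfolding r by (simp add: ennreal_mult[symmetric] ennreal_plus[symmetric] del: ennreal_plus)
        moreover have "A \<le> B + h"
          using K[of p q, OF pq(1)] nn unfolding r by (simp add: ennreal_plus[symmetric] del: ennreal_plus)
        moreover have "B \<le> A + h"
          using K[of q p, OF pq(2)] nn unfolding r by (simp add: ennreal_plus[symmetric] del: ennreal_plus)
        moreover have "\<bar>a - b\<bar> \<le> \<alpha> * \<bar>a - b\<bar>" using alpha_gt_1 by (simp add: mult_le_cancel_right1)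
        moreover have "\<alpha> * \<bar>a - b\<bar> = \<bar>\<alpha> * a - \<alpha> * b\<bar>" using alpha_gt_1 by (simp add: abs_mult flip: right_diff_distrib)
        ultimately have "\<bar>a - b\<bar> \<le> h" by linarith
        moreover have "H x = ennreal \<bar>a - b\<bar>"
          using nn unfolding H_def r by (cases "a \<le> b") (auto simp: ennreal_minus ennreal_neg)
        ultimately show ?thesis unfolding r by (simp add: ennreal_leI)
      qed simp
    qed
  qed (use alpha_gt_1 in auto)
  then show ?thesis
  proof eventually_elim
    case (elim x)
    then show ?case using pq[of x] by (simp add: antisym)
  qed
qed

text \<open>
  Adding the equations of the two pairs crosswise cancels the inhomogeneous term without any
  subtraction.
\<close>

lemma resolvent_pair_unique:
  assumes "resolvent_pair p q" "resolvent_pair p' q'"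
  shows "AE x in lborel. p x + q' x = p' x + q x"
proof (rule homogeneous_resolvent_unique)
  have lf: "locally_finite p" "locally_finite q" "locally_finite p'" "locally_finite q'"
    using assms by (auto simp: resolvent_pair_def)
  then show "locally_finite (\<lambda>x. p x + q' x)" "locally_finite (\<lambda>x. p' x + q x)"
    by (auto intro: locally_finite_add)
  have [measurable]: "p \<in> borel_measurable borel" "q \<in> borel_measurable borel" "p' \<in> borel_measurable borel" "q' \<in> borel_measurable borel"
    using lf by (auto simp: locally_finite_def)
  have "AE x in lborel. ennreal \<alpha> * p x + nnconv \<kappa> (\<lambda>y. ennreal y * p y) x =
        ennreal C * \<kappa> x + (ennreal \<alpha> * q x + nnconv \<kappa> (\<lambda>y. ennreal y * q y) x)"
    "AE x in lborel. ennreal \<alpha> * p' x + nnconv \<kappa> (\<lambda>y. ennreal y * p' y) x =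
        ennreal C * \<kappa> x + (ennreal \<alpha> * q' x + nnconv \<kappa> (\<lambda>y. ennreal y * q' y) x)"
    using assms by (auto simp: resolvent_pair_def)
  then show "AE x in lborel. ennreal \<alpha> * (p x + q' x) + nnconv \<kappa> (\<lambda>y. ennreal y * (p y + q' y)) x =
      ennreal \<alpha> * (p' x + q x) + nnconv \<kappa> (\<lambda>y. ennreal y * (p' y + q y)) x"
  proof eventually_elim
    case (elim x)
    have "ennreal \<alpha> * (p x + q' x) + nnconv \<kappa> (\<lambda>y. ennreal y * (p y + q' y)) x =
       (ennreal \<alpha> * p x + nnconv \<kappa> (\<lambda>y. ennreal y * p y) x) + (ennreal \<alpha> * q' x + nnconv \<kappa> (\<lambda>y. ennreal y * q' y) x)"
      unfolding distrib_left by (subst nnconv_add_right) (auto simp: ac_simps)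
    moreover have "ennreal \<alpha> * (p' x + q x) + nnconv \<kappa> (\<lambda>y. ennreal y * (p' y + q y)) x =
       (ennreal \<alpha> * p' x + nnconv \<kappa> (\<lambda>y. ennreal y * p' y) x) + (ennreal \<alpha> * q x + nnconv \<kappa> (\<lambda>y. ennreal y * q y) x)"
      unfolding distrib_left by (subst nnconv_add_right) (auto simp: ac_simps)
    ultimately show ?case unfolding elim by (simp only: ac_simps)
  qed
qed

text \<open>
  Convolution with \<open>\<kappa>\<close>, of order \<open>\<alpha> - 1\<close>, inverts the Abel kernel of order \<open>2 - \<alpha>\<close> up to the unit step,
  because orders add to one. Every term of the convolved equation then is a primitive, and equality of
  primitives gives equality almost everywhere.
\<close>

lemma volterra_imp_resolvent_pair:
  assumes p: "locally_finite p" and q: "locally_finite q"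
    and eq: "\<And>x. nnconv (rl_kernel 1) (\<lambda>y. ennreal y * p y) x + ennreal \<alpha> * nnconv (rl_kernel (2 - \<alpha>)) p x =
       ennreal C * rl_kernel 1 x + (nnconv (rl_kernel 1) (\<lambda>y. ennreal y * q y) x + ennreal \<alpha> * nnconv (rl_kernel (2 - \<alpha>)) q x)"
  shows "resolvent_pair p q"
  unfolding resolvent_pair_def
proof (intro conjI p q)
  have kpos: "0 < \<alpha> - 1" using alpha_gt_1 by simp
  have cpos: "0 < 2 - \<alpha>" using alpha_lt_2 by simp
  have [measurable]: "p \<in> borel_measurable borel" "q \<in> borel_measurable borel"
    using p q by (auto simp: locally_finite_def)
  let ?A = "\<lambda>r x. ennreal \<alpha> * r x + nnconv \<kappa> (\<lambda>y. ennreal y * r y) x"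
  have conv: "nnconv \<kappa> (\<lambda>x. nnconv (rl_kernel 1) (\<lambda>y. ennreal y * r y) x + ennreal \<alpha> * nnconv (rl_kernel (2 - \<alpha>)) r x) =
      nnconv (rl_kernel 1) (?A r)" if [measurable]: "r \<in> borel_measurable borel" for r
  proof -
    have 1: "nnconv \<kappa> (nnconv (rl_kernel 1) (\<lambda>y. ennreal y * r y)) = nnconv (rl_kernel 1) (nnconv \<kappa> (\<lambda>y. ennreal y * r y))"
      by (simp add: nnconv_assoc nnconv_commute[of \<kappa> "rl_kernel 1"])
    have 2: "nnconv \<kappa> (nnconv (rl_kernel (2 - \<alpha>)) r) = nnconv (rl_kernel 1) r"
      by (simp add: nnconv_assoc nnconv_rl_kernel[OF kpos cpos])
    show ?thesis
      by (simp add: nnconv_add_right nnconv_cmult_right 1 2 add.commute)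
  qed
  have "nnconv (rl_kernel 1) (?A p) = nnconv \<kappa> (\<lambda>x. ennreal C * rl_kernel 1 x + (nnconv (rl_kernel 1) (\<lambda>y. ennreal y * q y) x + ennreal \<alpha> * nnconv (rl_kernel (2 - \<alpha>)) q x))"
    by (subst conv[symmetric]) (simp_all add: eq)
  also have "\<dots> = (\<lambda>x. ennreal C * nnconv \<kappa> (rl_kernel 1) x + nnconv (rl_kernel 1) (?A q) x)"
    by (subst nnconv_add_right) (simp_all add: nnconv_cmult_right conv)
  also have "\<dots> = nnconv (rl_kernel 1) (\<lambda>x. ennreal C * \<kappa> x + ?A q x)"
    by (subst (2) nnconv_add_right) (simp_all add: nnconv_cmult_right nnconv_commute[of \<kappa> "rl_kernel 1"])
  finally have eq': "nnconv (rl_kernel 1) (?A p) = nnconv (rl_kernel 1) (\<lambda>x. ennreal C * \<kappa> x + ?A q x)" .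
  show "AE x in lborel. ?A p x = ennreal C * \<kappa> x + ?A q x"
  proof (rule AE_eq_if_nnconv_step_eq)
    fix x
    have lf: "locally_finite (nnconv \<kappa> (\<lambda>y. ennreal y * p y))"
      by (rule locally_finite_nnconv[OF locally_finite_moment[OF p] kpos])
    have step: "nnconv (rl_kernel 1) r x < \<infinity>" if "locally_finite r" for r
    proof -
      have "nnconv (rl_kernel 1) r x \<le> (\<integral>\<^sup>+y. r y * indicator {..x} y \<partial>lborel)"
        unfolding nnconv_step by (intro nn_integral_mono) (auto simp: indicator_def)
      then show ?thesis using that by (auto simp: locally_finite_def intro: le_less_trans)
    qed
    have "nnconv (rl_kernel 1) (?A p) x = ennreal \<alpha> * nnconv (rl_kernel 1) p x + nnconv (rl_kernel 1) (nnconv \<kappa> (\<lambda>y. ennreal y * p y)) x"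
      by (simp add: nnconv_add_right nnconv_cmult_right)
    also have "\<dots> < \<infinity>" using step[OF p] step[OF lf] by (simp add: ennreal_mult_less_top)
    finally show "nnconv (rl_kernel 1) (?A p) x < \<infinity>" .
  qed (use eq' in auto)
qed

end

section \<open>Uniqueness of Laplace transforms of measures\<close>

text \<open>
  On \<open>[0, 1]\<close> the exponential series of the characteristic function may be integrated term by term, so
  the moments determine it.
\<close>

lemma real_distribution_eqI_moments:
  fixes A B :: "real measure"
  assumes A: "real_distribution A" and B: "real_distribution B"
    and AA: "AE x in A. 0 \<le> x \<and> x \<le> 1" and BB: "AE x in B. 0 \<le> x \<and> x \<le> 1"
    and eq: "\<And>n. (\<integral>x. x ^ n \<partial>A) = (\<integral>x. x ^ n \<partial>B)"
  shows "A = B"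
proof (rule Levy_uniqueness[OF A B], rule ext)
  fix t
  have *: "char D t = (\<Sum>n. (\<i> * complex_of_real t) ^ n /\<^sub>R fact n * complex_of_real (\<integral>x. x ^ n \<partial>D))"
    if D: "real_distribution D" and DD: "AE x in D. 0 \<le> x \<and> x \<le> 1" for D
  proof -
    interpret D: real_distribution D by fact
    have bd: "AE x in D. norm (x ^ n) \<le> 1" for n
      using DD by eventually_elim (auto intro: power_le_one)
    have i: "integrable D (\<lambda>x. x ^ n)" for n
      by (rule D.integrable_const_bound[OF bd]) simp
    let ?g = "\<lambda>n x. (\<i> * complex_of_real t) ^ n /\<^sub>R fact n * complex_of_real (x ^ n)"
    have ig: "integrable D (?g n)" for n
      using i by (intro integrable_mult_right integrable_of_real)
    have ng: "norm (?g n x) = \<bar>t\<bar> ^ n /\<^sub>R fact n * \<bar>x ^ n\<bar>" for n x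
      by (simp add: norm_mult norm_power power_abs)
    have st: "summable (\<lambda>n. \<bar>t\<bar> ^ n /\<^sub>R fact n)" by (rule summable_exp_generic)
    have "char D t = (\<integral>x. (\<Sum>n. ?g n x) \<partial>D)"
      unfolding char_def exp_def by (intro Bochner_Integration.integral_cong)
        (auto simp: power_mult_distrib mult.assoc)
    also have "\<dots> = (\<Sum>n. \<integral>x. ?g n x \<partial>D)"
    proof (rule integral_suminf[OF ig])
      show "AE x in D. summable (\<lambda>n. norm (?g n x))"
        using DD
      proof eventually_elim
        case (elim x)
        show ?case unfolding ng
        proof (rule summable_comparison_test'[OF st])
          show "norm (\<bar>t\<bar> ^ n /\<^sub>R fact n * \<bar>x ^ n\<bar>) \<le> \<bar>t\<bar> ^ n /\<^sub>R fact n" for n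
            using elim power_le_one[of x n] by (auto intro!: mult_left_le)
        qed
      qed
      show "summable (\<lambda>n. \<integral>x. norm (?g n x) \<partial>D)" unfolding ng
      proof (rule summable_comparison_test'[OF st])
        fix n
        have "(\<integral>x. \<bar>x ^ n\<bar> \<partial>D) \<le> (\<integral>x. 1 \<partial>D)"
          using i bd by (intro integral_mono_AE) auto
        moreover have "D.prob UNIV = 1" using D.prob_space by simp
        ultimately have "(\<integral>x. \<bar>x ^ n\<bar> \<partial>D) \<le> 1" by simp
        moreover have "0 \<le> (\<integral>x. \<bar>x ^ n\<bar> \<partial>D)" by (intro integral_nonneg_AE) auto
        ultimately show "norm (\<integral>x. \<bar>t\<bar> ^ n /\<^sub>R fact n * \<bar>x ^ n\<bar> \<partial>D) \<le> \<bar>t\<bar> ^ n /\<^sub>R fact n"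
          by (auto intro!: mult_left_le)
      qed
    qed
    also have "\<dots> = (\<Sum>n. (\<i> * complex_of_real t) ^ n /\<^sub>R fact n * complex_of_real (\<integral>x. x ^ n \<partial>D))"
      by (subst integral_mult_right_zero, subst integral_complex_of_real) simp
    finally show ?thesis .
  qed
  show "char A t = char B t"
    by (simp add: *[OF A AA] *[OF B BB] eq)
qed

text \<open>
  The image of the measure \<open>e\<^sup>-\<^sup>x dA / m\<close>, with \<open>m\<close> its normalisation, under \<open>x \<mapsto> e\<^sup>-\<^sup>x\<close> is a
  distribution on \<open>[0, 1]\<close> whose moments are the values of the transform of \<open>A\<close> at the integers from \<open>1\<close>
  on. It determines \<open>A\<close>, because all steps can be undone.
\<close>

lemma measure_eqI_laplace:
  fixes A B :: "real measure"
  assumes sets [measurable_cong]: "sets A = sets borel" "sets B = sets borel"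
    and AA: "AE x in A. 0 \<le> x" and BB: "AE x in B. 0 \<le> x"
    and eq: "\<And>u. 0 < u \<Longrightarrow> (\<integral>\<^sup>+x. ennreal (exp (- u * x)) \<partial>A) = (\<integral>\<^sup>+x. ennreal (exp (- u * x)) \<partial>B)"
    and fin: "(\<integral>\<^sup>+x. ennreal (exp (- 1 * x)) \<partial>A) < \<infinity>"
  shows "A = B"
proof -
  obtain m where m: "0 \<le> m" "(\<integral>\<^sup>+x. ennreal (exp (- 1 * x)) \<partial>A) = ennreal m"
    using fin by (cases "\<integral>\<^sup>+x. ennreal (exp (- 1 * x)) \<partial>A") auto
  show ?thesis
  proof (cases "m = 0")
    case True
    have null: "emeasure D X = 0" if "sets D = sets borel" "(\<integral>\<^sup>+x. ennreal (exp (- 1 * x)) \<partial>D) = 0" "X \<in> sets D" for D :: "real measure" and X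
    proof -
      note that(1)[measurable_cong]
      have "AE x in D. ennreal (exp (- 1 * x)) = 0"
        using that(2) by (subst (asm) nn_integral_0_iff_AE) auto
      then have "AE x in D. x \<notin> X" by (auto elim!: eventually_mono)
      then show ?thesis using that(3) AE_iff_measurable[of X D "\<lambda>x. x \<notin> X"] sets.sets_into_space[of X D] by auto
    qed
    show ?thesis
      by (rule measure_eqI) (use null[OF sets(1)] null[OF sets(2)] True m eq[of 1] sets in auto)
  next
    case False
    with m have m: "0 < m" "(\<integral>\<^sup>+x. ennreal (exp (- 1 * x)) \<partial>A) = ennreal m" by auto
    \<comment> \<open>The exponential change of variables onto the unit interval, after tilting
      to total mass one.\<close>
    define T where "T D = distr (density D (\<lambda>x. ennreal (exp (- 1 * x) / m))) borel (\<lambda>x. exp (- x))" for D :: "real measure"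
    have T: "real_distribution (T D)" "AE x in T D. 0 \<le> x \<and> x \<le> 1"
      "ennreal (\<integral>x. x ^ n \<partial>T D) = (\<integral>\<^sup>+x. ennreal (exp (- real (Suc n) * x)) \<partial>D) * ennreal (1 / m)"
      "D = density (distr (T D) borel (\<lambda>y. - ln y)) (\<lambda>x. ennreal (m * exp x))"
      if D [measurable_cong]: "sets D = sets borel" and DD: "AE x in D. 0 \<le> x"
        and Dm: "(\<integral>\<^sup>+x. ennreal (exp (- 1 * x)) \<partial>D) = ennreal m" for D n
    proof -
      have "emeasure (density D (\<lambda>x. ennreal (exp (- 1 * x) / m))) (space D) = (\<integral>\<^sup>+x. ennreal (exp (- 1 * x)) * ennreal (1 / m) \<partial>D)"
        using m by (subst emeasure_density) (auto intro!: nn_integral_cong simp: ennreal_mult[symmetric])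
      also have "\<dots> = 1" using m by (subst nn_integral_multc) (auto simp: Dm[simplified] ennreal_mult[symmetric])
      finally have "prob_space (density D (\<lambda>x. ennreal (exp (- 1 * x) / m)))" by (intro prob_spaceI) simp
      then have "prob_space (T D)" unfolding T_def by (intro prob_space.prob_space_distr) auto
      then show rd: "real_distribution (T D)"
        unfolding real_distribution_def real_distribution_axioms_def by (simp add: T_def)
      show ae: "AE x in T D. 0 \<le> x \<and> x \<le> 1"
        unfolding T_def using DD by (subst AE_distr_iff) (auto simp: AE_density)
      interpret R: real_distribution "T D" by fact
      have bd: "AE x in T D. norm (x ^ n) \<le> 1" "AE x in T D. 0 \<le> x ^ n"
        using ae by (eventually_elim, auto intro: power_le_one)+
      have "ennreal (\<integral>x. x ^ n \<partial>T D) = (\<integral>\<^sup>+x. ennreal (x ^ n) \<partial>T D)"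
        by (rule nn_integral_eq_integral[symmetric, OF R.integrable_const_bound[OF bd(1)] bd(2)]) simp
      also have "\<dots> = (\<integral>\<^sup>+x. ennreal (exp (- 1 * x) / m) * ennreal (exp (- x) ^ n) \<partial>D)"
        unfolding T_def by (subst nn_integral_distr) (auto simp: nn_integral_density)
      also have "\<dots> = (\<integral>\<^sup>+x. ennreal (exp (- real (Suc n) * x)) * ennreal (1 / m) \<partial>D)"
        using m by (intro nn_integral_cong)
          (auto simp: ennreal_mult[symmetric] exp_of_nat_mult[symmetric] algebra_simps simp flip: exp_add)
      also have "\<dots> = (\<integral>\<^sup>+x. ennreal (exp (- real (Suc n) * x)) \<partial>D) * ennreal (1 / m)"
        by (rule nn_integral_multc) measurable
      finally show "ennreal (\<integral>x. x ^ n \<partial>T D) = (\<integral>\<^sup>+x. ennreal (exp (- real (Suc n) * x)) \<partial>D) * ennreal (1 / m)" .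
      have "distr (T D) borel (\<lambda>y. - ln y) = distr (density D (\<lambda>x. ennreal (exp (- 1 * x) / m))) borel (\<lambda>x. x)"
        unfolding T_def by (subst distr_distr) (auto simp: o_def)
      also have "\<dots> = density D (\<lambda>x. ennreal (exp (- 1 * x) / m))" by (rule distr_id2) (simp add: D)
      finally have "density (distr (T D) borel (\<lambda>y. - ln y)) (\<lambda>x. ennreal (m * exp x)) =
          density D (\<lambda>x. ennreal (exp (- 1 * x) / m) * ennreal (m * exp x))"
        by (simp add: density_density_eq)
      also have "\<dots> = density D (\<lambda>_. 1)"
        using m by (intro density_cong) (auto simp: ennreal_mult[symmetric] simp flip: exp_add)
      also have "\<dots> = D" by (rule density_1)
      finally show "D = density (distr (T D) borel (\<lambda>y. - ln y)) (\<lambda>x. ennreal (m * exp x))" ..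
    qed
    have mB: "(\<integral>\<^sup>+x. ennreal (exp (- 1 * x)) \<partial>B) = ennreal m" using m(2) eq[of 1] by simp
    have "T A = T B"
    proof (rule real_distribution_eqI_moments)
      fix n
      have "ennreal (\<integral>x. x ^ n \<partial>T A) = ennreal (\<integral>x. x ^ n \<partial>T B)"
        unfolding T(3)[OF sets(1) AA m(2)] T(3)[OF sets(2) BB mB] by (simp only: eq[of "real (Suc n)"] of_nat_0_less_iff zero_less_Suc)
      moreover have "0 \<le> (\<integral>x. x ^ n \<partial>T A)" "0 \<le> (\<integral>x. x ^ n \<partial>T B)"
        using T(2)[OF sets(1) AA m(2)] T(2)[OF sets(2) BB mB] by (auto intro!: integral_nonneg_AE elim!: eventually_mono)
      ultimately show "(\<integral>x. x ^ n \<partial>T A) = (\<integral>x. x ^ n \<partial>T B)" by simp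
    qed (rule T[OF sets(1) AA m(2)] T[OF sets(2) BB mB])+
    then show ?thesis using T(4)[OF sets(1) AA m(2)] T(4)[OF sets(2) BB mB] by simp
  qed
qed

section \<open>The supremum has a density solving the resolvent equation\<close>

definition add_measure :: "'a measure \<Rightarrow> 'a measure \<Rightarrow> 'a measure" where
  "add_measure A B = measure_of (space A) (sets A) (\<lambda>X. emeasure A X + emeasure B X)"

lemma sets_add_measure [simp, measurable_cong]: "sets (add_measure A B) = sets A"
  by (simp add: add_measure_def)

lemma space_add_measure [simp]: "space (add_measure A B) = space A"
  by (simp add: add_measure_def)

lemma emeasure_add_measure:
  assumes "sets B = sets A" "X \<in> sets A"
  shows "emeasure (add_measure A B) X = emeasure A X + emeasure B X"
proof (rule emeasure_measure_of[OF add_measure_def])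
  show "countably_additive (sets (add_measure A B)) (\<lambda>X. emeasure A X + emeasure B X)"
  proof (rule countably_additiveI)
    fix F :: "nat \<Rightarrow> 'a set"
    assume F: "range F \<subseteq> sets (add_measure A B)" "disjoint_family F"
    then have "(\<Sum>i. emeasure A (F i)) = emeasure A (\<Union>i. F i)" "(\<Sum>i. emeasure B (F i)) = emeasure B (\<Union>i. F i)"
      using assms(1) by (auto intro!: suminf_emeasure)
    then show "(\<Sum>i. emeasure A (F i) + emeasure B (F i)) = emeasure A (\<Union>i. F i) + emeasure B (\<Union>i. F i)"
      by (simp add: suminf_add[symmetric])
  qed
qed (use assms sets.sets_into_space in \<open>auto simp: positive_def\<close>)

lemma nn_integral_add_measure:
  assumes sets: "sets B = sets A" and f: "f \<in> borel_measurable A"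
  shows "(\<integral>\<^sup>+x. f x \<partial>add_measure A B) = (\<integral>\<^sup>+x. f x \<partial>A) + (\<integral>\<^sup>+x. f x \<partial>B)"
  using f
proof (induction rule: borel_measurable_induct)
  case (cong f g)
  then show ?case using nn_integral_cong[of A f g] nn_integral_cong[of B f g] nn_integral_cong[of "add_measure A B" f g]
      sets_eq_imp_space_eq[OF sets] by simp
next
  case (set X)
  then show ?case using sets by (simp add: emeasure_add_measure)
next
  case (mult u c)
  note [measurable] = mult(2)
  have [measurable]: "u \<in> borel_measurable B" using mult(2) sets measurable_cong_sets by blast
  show ?case using mult by (simp add: nn_integral_cmult distrib_left measurable_cong_sets[OF sets_add_measure refl])
next
  case (add u v)
  have "u \<in> borel_measurable B" "v \<in> borel_measurable B" using add sets measurable_cong_sets by blast+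
  then show ?case using add by (simp add: nn_integral_add measurable_cong_sets[OF sets_add_measure refl] ac_simps)
next
  case (seq U)
  have U: "U i \<in> borel_measurable B" "U i \<in> borel_measurable (add_measure A B)" for i
    using seq(1)[of i] sets measurable_cong_sets[OF sets_add_measure refl] measurable_cong_sets[OF sets refl] by blast+
  have inc: "incseq (\<lambda>i. integral\<^sup>N A (U i))" "incseq (\<lambda>i. integral\<^sup>N B (U i))"
    using seq(3) by (auto simp: incseq_def le_fun_def intro!: nn_integral_mono)
  have "(\<integral>\<^sup>+x. (SUP i. U i) x \<partial>D) = (SUP i. integral\<^sup>N D (U i))" if "\<And>i. U i \<in> borel_measurable D" for D
    unfolding SUP_apply by (rule nn_integral_monotone_convergence_SUP[OF seq(3) that])
  note S = this
  have IH: "integral\<^sup>N (add_measure A B) (U i) = integral\<^sup>N A (U i) + integral\<^sup>N B (U i)" for i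
    by (rule seq)
  show ?case unfolding S[OF seq(1)] S[OF U(1)] S[OF U(2)] IH by (rule ennreal_SUP_add[OF inc])
qed

text \<open>
  Multiply the hypothesis by \<open>u\<^sup>1\<^sup>-\<^sup>\<alpha>\<close>, the transform of \<open>\<kappa>\<close>. It then says that \<open>\<alpha> \<mu> + (\<kappa> * (y \<mu>)) dx\<close>
  and \<open>C \<kappa> dx\<close> have the same transform. So these measures are equal; in particular \<open>\<mu>\<close>, being dominated by
  \<open>(C / \<alpha>) \<kappa> dx\<close>, is absolutely continuous.
\<close>

lemma (in resolvent_setting) laplace_identity_imp_resolvent_density:
  assumes mu: "real_distribution \<mu>" and nonneg: "AE x in \<mu>. 0 \<le> x"
    and eq: "\<And>u. 0 < u \<Longrightarrow> (\<integral>\<^sup>+x. ennreal x * ennreal (exp (- u * x)) \<partial>\<mu>) +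
       ennreal (\<alpha> * u powr (\<alpha> - 1)) * (\<integral>\<^sup>+x. ennreal (exp (- u * x)) \<partial>\<mu>) = ennreal C"
  obtains d where "resolvent_pair d (\<lambda>_. 0)" "\<mu> = density lborel d"
proof -
  interpret mu: real_distribution \<mu> by fact
  have kpos: "0 < \<alpha> - 1" using alpha_gt_1 by simp
  have [measurable_cong]: "sets \<mu> = sets borel" by simp
  define n where "n x = (\<integral>\<^sup>+y. \<kappa> (x - y) * ennreal y \<partial>\<mu>)" for x
  have n_meas [measurable]: "n \<in> borel_measurable borel" unfolding n_def[abs_def] by measurable
  have n0: "n x = 0" if "x \<le> 0" for x
  proof -
    have "n x = (\<integral>\<^sup>+y. 0 \<partial>\<mu>)" unfolding n_def
    proof (rule nn_integral_cong)
      fix y show "\<kappa> (x - y) * ennreal y = 0" using that by (cases "y \<le> 0") (auto simp: rl_kernel_def ennreal_neg)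
    qed
    then show ?thesis by simp
  qed
  have n_laplace: "nn_laplace n u =
      ennreal (u powr (- (\<alpha> - 1))) * (\<integral>\<^sup>+x. ennreal x * ennreal (exp (- u * x)) \<partial>\<mu>)" if u: "0 < u" for u
  proof -
    interpret P: pair_sigma_finite lborel \<mu> by standard
    have "nn_laplace n u =
        (\<integral>\<^sup>+x. (\<integral>\<^sup>+y. \<kappa> (x - y) * ennreal y * ennreal (exp (- u * x)) \<partial>\<mu>) \<partial>lborel)"
      unfolding n_def by (subst nn_integral_multc) auto
    also have "\<dots> = (\<integral>\<^sup>+y. (\<integral>\<^sup>+x. \<kappa> (x - y) * ennreal y * ennreal (exp (- u * x)) \<partial>lborel) \<partial>\<mu>)"
      by (rule P.Fubini'[symmetric]) measurable
    also have "\<dots> = (\<integral>\<^sup>+y. ennreal (u powr (- (\<alpha> - 1))) * (ennreal y * ennreal (exp (- u * y))) \<partial>\<mu>)"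
    proof (rule nn_integral_cong)
      fix y
      have "(\<integral>\<^sup>+x. \<kappa> (x - y) * ennreal y * ennreal (exp (- u * x)) \<partial>lborel) =
          (\<integral>\<^sup>+x. \<kappa> x * ennreal (exp (- u * x)) * (ennreal y * ennreal (exp (- u * y))) \<partial>lborel)"
        by (subst nn_integral_real_affine[of _ 1 y])
          (auto simp: algebra_simps exp_add[symmetric] ennreal_mult[symmetric] intro!: nn_integral_cong)
      also have "\<dots> = ennreal (u powr (- (\<alpha> - 1))) * (ennreal y * ennreal (exp (- u * y)))"
        using nn_laplace_rl_kernel[OF kpos u] by (subst nn_integral_multc) auto
      finally show "(\<integral>\<^sup>+x. \<kappa> (x - y) * ennreal y * ennreal (exp (- u * x)) \<partial>lborel) =
         ennreal (u powr (- (\<alpha> - 1))) * (ennreal y * ennreal (exp (- u * y)))" .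
    qed
    also have "\<dots> = ennreal (u powr (- (\<alpha> - 1))) * (\<integral>\<^sup>+y. ennreal y * ennreal (exp (- u * y)) \<partial>\<mu>)"
      by (rule nn_integral_cmult) measurable
    finally show ?thesis .
  qed
  define P where "P = density \<mu> (\<lambda>_. ennreal \<alpha>)"
  define Q where "Q = density lborel n"
  define N where "N = add_measure P Q"
  have sets_PQ [simp, measurable_cong]: "sets P = sets borel" "sets Q = sets borel" "sets N = sets borel"
    by (auto simp: P_def Q_def N_def)
  have eN: "emeasure N X = ennreal \<alpha> * emeasure \<mu> X + emeasure Q X" if "X \<in> sets borel" for X
    using that unfolding N_def by (subst emeasure_add_measure) (auto simp: P_def emeasure_density nn_integral_cmult_indicator)
  have N: "N = density lborel (\<lambda>x. ennreal C * \<kappa> x)"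
  proof (rule measure_eqI_laplace)
    have mu0: "emeasure \<mu> {..<0} = 0"
      using nonneg AE_iff_measurable[of "{..<0}" \<mu> "\<lambda>x. 0 \<le> x"] by (auto simp: not_le lessThan_def)
    have "emeasure Q {..<0} = (\<integral>\<^sup>+x. n x * indicator {..<0} x \<partial>lborel)"
      unfolding Q_def by (rule emeasure_density) auto
    also have "\<dots> = (\<integral>\<^sup>+(x::real). 0 \<partial>lborel)" by (intro nn_integral_cong) (auto simp: n0 indicator_def)
    finally have "emeasure N {..<0} = 0" by (simp add: eN mu0)
    then show "AE x in N. 0 \<le> x"
      by (intro AE_I[where N="{..<0}"]) auto
    show "AE x in density lborel (\<lambda>x. ennreal C * \<kappa> x). 0 \<le> x"
      by (subst AE_density) (auto simp: rl_kernel_def)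
    have LN: "(\<integral>\<^sup>+x. ennreal (exp (- u * x)) \<partial>N) = ennreal C * ennreal (u powr (- (\<alpha> - 1)))" if u: "0 < u" for u
    proof -
      let ?L = "\<integral>\<^sup>+x. ennreal (exp (- u * x)) \<partial>\<mu>" and ?Y = "\<integral>\<^sup>+x. ennreal x * ennreal (exp (- u * x)) \<partial>\<mu>"
      have "(\<integral>\<^sup>+x. ennreal (exp (- u * x)) \<partial>N) = ennreal \<alpha> * ?L + nn_laplace n u"
        unfolding N_def by (subst nn_integral_add_measure) (auto simp: P_def Q_def nn_integral_density nn_integral_cmult)
      also have "\<dots> = ennreal (u powr (- (\<alpha> - 1)) * (\<alpha> * u powr (\<alpha> - 1))) * ?L + ennreal (u powr (- (\<alpha> - 1))) * ?Y"
      proof -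
        have "u powr (- (\<alpha> - 1)) * (\<alpha> * u powr (\<alpha> - 1)) = \<alpha>"
          using u by (simp add: powr_minus divide_simps del: minus_diff_eq)
        then show ?thesis by (simp only: n_laplace[OF u])
      qed
      also have "\<dots> = ennreal (u powr (- (\<alpha> - 1))) * (?Y + ennreal (\<alpha> * u powr (\<alpha> - 1)) * ?L)"
        using alpha_gt_1 by (subst ennreal_mult) (auto simp: distrib_left mult.assoc add.commute)
      also have "\<dots> = ennreal C * ennreal (u powr (- (\<alpha> - 1)))" unfolding eq[OF u] by (rule mult.commute)
      finally show ?thesis .
    qed
    show "(\<integral>\<^sup>+x. ennreal (exp (- u * x)) \<partial>N) = (\<integral>\<^sup>+x. ennreal (exp (- u * x)) \<partial>density lborel (\<lambda>x. ennreal C * \<kappa> x))" if u: "0 < u" for u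
      unfolding LN[OF u] using nn_laplace_rl_kernel[OF kpos u]
      by (subst nn_integral_density) (auto simp: mult.assoc nn_integral_cmult)
    show "(\<integral>\<^sup>+x. ennreal (exp (- 1 * x)) \<partial>N) < \<infinity>"
      unfolding LN[OF zero_less_one] by (simp add: ennreal_mult_less_top)
  qed auto
  have ac: "absolutely_continuous lborel \<mu>"
    unfolding absolutely_continuous_def
  proof
    fix X :: "real set" assume X: "X \<in> null_sets lborel"
    then have "emeasure N X = 0"
      unfolding N by (subst emeasure_density) (auto simp: nn_integral_null_set)
    then have "ennreal \<alpha> * emeasure \<mu> X = 0" using eN[of X] X by (auto simp: null_sets_def)
    then show "X \<in> null_sets \<mu>" using X alpha_gt_1 by (auto simp: null_sets_def)
  qed
  define d0 where "d0 = RN_deriv lborel \<mu>"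
  have d0_meas [measurable]: "d0 \<in> borel_measurable borel" unfolding d0_def by simp
  have mu_d0: "density lborel d0 = \<mu>"
    unfolding d0_def by (rule sigma_finite_measure.density_RN_deriv[OF sigma_finite_lborel ac]) simp
  \<comment> \<open>A version of the Radon--Nikodym derivative that vanishes on the whole left
    half-line.\<close>
  define d where "d x = d0 x * indicator {0<..} x" for x
  have d_meas [measurable]: "d \<in> borel_measurable borel" unfolding d_def[abs_def] by measurable
  have "AE x in density lborel d0. 0 \<le> x" unfolding mu_d0 by (rule nonneg)
  then have "AE x in lborel. 0 < d0 x \<longrightarrow> 0 \<le> x" by (subst (asm) AE_density) auto
  moreover have "AE x in lborel. x \<noteq> (0::real)" by (rule AE_lborel_singleton)
  ultimately have "AE x in lborel. d0 x = d x"
    by eventually_elim (auto simp: d_def indicator_def zero_less_iff_neq_zero)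
  then have mu_d: "\<mu> = density lborel d" unfolding mu_d0[symmetric] by (intro density_cong) auto
  have n_d: "n x = nnconv \<kappa> (\<lambda>y. ennreal y * d y) x" for x
    unfolding n_def nnconv_def by (subst mu_d, subst nn_integral_density) (auto intro!: nn_integral_cong simp: ac_simps)
  have "density lborel (\<lambda>x. ennreal \<alpha> * d x + n x) = N"
  proof (rule measure_eqI)
    fix X assume "X \<in> sets (density lborel (\<lambda>x. ennreal \<alpha> * d x + n x))"
    then have [measurable]: "X \<in> sets borel" by simp
    have "emeasure (density lborel (\<lambda>x. ennreal \<alpha> * d x + n x)) X = (\<integral>\<^sup>+x. ennreal \<alpha> * (d x * indicator X x) + n x * indicator X x \<partial>lborel)"
      by (subst emeasure_density) (auto simp: distrib_right mult.assoc)
    also have "\<dots> = ennreal \<alpha> * emeasure \<mu> X + emeasure Q X"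
      by (subst nn_integral_add) (auto simp: nn_integral_cmult mu_d Q_def emeasure_density)
    finally show "emeasure (density lborel (\<lambda>x. ennreal \<alpha> * d x + n x)) X = emeasure N X" by (simp add: eN)
  qed simp
  then have "AE x in lborel. ennreal \<alpha> * d x + n x = ennreal C * \<kappa> x"
    unfolding N by (subst (asm) sigma_finite_measure.density_unique_iff[OF sigma_finite_lborel]) auto
  moreover have "locally_finite d" unfolding locally_finite_def
  proof (intro conjI allI impI)
    fix T
    have "cutoff_integral d T = emeasure \<mu> {..T}" by (subst mu_d, subst emeasure_density) auto
    also have "\<dots> < \<infinity>" by (simp add: mu.emeasure_finite less_top[symmetric])
    finally show "cutoff_integral d T < \<infinity>" .
  qed (auto simp: d_def)
  moreover have "locally_finite (\<lambda>_. 0)" by (simp add: locally_finite_def)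
  ultimately have "resolvent_pair d (\<lambda>_. 0)"
    by (auto simp: resolvent_pair_def n_d nnconv_def)
  from that[OF this mu_d] show ?thesis .
qed

section \<open>The Volterra equation of the first kind\<close>

locale stable_index =
  fixes \<alpha> :: real
  assumes index_gt_1: "1 < \<alpha>" and index_lt_2: "\<alpha> < 2"

sublocale stable_index \<subseteq> resolvent_setting \<alpha> "\<alpha> / Gamma (1 / \<alpha>)"
proof
  show "0 < \<alpha> / Gamma (1 / \<alpha>)" using index_gt_1 by (intro divide_pos_pos Gamma_real_pos) auto
qed (fact index_gt_1 index_lt_2)+

context stable_index
begin

abbreviation "K \<equiv> volterra_kernel \<alpha>"

lemma measurable_volterra_kernel [measurable]: "K x \<in> borel_measurable borel"
  unfolding volterra_kernel_def[abs_def] by measurable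

lemma Gamma_2_minus_pos: "0 < Gamma (2 - \<alpha>)"
  using index_lt_2 by (intro Gamma_real_pos) auto

text \<open>
  This positive lower bound makes every solution of the Volterra equation locally integrable.
\<close>

lemma volterra_kernel_ge:
  assumes "0 < y" "y < x"
  shows "\<alpha> / Gamma (2 - \<alpha>) * (1 / x powr (\<alpha> - 1)) \<le> K x y"
proof -
  have "(x - y) powr (\<alpha> - 1) \<le> x powr (\<alpha> - 1)"
    using assms index_gt_1 by (intro powr_mono2) auto
  then have "1 / x powr (\<alpha> - 1) \<le> 1 / (x - y) powr (\<alpha> - 1)"
    using assms by (intro divide_left_mono) auto
  then have "\<alpha> / Gamma (2 - \<alpha>) * (1 / x powr (\<alpha> - 1)) \<le> \<alpha> / Gamma (2 - \<alpha>) * (1 / (x - y) powr (\<alpha> - 1))"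
    using index_gt_1 Gamma_2_minus_pos by (intro mult_left_mono) auto
  then show ?thesis using assms unfolding volterra_kernel_def by linarith
qed

lemma volterra_kernel_pos: "0 < y \<Longrightarrow> y < x \<Longrightarrow> 0 < K x y"
  using index_gt_1 Gamma_2_minus_pos by (intro less_le_trans[OF _ volterra_kernel_ge]) (auto intro!: mult_pos_pos divide_pos_pos)

text \<open>
  The two parts of the Volterra kernel are the kernels of order \<open>1\<close> and \<open>2 - \<alpha>\<close>.
\<close>

lemma nnconv_volterra:
  assumes [measurable]: "h \<in> borel_measurable borel" and h: "\<And>x. x \<le> 0 \<Longrightarrow> h x = 0"
  shows "nnconv (rl_kernel 1) (\<lambda>y. ennreal y * ennreal (h y)) x + ennreal \<alpha> * nnconv (rl_kernel (2 - \<alpha>)) (\<lambda>y. ennreal (h y)) x =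
    (\<integral>\<^sup>+y. ennreal (indicator {0<..<x} y * (K x y * h y)) \<partial>lborel)"
proof -
  have "nnconv (rl_kernel 1) (\<lambda>y. ennreal y * ennreal (h y)) x + ennreal \<alpha> * nnconv (rl_kernel (2 - \<alpha>)) (\<lambda>y. ennreal (h y)) x =
     (\<integral>\<^sup>+y. rl_kernel 1 (x - y) * (ennreal y * ennreal (h y)) + ennreal \<alpha> * (rl_kernel (2 - \<alpha>) (x - y) * ennreal (h y)) \<partial>lborel)"
    unfolding nnconv_def by (subst nn_integral_add) (auto simp: nn_integral_cmult)
  also have "\<dots> = (\<integral>\<^sup>+y. ennreal (indicator {0<..<x} y * (K x y * h y)) \<partial>lborel)"
  proof (rule nn_integral_cong)
    fix y
    show "rl_kernel 1 (x - y) * (ennreal y * ennreal (h y)) + ennreal \<alpha> * (rl_kernel (2 - \<alpha>) (x - y) * ennreal (h y)) =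
      ennreal (indicator {0<..<x} y * (K x y * h y))"
    proof (cases "0 < y \<and> y < x")
      case True
      define c where "c = \<alpha> * ((x - y) powr (2 - \<alpha> - 1) / Gamma (2 - \<alpha>))"
      have c: "0 \<le> c" using index_gt_1 Gamma_2_minus_pos by (simp add: c_def)
      have "(x - y) powr (2 - \<alpha> - 1) = 1 / (x - y) powr (\<alpha> - 1)"
        using powr_minus_divide[of "x - y" "\<alpha> - 1"] by simp
      then have K: "K x y = y + c" by (simp add: volterra_kernel_def c_def)
      have "rl_kernel 1 (x - y) * (ennreal y * ennreal (h y)) + ennreal \<alpha> * (rl_kernel (2 - \<alpha>) (x - y) * ennreal (h y)) =
          ennreal y * ennreal (h y) + ennreal c * ennreal (h y)"
      proof -
        have "ennreal c = ennreal \<alpha> * ennreal ((x - y) powr (2 - \<alpha> - 1) / Gamma (2 - \<alpha>))"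
          unfolding c_def using index_gt_1 Gamma_2_minus_pos by (intro ennreal_mult) auto
        moreover have "rl_kernel (2 - \<alpha>) (x - y) = ennreal ((x - y) powr (2 - \<alpha> - 1) / Gamma (2 - \<alpha>))" "rl_kernel 1 (x - y) = 1"
          using True by (auto simp: rl_kernel_def)
        ultimately show ?thesis by (simp only: mult.assoc mult_1)
      qed
      also have "\<dots> = ennreal (K x y) * ennreal (h y)"
        using True c by (simp add: K distrib_right ennreal_plus)
      also have "\<dots> = ennreal (K x y * h y)" using volterra_kernel_pos[of y x] True by (simp add: ennreal_mult')
      finally show ?thesis using True by simp
    next
      case False
      then show ?thesis using h[of y] by (cases "y \<le> 0") (auto simp: rl_kernel_def)
    qed
  qed
  finally show ?thesis .
qed

text \<open>
  Only the products of \<open>g\<close> with the kernels are known to be measurable; dividing by the positive kernel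
  recovers \<open>g\<close> on every bounded interval.
\<close>

lemma volterra_solution_measurable:
  assumes "volterra_solution \<alpha> g"
  shows "(\<lambda>y. indicator {0<..} y * g y) \<in> borel_measurable lebesgue"
proof (rule borel_measurable_LIMSEQ_real)
  fix n :: nat
  have x: "0 < real (Suc n)" by simp
  have "(\<lambda>y. indicator {0<..<real (Suc n)} y *\<^sub>R (K (real (Suc n)) y * g y)) \<in> borel_measurable lebesgue"
    using assms x unfolding volterra_solution_def set_integrable_def by (auto intro: borel_measurable_integrable)
  moreover have "(\<lambda>y. inverse (K (real (Suc n)) y)) \<in> borel_measurable lebesgue"
    by (rule measurable_completion) measurable
  ultimately have "(\<lambda>y. inverse (K (real (Suc n)) y) * (indicator {0<..<real (Suc n)} y *\<^sub>R (K (real (Suc n)) y * g y))) \<in> borel_measurable lebesgue"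
    by (rule borel_measurable_times[rotated])
  also have "(\<lambda>y. inverse (K (real (Suc n)) y) * (indicator {0<..<real (Suc n)} y *\<^sub>R (K (real (Suc n)) y * g y))) =
      (\<lambda>y. indicator {0<..<real (Suc n)} y * g y)"
    using volterra_kernel_pos[of _ "real (Suc n)"] by (fastforce simp: indicator_def fun_eq_iff)
  finally show "(\<lambda>y. indicator {0<..<real (Suc n)} y * g y) \<in> borel_measurable lebesgue" .
next
  fix y :: real
  obtain N where "y < real N" using reals_Archimedean2 by blast
  then have "eventually (\<lambda>n. indicator {0<..<real (Suc n)} y * g y = indicator {0<..} y * g y) sequentially"
    by (intro eventually_sequentiallyI[of N]) (auto simp: indicator_def)
  then show "(\<lambda>n. indicator {0<..<real (Suc n)} y * g y) \<longlonglongrightarrow> indicator {0<..} y * g y"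
    by (rule tendsto_eventually)
qed

text \<open>
  A solution is only Lebesgue measurable, whereas convolutions are taken of Borel functions. So it is
  replaced by a Borel version, which then is split into positive and negative parts.
\<close>

lemma volterra_solution_imp_pair:
  assumes g: "volterra_solution \<alpha> g"
  obtains h where "h \<in> borel_measurable borel" "\<And>x. x \<le> 0 \<Longrightarrow> h x = 0"
    "AE x in lborel. 0 < x \<longrightarrow> h x = g x"
    "resolvent_pair (\<lambda>x. ennreal (h x)) (\<lambda>x. ennreal (- h x))"
proof -
  obtain h0 where [measurable]: "h0 \<in> borel_measurable borel" and h0: "AE y in lborel. indicator {0<..} y * g y = h0 y"
    using completion_ex_borel_measurable_real[OF volterra_solution_measurable[OF g]] by auto
  define h where "h y = indicator {0<..} y * h0 y" for y :: real
  have h_meas [measurable]: "h \<in> borel_measurable borel" unfolding h_def[abs_def] by measurable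
  have h_neg: "h x = 0" if "x \<le> 0" for x using that by (simp add: h_def)
  have hg: "AE x in lborel. 0 < x \<longrightarrow> h x = g x"
    using h0 by eventually_elim (auto simp: h_def)
  have int: "integrable lborel (\<lambda>y. indicator {0<..<x} y * (K x y * h y))"
    and val: "(\<integral>y. indicator {0<..<x} y * (K x y * h y) \<partial>lborel) = \<alpha> / Gamma (1 / \<alpha>)" if x: "0 < x" for x
  proof -
    let ?F = "\<lambda>y. indicator {0<..<x} y * (K x y * g y)" and ?H = "\<lambda>y. indicator {0<..<x} y * (K x y * h y)"
    have ai: "(\<lambda>y. K x y * g y) absolutely_integrable_on {0<..<x}"
      using g x by (auto simp: volterra_solution_def)
    then have F: "integrable lebesgue ?F" by (simp add: set_integrable_def)
    have ae: "AE y in lebesgue. ?F y = ?H y"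
      using AE_completion[OF hg] by eventually_elim (auto simp: indicator_def)
    have Hm: "?H \<in> borel_measurable lborel" by measurable
    have "integrable lebesgue ?H"
      using F integrable_cong_AE[OF borel_measurable_integrable[OF F] measurable_completion[OF Hm] ae] by simp
    then show "integrable lborel ?H" using integrable_completion[OF Hm] by simp
    have "(\<integral>y. ?H y \<partial>lborel) = (\<integral>y. ?H y \<partial>lebesgue)" by (rule integral_completion[OF Hm, symmetric])
    also have "\<dots> = (\<integral>y. ?F y \<partial>lebesgue)"
      by (rule integral_cong_AE[OF borel_measurable_integrable[OF F] measurable_completion[OF Hm] ae, symmetric])
    also have "\<dots> = integral {0<..<x} (\<lambda>y. K x y * g y)"
      using set_lebesgue_integral_eq_integral(2)[OF ai] by (simp add: set_lebesgue_integral_def)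
    also have "\<dots> = \<alpha> / Gamma (1 / \<alpha>)" using g x by (auto simp: volterra_solution_def)
    finally show "(\<integral>y. ?H y \<partial>lborel) = \<alpha> / Gamma (1 / \<alpha>)" .
  qed
  have fin: "(\<integral>\<^sup>+y. ennreal (s * (indicator {0<..<x} y * (K x y * h y))) \<partial>lborel) < \<infinity>" if "0 < x" "s = 1 \<or> s = - 1" for x s
  proof -
    have "(\<integral>\<^sup>+y. ennreal (s * (indicator {0<..<x} y * (K x y * h y))) \<partial>lborel) \<le>
        (\<integral>\<^sup>+y. ennreal (norm (indicator {0<..<x} y * (K x y * h y))) \<partial>lborel)"
      using that(2) by (intro nn_integral_mono ennreal_leI) auto
    also have "\<dots> < \<infinity>" using int[OF that(1)] by (simp add: integrable_iff_bounded)
    finally show ?thesis .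
  qed
  \<comment> \<open>The sign s treats the positive and the negative part at once.\<close>
  have lf: "locally_finite (\<lambda>x. ennreal (s * h x))" if s: "s = 1 \<or> s = - 1" for s
    unfolding locally_finite_def
  proof (intro conjI allI impI)
    fix T :: real
    define x where "x = \<bar>T\<bar> + 1"
    define m where "m = \<alpha> / Gamma (2 - \<alpha>) * (1 / x powr (\<alpha> - 1))"
    have x: "0 < x" "T < x" by (auto simp: x_def)
    have m: "0 < m" using x(1) index_gt_1 Gamma_2_minus_pos by (auto simp: m_def)
    have "(\<integral>\<^sup>+y. ennreal (s * h y) * indicator {..T} y \<partial>lborel) \<le>
        (\<integral>\<^sup>+y. ennreal (1 / m) * ennreal (s * (indicator {0<..<x} y * (K x y * h y))) \<partial>lborel)"
    proof (rule nn_integral_mono)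
      fix y
      show "ennreal (s * h y) * indicator {..T} y \<le> ennreal (1 / m) * ennreal (s * (indicator {0<..<x} y * (K x y * h y)))"
      proof (cases "0 < y \<and> y \<le> T \<and> 0 < s * h y")
        case True
        then have y: "0 < y" "y < x" using x by auto
        have "m * (s * h y) \<le> K x y * (s * h y)"
          using volterra_kernel_ge[OF y] True by (intro mult_right_mono) (auto simp: m_def)
        then have "s * h y \<le> 1 / m * (K x y * (s * h y))" using m by (simp add: field_simps)
        then have "ennreal (s * h y) \<le> ennreal (1 / m * (K x y * (s * h y)))" by (rule ennreal_leI)
        also have "\<dots> = ennreal (1 / m) * ennreal (K x y * (s * h y))"
        proof (rule ennreal_mult)
          show "0 \<le> K x y * (s * h y)"
            by (rule mult_nonneg_nonneg) (use True volterra_kernel_pos[OF y] in auto)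
        qed (use m in simp)
        also have "K x y * (s * h y) = s * (indicator {0<..<x} y * (K x y * h y))"
          using y by (simp add: mult.left_commute)
        finally show ?thesis using True by simp
      next
        case False
        then have zero: "ennreal (s * h y) * indicator {..T} y = 0"
          using h_neg[of y] by (cases "y \<le> 0") (auto simp: indicator_def ennreal_neg)
        show ?thesis unfolding zero by simp
      qed
    qed
    also have "\<dots> = ennreal (1 / m) * (\<integral>\<^sup>+y. ennreal (s * (indicator {0<..<x} y * (K x y * h y))) \<partial>lborel)"
      by (rule nn_integral_cmult) measurable
    also have "\<dots> < \<infinity>" using fin[OF x(1) s] by (simp add: ennreal_mult_less_top)
    finally show "(\<integral>\<^sup>+y. ennreal (s * h y) * indicator {..T} y \<partial>lborel) < \<infinity>" .
  qed (auto simp: h_neg)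
  have "resolvent_pair (\<lambda>x. ennreal (h x)) (\<lambda>x. ennreal (- h x))"
  proof (rule volterra_imp_resolvent_pair)
    show "locally_finite (\<lambda>x. ennreal (h x))" "locally_finite (\<lambda>x. ennreal (- h x))"
      using lf[of 1] lf[of "- 1"] by auto
    fix x :: real
    let ?H = "\<lambda>y. indicator {0<..<x} y * (K x y * h y)"
    have "(\<integral>\<^sup>+y. ennreal (?H y) \<partial>lborel) = ennreal (\<alpha> / Gamma (1 / \<alpha>)) * rl_kernel 1 x + (\<integral>\<^sup>+y. ennreal (- ?H y) \<partial>lborel)"
    proof (cases "0 < x")
      case True
      obtain a where a: "0 \<le> a" "(\<integral>\<^sup>+y. ennreal (?H y) \<partial>lborel) = ennreal a"
        using fin[OF True, of 1] by (cases "\<integral>\<^sup>+y. ennreal (?H y) \<partial>lborel") auto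
      obtain b where b: "0 \<le> b" "(\<integral>\<^sup>+y. ennreal (- ?H y) \<partial>lborel) = ennreal b"
        using fin[OF True, of "- 1"] by (cases "\<integral>\<^sup>+y. ennreal (- ?H y) \<partial>lborel") auto
      have "\<alpha> / Gamma (1 / \<alpha>) = a - b"
        using real_lebesgue_integral_def[OF int[OF True]] a b unfolding val[OF True] by simp
      then have "a = \<alpha> / Gamma (1 / \<alpha>) + b" by simp
      then show ?thesis using True b(1) C_pos unfolding a(2) b(2) by (simp add: rl_kernel_1 ennreal_plus)
    next
      case False
      then have "?H = (\<lambda>_. 0)" by (auto simp: indicator_def)
      then show ?thesis using False by (simp add: rl_kernel_1)
    qed
    then show "nnconv (rl_kernel 1) (\<lambda>y. ennreal y * ennreal (h y)) x + ennreal \<alpha> * nnconv (rl_kernel (2 - \<alpha>)) (\<lambda>y. ennreal (h y)) x =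
       ennreal (\<alpha> / Gamma (1 / \<alpha>)) * rl_kernel 1 x +
       (nnconv (rl_kernel 1) (\<lambda>y. ennreal y * ennreal (- h y)) x + ennreal \<alpha> * nnconv (rl_kernel (2 - \<alpha>)) (\<lambda>y. ennreal (- h y)) x)"
      using nnconv_volterra[of h x] nnconv_volterra[of "\<lambda>y. - h y" x] h_neg by simp
  qed
  with that[of h] h_neg hg show ?thesis by simp
qed

theorem volterra_solution_unique:
  assumes "volterra_solution \<alpha> f" "volterra_solution \<alpha> g"
  shows "AE x in lborel. 0 < x \<longrightarrow> g x = f x"
proof -
  obtain h where h: "AE x in lborel. 0 < x \<longrightarrow> h x = f x" "resolvent_pair (\<lambda>x. ennreal (h x)) (\<lambda>x. ennreal (- h x))"
    by (rule volterra_solution_imp_pair[OF assms(1)]) (rule that)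
  obtain l where l: "AE x in lborel. 0 < x \<longrightarrow> l x = g x" "resolvent_pair (\<lambda>x. ennreal (l x)) (\<lambda>x. ennreal (- l x))"
    by (rule volterra_solution_imp_pair[OF assms(2)]) (rule that)
  from resolvent_pair_unique[OF h(2) l(2)] h(1) l(1) show ?thesis
  proof eventually_elim
    case (elim x)
    have "h x = l x"
      using elim(1) by (cases "0 \<le> h x"; cases "0 \<le> l x") (auto simp: ennreal_neg ennreal_plus[symmetric] simp del: ennreal_plus)
    with elim(2,3) show ?case by auto
  qed
qed

text \<open>
  The parts of \<open>f\<close> cannot both be positive at a point, so \<open>f\<^sup>+ = d + f\<^sup>-\<close> forces \<open>f\<^sup>- = 0\<close>. This is where
  the sign of \<open>f\<close> comes from.
\<close>

theorem volterra_solution_eq_resolvent_density: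
  assumes f: "volterra_solution \<alpha> f" and d: "resolvent_pair d (\<lambda>_. 0)"
  shows "AE x in lborel. 0 < x \<longrightarrow> 0 \<le> f x \<and> d x = ennreal (f x)"
proof -
  obtain h where h: "AE x in lborel. 0 < x \<longrightarrow> h x = f x" "resolvent_pair (\<lambda>x. ennreal (h x)) (\<lambda>x. ennreal (- h x))"
    by (rule volterra_solution_imp_pair[OF f]) (rule that)
  from resolvent_pair_unique[OF h(2) d] h(1) show ?thesis
  proof eventually_elim
    case (elim x)
    have "0 \<le> h x \<and> d x = ennreal (h x)"
      using elim(1) by (cases "0 \<le> h x") (auto simp: ennreal_neg)
    with elim(2) show ?case by auto
  qed
qed

end

section \<open>The fractional differential equation\<close>

lemma absolutely_integrable_weight:
  fixes F w :: "real \<Rightarrow> real"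
  assumes F: "F absolutely_integrable_on S" and S: "S \<in> sets borel"
    and w: "w \<in> borel_measurable borel" and B: "\<And>y. y \<in> S \<Longrightarrow> \<bar>w y\<bar> \<le> B"
  shows "(\<lambda>y. w y * F y) absolutely_integrable_on S"
proof (rule absolutely_integrable_bounded_measurable_product_real[OF _ _ _ F])
  show "S \<in> sets lebesgue" using S by (simp add: sets_completionI_sets)
  show "w \<in> borel_measurable (lebesgue_on S)"
    using w by (intro measurable_restrict_space1 measurable_completion) simp
  show "bounded (w ` S)" using B unfolding bounded_iff by auto
qed

context stable_index
begin

abbreviation abel :: "(real \<Rightarrow> real) \<Rightarrow> real \<Rightarrow> real" where
  "abel g u \<equiv> integral {0<..<u} (\<lambda>y. g y / (u - y) powr (\<alpha> - 1))"

abbreviation c\<^sub>0 :: real where "c\<^sub>0 \<equiv> \<alpha> / Gamma (2 - \<alpha>)"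

lemma c0_pos: "0 < c\<^sub>0"
  using index_gt_1 Gamma_2_minus_pos by simp

lemma scaled_rl_derivative: "\<alpha> * rl_derivative (\<alpha> - 1) g x = c\<^sub>0 * deriv (abel g) x"
proof -
  have "1 - (\<alpha> - 1) = 2 - \<alpha>" by simp
  then show ?thesis unfolding rl_derivative_def by (simp only:) simp
qed

lemma abel_integrand_eq:
  assumes "y \<in> {0<..<x}"
  shows "K x y = y + c\<^sub>0 * (1 / (x - y) powr (\<alpha> - 1))"
    and "0 < (x - y) powr (\<alpha> - 1)" "(x - y) powr (\<alpha> - 1) \<le> x powr (\<alpha> - 1)"
    and "K x y * (x - y) powr (\<alpha> - 1) = y * (x - y) powr (\<alpha> - 1) + c\<^sub>0"
proof -
  show "K x y = y + c\<^sub>0 * (1 / (x - y) powr (\<alpha> - 1))" by (simp add: volterra_kernel_def)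
  show "0 < (x - y) powr (\<alpha> - 1)" using assms by simp
  then show "K x y * (x - y) powr (\<alpha> - 1) = y * (x - y) powr (\<alpha> - 1) + c\<^sub>0"
    by (simp add: volterra_kernel_def distrib_right)
  show "(x - y) powr (\<alpha> - 1) \<le> x powr (\<alpha> - 1)"
    using assms index_gt_1 by (intro powr_mono2) auto
qed

text \<open>
  The factors relating the integrands \<open>K x y * g y\<close>, \<open>g y / (x - y) powr (\<alpha> - 1)\<close> and \<open>y * g y\<close> are
  bounded, so integrability passes between them as this and the next two lemmas state.
\<close>

lemma abel_imp_moment_integrable:
  assumes A: "(\<lambda>y. g y / (x - y) powr (\<alpha> - 1)) absolutely_integrable_on {0<..<x}"
  shows "(\<lambda>y. y * g y) absolutely_integrable_on {0<..<x}"
proof -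
  have "(\<lambda>y. (y * (x - y) powr (\<alpha> - 1)) * (g y / (x - y) powr (\<alpha> - 1))) absolutely_integrable_on {0<..<x}"
  proof (rule absolutely_integrable_weight[OF A, where B="x * x powr (\<alpha> - 1)"])
    fix y assume y: "y \<in> {0<..<x}"
    have "y * (x - y) powr (\<alpha> - 1) \<le> x * x powr (\<alpha> - 1)"
      using y abel_integrand_eq(3)[OF y] by (intro mult_mono) auto
    then show "\<bar>y * (x - y) powr (\<alpha> - 1)\<bar> \<le> x * x powr (\<alpha> - 1)" using y by simp
  qed auto
  moreover have "(y * (x - y) powr (\<alpha> - 1)) * (g y / (x - y) powr (\<alpha> - 1)) = y * g y" if "y \<in> {0<..<x}" for y
    using abel_integrand_eq(2)[OF that] by simp
  ultimately show ?thesis by (subst (asm) set_integrable_cong) auto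
qed

lemma volterra_imp_abel_integrable:
  assumes V: "(\<lambda>y. K x y * g y) absolutely_integrable_on {0<..<x}"
  shows "(\<lambda>y. g y / (x - y) powr (\<alpha> - 1)) absolutely_integrable_on {0<..<x}"
proof -
  have "(\<lambda>y. inverse (K x y * (x - y) powr (\<alpha> - 1)) * (K x y * g y)) absolutely_integrable_on {0<..<x}"
  proof (rule absolutely_integrable_weight[OF V, where B="inverse c\<^sub>0"])
    fix y assume y: "y \<in> {0<..<x}"
    have le: "c\<^sub>0 \<le> K x y * (x - y) powr (\<alpha> - 1)" using y abel_integrand_eq(4)[OF y] by simp
    have inv: "\<bar>inverse v\<bar> \<le> inverse c" if "c \<le> v" "0 < c" for v c :: real
      using that by (simp add: le_imp_inverse_le)
    show "\<bar>inverse (K x y * (x - y) powr (\<alpha> - 1))\<bar> \<le> inverse c\<^sub>0"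
      by (rule inv[OF le c0_pos])
  qed auto
  moreover have "inverse (K x y * (x - y) powr (\<alpha> - 1)) * (K x y * g y) = g y / (x - y) powr (\<alpha> - 1)" if "y \<in> {0<..<x}" for y
    using abel_integrand_eq(2)[OF that] volterra_kernel_pos[of y x] that by (simp add: field_simps)
  ultimately show ?thesis by (subst (asm) set_integrable_cong) auto
qed

lemma abel_imp_volterra_integral:
  assumes A: "(\<lambda>y. g y / (x - y) powr (\<alpha> - 1)) absolutely_integrable_on {0<..<x}"
  shows "(\<lambda>y. K x y * g y) absolutely_integrable_on {0<..<x}"
    and "integral {0<..<x} (\<lambda>y. K x y * g y) = integral {0<..<x} (\<lambda>y. y * g y) + c\<^sub>0 * abel g x"
proof -
  note Y = abel_imp_moment_integrable[OF A]
  have A': "(\<lambda>y. c\<^sub>0 * (g y / (x - y) powr (\<alpha> - 1))) absolutely_integrable_on {0<..<x}"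
    by (rule set_integrable_mult_right) (rule A)
  have eq: "K x y * g y = y * g y + c\<^sub>0 * (g y / (x - y) powr (\<alpha> - 1))" for y
    by (simp add: volterra_kernel_def distrib_right)
  show "(\<lambda>y. K x y * g y) absolutely_integrable_on {0<..<x}"
    unfolding eq by (rule set_integral_add(1)[OF Y A'])
  have "integral {0<..<x} (\<lambda>y. y * g y + c\<^sub>0 * (g y / (x - y) powr (\<alpha> - 1))) =
      integral {0<..<x} (\<lambda>y. y * g y) + integral {0<..<x} (\<lambda>y. c\<^sub>0 * (g y / (x - y) powr (\<alpha> - 1)))"
    by (rule integral_add) (use Y A' set_lebesgue_integral_eq_integral(1) in blast)+
  also have "integral {0<..<x} (\<lambda>y. c\<^sub>0 * (g y / (x - y) powr (\<alpha> - 1))) = c\<^sub>0 * abel g x"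
    by (rule integral_mult_right)
  finally show "integral {0<..<x} (\<lambda>y. K x y * g y) = integral {0<..<x} (\<lambda>y. y * g y) + c\<^sub>0 * abel g x"
    unfolding eq .
qed

lemma moment_integral:
  assumes A: "\<And>x. 0 < x \<Longrightarrow> (\<lambda>y. g y / (x - y) powr (\<alpha> - 1)) absolutely_integrable_on {0<..<x}"
  shows "0 < a \<Longrightarrow> a \<le> b \<Longrightarrow> integral {0<..<b} (\<lambda>y. y * g y) = integral {0<..<a} (\<lambda>y. y * g y) + integral {a..b} (\<lambda>y. y * g y)"
    and "((\<lambda>a. integral {0<..<a} (\<lambda>y. y * g y)) \<longlongrightarrow> 0) (at_right 0)"
proof -
  have Ioo: "integral {0<..<a} (\<lambda>y. y * g y) = integral {0..a} (\<lambda>y. y * g y)" for a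
    using integral_open_interval[of 0 a "\<lambda>y. y * g y"] by simp
  have int: "(\<lambda>y. y * g y) integrable_on {0..b}" if "0 < b" for b
    using set_lebesgue_integral_eq_integral(1)[OF abel_imp_moment_integrable[OF A[OF that]]]
    by (simp add: integrable_on_Icc_iff_Ioo)
  show "0 < a \<Longrightarrow> a \<le> b \<Longrightarrow> integral {0<..<b} (\<lambda>y. y * g y) = integral {0<..<a} (\<lambda>y. y * g y) + integral {a..b} (\<lambda>y. y * g y)"
    unfolding Ioo using Henstock_Kurzweil_Integration.integral_combine[of 0 a b "\<lambda>y. y * g y"] int[of b] by simp
  have "continuous_on {0..1} (\<lambda>a. integral {0..a} (\<lambda>y. y * g y))"
    by (rule indefinite_integral_continuous_1[OF int]) simp
  then have "((\<lambda>a. integral {0..a} (\<lambda>y. y * g y)) \<longlongrightarrow> integral {0..0} (\<lambda>y. y * g y)) (at 0 within {0..1})"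
    unfolding continuous_on_def by (rule bspec) simp
  then show "((\<lambda>a. integral {0<..<a} (\<lambda>y. y * g y)) \<longlongrightarrow> 0) (at_right 0)"
    unfolding Ioo by (simp add: at_within_Icc_at_right)
qed

text \<open>
  Compare \<open>g\<close> with \<open>L y\<^sup>\<alpha>\<^sup>-\<^sup>2\<close>: the Abel integral of \<open>y\<^sup>\<alpha>\<^sup>-\<^sup>2\<close> over \<open>(0, x)\<close> is a Beta integral whose value
  \<open>\<Gamma>(\<alpha> - 1) \<Gamma>(2 - \<alpha>)\<close> does not depend on \<open>x\<close>.
\<close>

lemma abel_limit_0:
  assumes A: "\<And>x. 0 < x \<Longrightarrow> (\<lambda>y. g y / (x - y) powr (\<alpha> - 1)) absolutely_integrable_on {0<..<x}"
    and lim: "((\<lambda>x. x powr (2 - \<alpha>) * g x) \<longlongrightarrow> L) (at_right 0)"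
  shows "(abel g \<longlongrightarrow> L * (Gamma (\<alpha> - 1) * Gamma (2 - \<alpha>))) (at_right 0)"
proof (rule tendstoI)
  let ?B = "Gamma (\<alpha> - 1) * Gamma (2 - \<alpha>)"
  have B: "0 < ?B" using index_gt_1 index_lt_2 by (intro mult_pos_pos Gamma_real_pos) auto
  fix e :: real assume e: "0 < e"
  let ?w = "\<lambda>x y. y powr (\<alpha> - 2) / (x - y) powr (\<alpha> - 1)"
  have w: "(?w x has_integral ?B) {0<..<x}" if x: "0 < x" for x
  proof -
    have "(\<integral>\<^sup>+y. ennreal ((x - y) powr ((2 - \<alpha>) - 1) * y powr ((\<alpha> - 1) - 1)) * indicator {0<..<x} y \<partial>lborel) =
      ennreal (x powr ((2 - \<alpha>) + (\<alpha> - 1) - 1) * (Gamma (2 - \<alpha>) * Gamma (\<alpha> - 1) / Gamma ((2 - \<alpha>) + (\<alpha> - 1))))"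
      using index_gt_1 index_lt_2 x by (intro nn_integral_beta) auto
    also have "\<dots> = ennreal ?B" using x by (simp add: mult.commute)
    also have "(\<integral>\<^sup>+y. ennreal ((x - y) powr ((2 - \<alpha>) - 1) * y powr ((\<alpha> - 1) - 1)) * indicator {0<..<x} y \<partial>lborel) =
        (\<integral>\<^sup>+y. ennreal (indicator {0<..<x} y * ?w x y) \<partial>lborel)"
    proof (rule nn_integral_cong)
      fix y
      have "(x - y) powr ((2 - \<alpha>) - 1) = 1 / (x - y) powr (\<alpha> - 1)"
        using powr_minus_divide[of "x - y" "\<alpha> - 1"] by simp
      then show "ennreal ((x - y) powr ((2 - \<alpha>) - 1) * y powr ((\<alpha> - 1) - 1)) * indicator {0<..<x} y = ennreal (indicator {0<..<x} y * ?w x y)"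
        by (simp add: indicator_def)
    qed
    finally have "((\<lambda>y. indicator {0<..<x} y * ?w x y) has_integral ?B) UNIV"
      using B by (intro nn_integral_has_integral) auto
    then have "((\<lambda>y. if y \<in> {0<..<x} then ?w x y else 0) has_integral ?B) UNIV"
      by (rule has_integral_eq[rotated]) (auto simp: indicator_def)
    then show ?thesis by (simp only: has_integral_restrict_UNIV)
  qed
  have "eventually (\<lambda>x. dist (x powr (2 - \<alpha>) * g x) L < e / (2 * ?B)) (at_right 0)"
    using tendstoD[OF lim, of "e / (2 * ?B)"] e B by simp
  then obtain d where d: "0 < d" "\<And>y. 0 < y \<Longrightarrow> y < d \<Longrightarrow> dist (y powr (2 - \<alpha>) * g y) L < e / (2 * ?B)"
    unfolding eventually_at_right_field by auto
  show "\<forall>\<^sub>F x in at_right 0. dist (abel g x) (L * ?B) < e"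
    unfolding eventually_at_right_field
  proof (intro exI[of _ d] conjI allI impI d(1))
    fix x assume x: "0 < x" "x < d"
    have "(\<lambda>y. g y / (x - y) powr (\<alpha> - 1)) integrable_on {0<..<x}"
      by (rule set_lebesgue_integral_eq_integral(1)[OF A[OF x(1)]])
    then have D: "((\<lambda>y. g y / (x - y) powr (\<alpha> - 1) - L * ?w x y) has_integral abel g x - L * ?B) {0<..<x}"
      by (intro has_integral_diff has_integral_mult_right w[OF x(1)] integrable_integral)
    have "norm (abel g x - L * ?B) \<le> e / (2 * ?B) * ?B"
      unfolding integral_unique[OF D, symmetric] integral_unique[OF has_integral_mult_right[OF w[OF x(1)], of "e / (2 * ?B)"], symmetric]
    proof (rule Henstock_Kurzweil_Integration.integral_norm_bound_integral)
      show "(\<lambda>y. g y / (x - y) powr (\<alpha> - 1) - L * ?w x y) integrable_on {0<..<x}" using D by (rule has_integral_integrable)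
      show "(\<lambda>y. e / (2 * ?B) * ?w x y) integrable_on {0<..<x}" using has_integral_mult_right[OF w[OF x(1)]] by (rule has_integral_integrable)
      fix y assume y: "y \<in> {0<..<x}"
      have yp: "y powr (\<alpha> - 2) * y powr (2 - \<alpha>) = 1" using y by (simp flip: powr_add)
      have "g y / (x - y) powr (\<alpha> - 1) - L * ?w x y = (y powr (2 - \<alpha>) * g y - L) * ?w x y"
        using yp by (simp add: algebra_simps diff_divide_distrib)
      then have "norm (g y / (x - y) powr (\<alpha> - 1) - L * ?w x y) = dist (y powr (2 - \<alpha>) * g y) L * ?w x y"
        by (simp add: abs_mult dist_real_def)
      also have "\<dots> \<le> e / (2 * ?B) * ?w x y" using d(2)[of y] x y by (intro mult_right_mono) auto
      finally show "norm (g y / (x - y) powr (\<alpha> - 1) - L * ?w x y) \<le> e / (2 * ?B) * ?w x y" .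
    qed
    also have "\<dots> < e" using B e by simp
    finally show "dist (abel g x) (L * ?B) < e" by (simp add: dist_real_def)
  qed
qed

text \<open>
  The fractional equation says that \<open>abel g x\<close> plus the integral of \<open>y g y\<close> over \<open>(0, x)\<close>, suitably
  weighted, has derivative zero. The value of this constant is read off as \<open>x\<close> tends to \<open>0\<close>.
\<close>

theorem fractional_imp_volterra:
  assumes g: "fractional_solution \<alpha> g"
  shows "volterra_solution \<alpha> g"
  unfolding volterra_solution_def
proof (intro allI impI)
  fix x :: real assume x: "0 < x"
  let ?I = "\<lambda>a. integral {0<..<a} (\<lambda>y. y * g y)"
  have A: "(\<lambda>y. g y / (x - y) powr (\<alpha> - 1)) absolutely_integrable_on {0<..<x}"
    and diff: "abel g field_differentiable (at x)"
    and eq: "x * g x + \<alpha> * rl_derivative (\<alpha> - 1) g x = 0" if "0 < x" for x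
    using g that by (auto simp: fractional_solution_def rl_admissible_def)
  have der: "(abel g has_real_derivative - (x * g x / c\<^sub>0)) (at x)" if "0 < x" for x
  proof -
    have 1: "x * g x + c\<^sub>0 * deriv (abel g) x = 0" using eq[OF that] unfolding scaled_rl_derivative .
    have 2: "d = - (p / c)" if "p + c * d = 0" "0 < c" for p c d :: real
      using that by (simp add: field_simps)
    have 3: "deriv (abel g) x = - (x * g x / c\<^sub>0)" by (rule 2[OF 1 c0_pos])
    show ?thesis using diff[OF that] unfolding DERIV_deriv_iff_field_differentiable[symmetric] 3 .
  qed
  have ftc: "abel g x + ?I x / c\<^sub>0 = abel g a + ?I a / c\<^sub>0" if a: "0 < a" "a \<le> x" for a
  proof -
    have "((\<lambda>y. - (y * g y / c\<^sub>0)) has_integral abel g x - abel g a) {a..x}"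
    proof (rule fundamental_theorem_of_calculus[OF a(2)])
      fix y assume "y \<in> {a..x}"
      with a have "0 < y" by simp
      from has_field_derivative_at_within[OF der[OF this]]
      show "(abel g has_vector_derivative - (y * g y / c\<^sub>0)) (at y within {a..x})"
        unfolding has_real_derivative_iff_has_vector_derivative .
    qed
    from has_integral_mult_right[OF this, of "- c\<^sub>0"]
    have "((\<lambda>y. - c\<^sub>0 * - (y * g y / c\<^sub>0)) has_integral - c\<^sub>0 * (abel g x - abel g a)) {a..x}" .
    moreover have "- c * - (p / c) = p" if "0 < c" for c p :: real using that by simp
    note this[OF c0_pos]
    ultimately have "integral {a..x} (\<lambda>y. y * g y) = - c\<^sub>0 * (abel g x - abel g a)"
      by (simp only: integral_unique)
    then have 1: "?I x = ?I a + - c\<^sub>0 * (abel g x - abel g a)"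
      using moment_integral(1)[of g a x, OF A a] by (simp only:)
    have 2: "jx + i / c = ja + ia / c" if "i = ia + - c * (jx - ja)" "0 < c" for i ia c jx ja :: real
      using that by (simp add: field_simps)
    show ?thesis by (rule 2[OF 1 c0_pos])
  qed
  have "((\<lambda>a. abel g a + ?I a / c\<^sub>0) \<longlongrightarrow> 1 / (Gamma (\<alpha> - 1) * Gamma (1 / \<alpha>)) * (Gamma (\<alpha> - 1) * Gamma (2 - \<alpha>)) + 0 / c\<^sub>0) (at_right 0)"
  proof (intro tendsto_add tendsto_divide tendsto_const abel_limit_0[OF A] moment_integral(2)[OF A])
    show "((\<lambda>x. x powr (2 - \<alpha>) * g x) \<longlongrightarrow> 1 / (Gamma (\<alpha> - 1) * Gamma (1 / \<alpha>))) (at_right 0)"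
      using g by (simp add: fractional_solution_def)
  qed (use c0_pos in auto)
  moreover have "((\<lambda>a. abel g a + ?I a / c\<^sub>0) \<longlongrightarrow> abel g x + ?I x / c\<^sub>0) (at_right 0)"
  proof (rule tendsto_eventually)
    show "eventually (\<lambda>a. abel g a + ?I a / c\<^sub>0 = abel g x + ?I x / c\<^sub>0) (at_right 0)"
      unfolding eventually_at_right_field using x ftc by (intro exI[of _ x]) auto
  qed
  ultimately have "abel g x + ?I x / c\<^sub>0 = 1 / (Gamma (\<alpha> - 1) * Gamma (1 / \<alpha>)) * (Gamma (\<alpha> - 1) * Gamma (2 - \<alpha>)) + 0 / c\<^sub>0"
    using tendsto_unique trivial_limit_at_right_real by blast
  also have "\<dots> = Gamma (2 - \<alpha>) / Gamma (1 / \<alpha>)"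
  proof -
    have "0 < Gamma (\<alpha> - 1)" using index_gt_1 by (intro Gamma_real_pos) simp
    then show ?thesis by simp
  qed
  finally have 1: "abel g x + ?I x / c\<^sub>0 = Gamma (2 - \<alpha>) / Gamma (1 / \<alpha>)" .
  have 2: "i + c * j = c * r" if "j + i / c = r" "0 < c" for i c j r :: real
    using that by (auto simp: distrib_left)
  have "?I x + c\<^sub>0 * abel g x = c\<^sub>0 * (Gamma (2 - \<alpha>) / Gamma (1 / \<alpha>))"
    by (rule 2[OF 1 c0_pos])
  then have "?I x + c\<^sub>0 * abel g x = \<alpha> / Gamma (1 / \<alpha>)"
    using Gamma_2_minus_pos by simp
  then show "(\<lambda>y. K x y * g y) absolutely_integrable_on {0<..<x} \<and> integral {0<..<x} (\<lambda>y. K x y * g y) = \<alpha> / Gamma (1 / \<alpha>)"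
    using abel_imp_volterra_integral[OF A[OF x]] by simp
qed

text \<open>
  The Volterra equation expresses the Abel integral through the integral of \<open>y f y\<close>, which is
  differentiable because \<open>f\<close> is continuous.
\<close>

theorem volterra_imp_fractional:
  assumes f: "volterra_solution \<alpha> f" and cont: "continuous_on {0<..} f"
    and lim: "((\<lambda>x. x powr (2 - \<alpha>) * f x) \<longlongrightarrow> 1 / (Gamma (\<alpha> - 1) * Gamma (1 / \<alpha>))) (at_right 0)"
  shows "fractional_solution \<alpha> f"
proof -
  let ?I = "\<lambda>a. integral {0<..<a} (\<lambda>y. y * f y)"
  have A: "(\<lambda>y. f y / (x - y) powr (\<alpha> - 1)) absolutely_integrable_on {0<..<x}" if "0 < x" for x
    using f that by (intro volterra_imp_abel_integrable) (auto simp: volterra_solution_def)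
  have abel: "abel f x = (\<alpha> / Gamma (1 / \<alpha>) - ?I x) / c\<^sub>0" if "0 < x" for x
  proof -
    have 1: "\<alpha> / Gamma (1 / \<alpha>) = ?I x + c\<^sub>0 * abel f x"
      unfolding abel_imp_volterra_integral(2)[OF A[OF that], symmetric] using f that by (simp add: volterra_solution_def)
    have 2: "j = (r - i) / c" if "r = i + c * j" "0 < c" for i c j r :: real
      using that by simp
    show ?thesis by (rule 2[OF 1 c0_pos])
  qed
  have der: "(abel f has_real_derivative - (x * f x / c\<^sub>0)) (at x)" if x: "0 < x" for x
  proof -
    have "continuous_on {x / 2..x + 1} (\<lambda>y. y * f y)"
      using x by (intro continuous_intros continuous_on_subset[OF cont]) auto
    then have "((\<lambda>u. integral {x / 2..u} (\<lambda>y. y * f y)) has_real_derivative x * f x) (at x within {x / 2..x + 1})"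
      using x by (intro integral_has_real_derivative) auto
    then have d: "((\<lambda>u. integral {x / 2..u} (\<lambda>y. y * f y)) has_real_derivative x * f x) (at x)"
      using x by (subst (asm) at_within_interior) auto
    have "((\<lambda>u. (\<alpha> / Gamma (1 / \<alpha>) - (?I (x / 2) + integral {x / 2..u} (\<lambda>y. y * f y))) / c\<^sub>0) has_real_derivative (0 - (0 + x * f x)) / c\<^sub>0) (at x)"
      by (intro DERIV_cdivide DERIV_diff DERIV_const DERIV_add d)
    then have "(abel f has_real_derivative (0 - (0 + x * f x)) / c\<^sub>0) (at x)"
    proof (rule has_field_derivative_transform_within_open[where S="{x / 2<..}"])
      fix u assume "u \<in> {x / 2<..}"
      then show "(\<alpha> / Gamma (1 / \<alpha>) - (?I (x / 2) + integral {x / 2..u} (\<lambda>y. y * f y))) / c\<^sub>0 = abel f u"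
        using abel[of u] moment_integral(1)[of f "x / 2" u, OF A] x by simp
    qed (use x in auto)
    then show ?thesis by simp
  qed
  show ?thesis
    unfolding fractional_solution_def rl_admissible_def
  proof (intro conjI allI impI lim A)
    fix x :: real assume x: "0 < x"
    show "abel f field_differentiable (at x)" using der[OF x] field_differentiable_def by blast
    have cancel: "c * - (p / c) = - p" if "0 < c" for c p :: real using that by simp
    have "\<alpha> * rl_derivative (\<alpha> - 1) f x = - (x * f x)" 
      unfolding scaled_rl_derivative DERIV_imp_deriv[OF der[OF x]]
      by (rule cancel[OF c0_pos])
    then show "x * f x + \<alpha> * rl_derivative (\<alpha> - 1) f x = 0" by simp
  qed
qed

text \<open>
  Solutions agree almost everywhere by uniqueness for the Volterra equation. Hence they have the same
  Abel integrals and fractional derivatives everywhere, and the fractional equation itself upgrades the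
  equality to every point.
\<close>

theorem fractional_solution_unique:
  assumes f: "fractional_solution \<alpha> f" and g: "fractional_solution \<alpha> g" and x: "0 < x"
  shows "g x = f x"
proof -
  have "AE x in lborel. 0 < x \<longrightarrow> g x = f x"
    by (intro volterra_solution_unique fractional_imp_volterra f g)
  then obtain N where N: "{x \<in> space lborel. \<not> (0 < x \<longrightarrow> g x = f x)} \<subseteq> N" "emeasure lborel N = 0" "N \<in> sets lborel"
    by (rule AE_E)
  have "negligible N"
    unfolding negligible_iff_null_sets using N by (intro null_sets_completionI) auto
  then have neg: "negligible {x. \<not> (0 < x \<longrightarrow> g x = f x)}"
    by (rule negligible_subset) (use N in auto)
  have "abel g u = abel f u" for u
    by (rule integral_spike[OF neg]) auto
  then have "rl_derivative (\<alpha> - 1) g x = rl_derivative (\<alpha> - 1) f x" by (simp add: rl_derivative_def)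
  moreover have "x * g x + \<alpha> * rl_derivative (\<alpha> - 1) g x = 0" "x * f x + \<alpha> * rl_derivative (\<alpha> - 1) f x = 0"
    using f g x by (auto simp: fractional_solution_def)
  ultimately have "x * g x + \<alpha> * rl_derivative (\<alpha> - 1) f x = x * f x + \<alpha> * rl_derivative (\<alpha> - 1) f x"
    by simp
  then show ?thesis using x by simp
qed

end

section \<open>The power series\<close>

text \<open>
  Log-convexity: the slope of \<open>ln \<circ> \<Gamma>\<close> over \<open>[s, s + b]\<close> is at least that over \<open>[s - 1, s]\<close>,
  which is \<open>ln (s - 1)\<close>.
\<close>

lemma Gamma_ratio_le:
  fixes s b :: real
  assumes s: "1 < s" and b: "0 < b"
  shows "Gamma s / Gamma (s + b) \<le> (s - 1) powr (- b)"
proof -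
  have G: "0 < Gamma (s - 1)" "0 < Gamma s" "0 < Gamma (s + b)" using s b by (auto intro!: Gamma_real_pos)
  have "ln (Gamma s) \<le> (b / (1 + b)) * ln (Gamma (s - 1)) + (1 / (1 + b)) * ln (Gamma (s + b))"
  proof -
    \<comment> \<open>The point s as a convex combination of s - 1 and s + b.\<close>
    have "(1 - 1 / (1 + b)) *\<^sub>R (s - 1) + (1 / (1 + b)) *\<^sub>R (s + b) = (s - 1) + 1 / (1 + b) * (1 + b)"
      unfolding real_scaleR_def by algebra
    then have "(1 - 1 / (1 + b)) *\<^sub>R (s - 1) + (1 / (1 + b)) *\<^sub>R (s + b) = s" using b by simp
    moreover have "1 - 1 / (1 + b) = b / (1 + b)" using b by (simp add: field_simps)
    ultimately show ?thesis
      using convex_onD[OF log_convex_Gamma_real, of "1 / (1 + b)" "s - 1" "s + b"] s b by (simp add: o_def)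
  qed
  then have "(1 + b) * ln (Gamma s) \<le> (1 + b) * ((b / (1 + b)) * ln (Gamma (s - 1)) + (1 / (1 + b)) * ln (Gamma (s + b)))"
    using b by (intro mult_left_mono) auto
  also have "\<dots> = b * ln (Gamma (s - 1)) + ln (Gamma (s + b))" using b by (simp add: distrib_left)
  finally have 1: "(1 + b) * ln (Gamma s) \<le> b * ln (Gamma (s - 1)) + ln (Gamma (s + b))" .
  have "s - 1 \<notin> \<int>\<^sub>\<le>\<^sub>0" using s by (auto dest: nonpos_Ints_nonpos)
  from Gamma_plus1[OF this] have "Gamma s = (s - 1) * Gamma (s - 1)" by simp
  moreover have "ln ((s - 1) * Gamma (s - 1)) = ln (s - 1) + ln (Gamma (s - 1))" using s G(1) by (intro ln_mult_pos) simp
  ultimately have "ln (Gamma s) = ln (s - 1) + ln (Gamma (s - 1))" by simp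
  then have "ln (Gamma s) - ln (Gamma (s + b)) \<le> - b * ln (s - 1)" using 1 by (simp add: algebra_simps)
  then have "exp (ln (Gamma s) - ln (Gamma (s + b))) \<le> exp (- b * ln (s - 1))" by simp
  then show ?thesis using G s by (simp add: exp_diff powr_def)
qed

context stable_index
begin

definition sup_coeff :: "nat \<Rightarrow> real" where
  "sup_coeff k = 1 / (Gamma (\<alpha> * real (Suc k) - 1) * Gamma (- real (Suc k) + 1 + 1 / \<alpha>))"

lemma inverse_index_minus_nat: "1 / \<alpha> - real k \<notin> \<int>\<^sub>\<le>\<^sub>0"
proof
  assume "1 / \<alpha> - real k \<in> \<int>\<^sub>\<le>\<^sub>0"
  then obtain n :: int where "1 / \<alpha> - real k = real_of_int n" by (auto elim: nonpos_Ints_cases)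
  then have n: "1 / \<alpha> = real_of_int (n + int k)" by simp
  have "0 < 1 / \<alpha>" "1 / \<alpha> < 1" using index_gt_1 by auto
  then have "0 < n + int k" "n + int k < 1" unfolding n by linarith+
  then show False by linarith
qed

lemma sup_coeff_alt: "sup_coeff k = 1 / (Gamma (\<alpha> * real (Suc k) - 1) * Gamma (1 / \<alpha> - real k))"
  by (simp add: sup_coeff_def algebra_simps)

lemma index_mult_ge: "\<alpha> \<le> \<alpha> * real (Suc k)"
  using index_gt_1 by (simp add: mult_le_cancel_left1)

lemma Gamma_index_pos: "0 < Gamma (\<alpha> * real (Suc k) - 1)" "0 < Gamma (\<alpha> * real (Suc k))" "0 < Gamma (\<alpha> * real k + 1)"
proof -
  have "0 < \<alpha> * real (Suc k) - 1" "0 < \<alpha> * real (Suc k)" "0 < \<alpha> * real k + 1"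
    using index_gt_1 index_mult_ge[of k] by (linarith, linarith, simp add: add_nonneg_pos)
  then show "0 < Gamma (\<alpha> * real (Suc k) - 1)" "0 < Gamma (\<alpha> * real (Suc k))" "0 < Gamma (\<alpha> * real k + 1)"
    by (auto intro: Gamma_real_pos simp del: of_nat_Suc)
qed

text \<open>
  Up to a factor \<open>\<alpha>\<close> in the first one, these are the coefficients that the Abel part and the linear part
  of the Volterra kernel produce from the term of index \<open>k\<close>. The second one at \<open>k\<close> cancels \<open>\<alpha>\<close> times
  the first one at \<open>k + 1\<close>.
\<close>

lemma sup_coeff_telescope:
  shows "sup_coeff k * (Gamma (\<alpha> * real (Suc k) - 1) / Gamma (\<alpha> * real k + 1)) =
      1 / (Gamma (1 / \<alpha> - real k) * Gamma (\<alpha> * real k + 1))"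
    and "sup_coeff k / (\<alpha> * real (Suc k)) = - \<alpha> * (1 / (Gamma (1 / \<alpha> - real (Suc k)) * Gamma (\<alpha> * real (Suc k) + 1)))"
proof -
  note G = Gamma_index_pos[of k]
  show "sup_coeff k * (Gamma (\<alpha> * real (Suc k) - 1) / Gamma (\<alpha> * real k + 1)) =
      1 / (Gamma (1 / \<alpha> - real k) * Gamma (\<alpha> * real k + 1))"
    unfolding sup_coeff_alt using G by (simp del: of_nat_Suc)
  let ?n = "real (Suc k)"
  have p: "0 < \<alpha> * ?n - 1" "0 < \<alpha> * ?n" using index_mult_ge[of k] index_gt_1 by linarith+
  have r: "1 / \<alpha> - real k = 1 / \<alpha> - ?n + 1" by simp
  have g1: "Gamma (1 / \<alpha> - real k) = (1 / \<alpha> - ?n) * Gamma (1 / \<alpha> - ?n)"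
    unfolding r by (rule Gamma_plus1[OF inverse_index_minus_nat])
  have "\<alpha> * ?n - 1 \<notin> \<int>\<^sub>\<le>\<^sub>0" using p by (auto dest: nonpos_Ints_nonpos)
  from Gamma_plus1[OF this] have g2: "Gamma (\<alpha> * ?n) = (\<alpha> * ?n - 1) * Gamma (\<alpha> * ?n - 1)" by (simp del: of_nat_Suc)
  have "\<alpha> * ?n \<notin> \<int>\<^sub>\<le>\<^sub>0" using p by (auto dest: nonpos_Ints_nonpos)
  from Gamma_plus1[OF this] have g3: "Gamma (\<alpha> * ?n + 1) = \<alpha> * ?n * ((\<alpha> * ?n - 1) * Gamma (\<alpha> * ?n - 1))"
    unfolding g2 .
  have e: "1 / \<alpha> - ?n = - (\<alpha> * ?n - 1) / \<alpha>" using index_gt_1 by (simp add: field_simps)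
  have alg: "1 / (g * (- q / a * h)) / b = - a * (1 / (h * (b * (q * g))))" if "0 < q" "0 < a" for g q a h b :: real
    using that by (simp add: field_simps)
  show "sup_coeff k / (\<alpha> * ?n) = - \<alpha> * (1 / (Gamma (1 / \<alpha> - ?n) * Gamma (\<alpha> * ?n + 1)))"
    unfolding sup_coeff_alt g1 g3 e
    by (rule alg[OF p(1)]) (use index_gt_1 in simp)
qed

lemma sup_coeff_Suc:
  "\<bar>sup_coeff (Suc k)\<bar> = \<bar>sup_coeff k\<bar> / \<alpha> * (Gamma (\<alpha> * real (Suc k)) / Gamma (\<alpha> * real (Suc k) + (\<alpha> - 1)))"
proof -
  let ?n = "real (Suc k)"
  have p: "0 < \<alpha> * ?n" using index_gt_1 by simp
  have G: "0 < Gamma (\<alpha> * ?n)" "0 < Gamma (\<alpha> * ?n + 1)" "0 < Gamma (\<alpha> * ?n + (\<alpha> - 1))"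
    by (rule Gamma_real_pos, use p index_gt_1 in linarith)+
  have e: "\<alpha> * real (Suc (Suc k)) - 1 = \<alpha> * ?n + (\<alpha> - 1)" by (simp add: algebra_simps)
  have "\<alpha> * ?n \<notin> \<int>\<^sub>\<le>\<^sub>0" using p by (auto dest: nonpos_Ints_nonpos)
  note g3 = Gamma_plus1[OF this]
  define w where "w = 1 / Gamma (1 / \<alpha> - ?n)"
  have s1: "sup_coeff (Suc k) = w / Gamma (\<alpha> * ?n + (\<alpha> - 1))"
    unfolding sup_coeff_alt e w_def by (simp del: of_nat_Suc)
  have cancel: "v = c * (v / c)" if "0 < c" for v c :: real using that by simp
  have "sup_coeff k = \<alpha> * ?n * (sup_coeff k / (\<alpha> * ?n))" by (rule cancel[OF p])
  also have "\<dots> = \<alpha> * ?n * (- \<alpha> * (w / Gamma (\<alpha> * ?n + 1)))"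
    unfolding sup_coeff_telescope(2) w_def by (simp del: of_nat_Suc)
  also have "\<dots> = - \<alpha> * w / Gamma (\<alpha> * ?n)" unfolding g3 using p by (simp del: of_nat_Suc)
  finally have "w = - sup_coeff k * Gamma (\<alpha> * ?n) / \<alpha>" using G index_gt_1 by (simp add: field_simps del: of_nat_Suc)
  then show ?thesis unfolding s1 using G index_gt_1 by (simp add: abs_mult del: of_nat_Suc)
qed

text \<open>
  The ratio of successive coefficients decays like \<open>k\<^sup>1\<^sup>-\<^sup>\<alpha>\<close>.
\<close>

lemma summable_sup_coeff: "summable (\<lambda>k. \<bar>sup_coeff k\<bar> * z ^ k)" if z: "0 \<le> z" for z :: real
proof -
  have lim: "(\<lambda>k. z / \<alpha> * (\<alpha> * real (Suc k) - 1) powr (- (\<alpha> - 1))) \<longlonglongrightarrow> z / \<alpha> * 0"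
  proof (intro tendsto_mult tendsto_const tendsto_neg_powr)
    show "filterlim (\<lambda>k. \<alpha> * real (Suc k) - 1) at_top sequentially"
      using index_gt_1 by real_asymp
  qed (use index_gt_1 in auto)
  then have "eventually (\<lambda>k. z / \<alpha> * (\<alpha> * real (Suc k) - 1) powr (- (\<alpha> - 1)) < 1 / 2) sequentially"
    by (intro order_tendstoD(2)[OF lim]) simp
  then obtain N where N: "\<And>k. N \<le> k \<Longrightarrow> z / \<alpha> * (\<alpha> * real (Suc k) - 1) powr (- (\<alpha> - 1)) < 1 / 2"
    unfolding eventually_sequentially by auto
  show ?thesis
  proof (rule summable_ratio_test[where c="1/2" and N=N])
    fix k assume k: "N \<le> k"
    have G: "0 < Gamma (\<alpha> * real (Suc k) + (\<alpha> - 1))"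
      by (rule Gamma_real_pos) (use index_mult_ge[of k] index_gt_1 in linarith)
    have "norm (\<bar>sup_coeff (Suc k)\<bar> * z ^ Suc k) =
        (z / \<alpha> * (Gamma (\<alpha> * real (Suc k)) / Gamma (\<alpha> * real (Suc k) + (\<alpha> - 1)))) * norm (\<bar>sup_coeff k\<bar> * z ^ k)"
      unfolding sup_coeff_Suc using z index_gt_1 Gamma_index_pos[of k] G
      by (simp add: abs_mult del: of_nat_Suc)
    also have "\<dots> \<le> (z / \<alpha> * (\<alpha> * real (Suc k) - 1) powr (- (\<alpha> - 1))) * norm (\<bar>sup_coeff k\<bar> * z ^ k)"
      using z index_gt_1 less_le_trans[OF index_gt_1 index_mult_ge[of k]] by (intro mult_right_mono mult_left_mono Gamma_ratio_le) (auto simp del: of_nat_Suc)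
    also have "\<dots> \<le> 1 / 2 * norm (\<bar>sup_coeff k\<bar> * z ^ k)"
      using N[OF k] by (intro mult_right_mono) auto
    finally show "norm (\<bar>sup_coeff (Suc k)\<bar> * z ^ Suc k) \<le> 1 / 2 * norm (\<bar>sup_coeff k\<bar> * z ^ k)" .
  qed simp
qed

lemma summable_sup_series: "summable (\<lambda>k. sup_coeff k * z ^ k)" for z :: real
  by (rule summable_norm_cancel) (use summable_sup_coeff[of "\<bar>z\<bar>"] in \<open>simp add: abs_mult power_abs\<close>)

text \<open>
  An entire function of \<open>x powr \<alpha>\<close> times the singular factor; continuity and the behaviour at \<open>0\<close> are
  read off from this form.
\<close>

definition sup_density :: "real \<Rightarrow> real" where
  "sup_density x = x powr (\<alpha> - 2) * (\<Sum>k. sup_coeff k * (x powr \<alpha>) ^ k)"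

lemma powr_exponent: "0 < x \<Longrightarrow> x powr (\<alpha> * real (Suc k) - 2) = x powr (\<alpha> - 2) * (x powr \<alpha>) ^ k"
  by (simp add: powr_power algebra_simps flip: powr_add)

lemma sup_density_sums:
  assumes "0 < x" shows "(\<lambda>k. sup_coeff k * x powr (\<alpha> * real (Suc k) - 2)) sums sup_density x"
proof -
  have "(\<lambda>k. x powr (\<alpha> - 2) * (sup_coeff k * (x powr \<alpha>) ^ k)) sums sup_density x"
    unfolding sup_density_def by (intro sums_mult summable_sums summable_sup_series)
  then show ?thesis unfolding powr_exponent[OF assms] by (simp only: mult.left_commute)
qed

lemma isCont_sup_series: "isCont (\<lambda>z. \<Sum>k. sup_coeff k * z ^ k) z" for z :: real
  by (rule isCont_powser[of sup_coeff "\<bar>z\<bar> + 1"]) (auto intro: summable_sup_series)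

lemma continuous_on_sup_density: "continuous_on {0<..} sup_density"
  unfolding sup_density_def
  by (intro continuous_intros continuous_on_compose2[OF continuous_at_imp_continuous_on[of UNIV "\<lambda>z. \<Sum>k. sup_coeff k * z ^ k"]])
    (auto simp: isCont_sup_series)

lemma sup_density_limit_0:
  "((\<lambda>x. x powr (2 - \<alpha>) * sup_density x) \<longlongrightarrow> 1 / (Gamma (\<alpha> - 1) * Gamma (1 / \<alpha>))) (at_right 0)"
proof -
  have "((\<lambda>x::real. x powr \<alpha>) \<longlongrightarrow> 0 powr \<alpha>) (at_right 0)"
    using index_gt_1 by (intro tendsto_powr' tendsto_ident_at tendsto_const)
      (auto intro: eventually_mono[OF eventually_at_right_less[of 0]])
  then have "((\<lambda>x::real. x powr \<alpha>) \<longlongrightarrow> 0) (at_right 0)" by simp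
  from isCont_tendsto_compose[OF isCont_sup_series[of 0] this]
  have "((\<lambda>x. \<Sum>k. sup_coeff k * (x powr \<alpha>) ^ k) \<longlongrightarrow> (\<Sum>k. sup_coeff k * 0 ^ k)) (at_right 0)" .
  also have "(\<Sum>k. sup_coeff k * 0 ^ k) = sup_coeff 0" by (rule powser_zero)
  also have "sup_coeff 0 = 1 / (Gamma (\<alpha> - 1) * Gamma (1 / \<alpha>))" by (simp add: sup_coeff_def)
  finally show ?thesis
  proof (rule Lim_transform_eventually)
    show "\<forall>\<^sub>F x in at_right 0. (\<Sum>k. sup_coeff k * (x powr \<alpha>) ^ k) = x powr (2 - \<alpha>) * sup_density x"
      using eventually_at_right_less[of "0::real"]
    proof eventually_elim
      case (elim x)
      have "x powr (2 - \<alpha>) * x powr (\<alpha> - 2) = 1" using elim by (simp flip: powr_add)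
      then show ?case unfolding sup_density_def mult.assoc[symmetric] by simp
    qed
  qed
qed

lemma volterra_kernel_moment:
  assumes x: "0 < x"
  shows "integrable lborel (\<lambda>y. indicator {0<..<x} y * (K x y * y powr (\<alpha> * real (Suc k) - 2)))"
    and "(\<integral>y. indicator {0<..<x} y * (K x y * y powr (\<alpha> * real (Suc k) - 2)) \<partial>lborel) =
      x powr (\<alpha> * real (Suc k)) / (\<alpha> * real (Suc k)) +
      \<alpha> * (x powr \<alpha>) ^ k * (Gamma (\<alpha> * real (Suc k) - 1) / Gamma (\<alpha> * real k + 1))"
proof -
  let ?n = "real (Suc k)"
  have p: "0 < \<alpha> * ?n - 1" "0 < \<alpha> * ?n" using index_mult_ge[of k] index_gt_1 by linarith+
  let ?F = "\<lambda>y. indicator {0<..<x} y * (K x y * y powr (\<alpha> * ?n - 2))"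
  let ?v = "x powr (\<alpha> * ?n) / (\<alpha> * ?n) + \<alpha> * (x powr \<alpha>) ^ k * (Gamma (\<alpha> * ?n - 1) / Gamma (\<alpha> * real k + 1))"
  have "(\<integral>\<^sup>+y. ennreal (?F y) \<partial>lborel) =
     (\<integral>\<^sup>+y. ennreal ((x - y) powr (1 - 1) * y powr (\<alpha> * ?n - 1)) * indicator {0<..<x} y +
        ennreal (\<alpha> / Gamma (2 - \<alpha>)) * (ennreal ((x - y) powr ((2 - \<alpha>) - 1) * y powr ((\<alpha> * ?n - 1) - 1)) * indicator {0<..<x} y) \<partial>lborel)"
  proof (rule nn_integral_cong)
    fix y
    show "ennreal (?F y) = ennreal ((x - y) powr (1 - 1) * y powr (\<alpha> * ?n - 1)) * indicator {0<..<x} y +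
        ennreal (\<alpha> / Gamma (2 - \<alpha>)) * (ennreal ((x - y) powr ((2 - \<alpha>) - 1) * y powr ((\<alpha> * ?n - 1) - 1)) * indicator {0<..<x} y)"
    proof (cases "y \<in> {0<..<x}")
      case True
      have a: "(x - y) powr ((2 - \<alpha>) - 1) = 1 / (x - y) powr (\<alpha> - 1)"
        using powr_minus_divide[of "x - y" "\<alpha> - 1"] by simp
      have b: "y powr (\<alpha> * ?n - 1) = y * y powr (\<alpha> * ?n - 2)"
        using True by (subst powr_mult_base) (auto simp del: of_nat_Suc)
      have c: "0 \<le> \<alpha> / Gamma (2 - \<alpha>)" using index_gt_1 Gamma_2_minus_pos by simp
      have "K x y * y powr (\<alpha> * ?n - 2) = (x - y) powr (1 - 1) * y powr (\<alpha> * ?n - 1) +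
          \<alpha> / Gamma (2 - \<alpha>) * ((x - y) powr ((2 - \<alpha>) - 1) * y powr ((\<alpha> * ?n - 1) - 1))"
        unfolding a b volterra_kernel_def using True by (simp add: distrib_right del: of_nat_Suc)
      then have "ennreal (K x y * y powr (\<alpha> * ?n - 2)) = ennreal ((x - y) powr (1 - 1) * y powr (\<alpha> * ?n - 1)) +
          ennreal (\<alpha> / Gamma (2 - \<alpha>) * ((x - y) powr ((2 - \<alpha>) - 1) * y powr ((\<alpha> * ?n - 1) - 1)))"
        using c True by (simp only: ennreal_plus[symmetric] mult_nonneg_nonneg powr_ge_zero)
      also have "ennreal (\<alpha> / Gamma (2 - \<alpha>) * ((x - y) powr ((2 - \<alpha>) - 1) * y powr ((\<alpha> * ?n - 1) - 1))) =
        ennreal (\<alpha> / Gamma (2 - \<alpha>)) * ennreal ((x - y) powr ((2 - \<alpha>) - 1) * y powr ((\<alpha> * ?n - 1) - 1))"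
        by (rule ennreal_mult[OF c]) simp
      finally show ?thesis using True by (simp only: indicator_simps mult_1 mult_1_right)
    qed simp
  qed
  also have "\<dots> = (\<integral>\<^sup>+y. ennreal ((x - y) powr (1 - 1) * y powr (\<alpha> * ?n - 1)) * indicator {0<..<x} y \<partial>lborel) +
        ennreal (\<alpha> / Gamma (2 - \<alpha>)) * (\<integral>\<^sup>+y. ennreal ((x - y) powr ((2 - \<alpha>) - 1) * y powr ((\<alpha> * ?n - 1) - 1)) * indicator {0<..<x} y \<partial>lborel)"
    by (subst nn_integral_add, measurable, subst nn_integral_cmult) auto
  also have "(\<integral>\<^sup>+y. ennreal ((x - y) powr (1 - 1) * y powr (\<alpha> * ?n - 1)) * indicator {0<..<x} y \<partial>lborel) =
      ennreal (x powr (1 + \<alpha> * ?n - 1) * (Gamma 1 * Gamma (\<alpha> * ?n) / Gamma (1 + \<alpha> * ?n)))"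
    by (rule nn_integral_beta[OF _ p(2) x]) simp
  also have "(\<integral>\<^sup>+y. ennreal ((x - y) powr ((2 - \<alpha>) - 1) * y powr ((\<alpha> * ?n - 1) - 1)) * indicator {0<..<x} y \<partial>lborel) =
      ennreal (x powr ((2 - \<alpha>) + (\<alpha> * ?n - 1) - 1) * (Gamma (2 - \<alpha>) * Gamma (\<alpha> * ?n - 1) / Gamma ((2 - \<alpha>) + (\<alpha> * ?n - 1))))"
    by (rule nn_integral_beta[OF _ p(1) x]) (use index_lt_2 in simp)
  also have "(2 - \<alpha>) + (\<alpha> * ?n - 1) = \<alpha> * real k + 1" by (simp add: algebra_simps)
  also have "x powr (\<alpha> * real k + 1 - 1) = (x powr \<alpha>) ^ k" using x by (simp add: powr_power mult.commute)
  also have "x powr (1 + \<alpha> * ?n - 1) * (Gamma 1 * Gamma (\<alpha> * ?n) / Gamma (1 + \<alpha> * ?n)) = x powr (\<alpha> * ?n) / (\<alpha> * ?n)"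
  proof -
    have "\<alpha> * ?n \<notin> \<int>\<^sub>\<le>\<^sub>0" using p by (auto dest: nonpos_Ints_nonpos)
    from Gamma_plus1[OF this] have "Gamma (1 + \<alpha> * ?n) = \<alpha> * ?n * Gamma (\<alpha> * ?n)" by (simp only: add.commute)
    then show ?thesis using Gamma_index_pos(2)[of k] by (simp del: of_nat_Suc)
  qed
  also have "ennreal (x powr (\<alpha> * ?n) / (\<alpha> * ?n)) + ennreal (\<alpha> / Gamma (2 - \<alpha>)) *
      ennreal ((x powr \<alpha>) ^ k * (Gamma (2 - \<alpha>) * Gamma (\<alpha> * ?n - 1) / Gamma (\<alpha> * real k + 1))) = ennreal ?v"
    using p index_gt_1 Gamma_2_minus_pos Gamma_index_pos[of k] x
    by (simp add: ennreal_mult[symmetric] ennreal_plus[symmetric] del: of_nat_Suc ennreal_plus)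
  finally have nn: "(\<integral>\<^sup>+y. ennreal (?F y) \<partial>lborel) = ennreal ?v" .
  have v0: "0 \<le> ?v" using p index_gt_1 Gamma_index_pos[of k] x by (simp del: of_nat_Suc)
  have F0: "0 \<le> ?F y" for y using volterra_kernel_pos[of y x] by (cases "y \<in> {0<..<x}") (auto simp: less_imp_le)
  show "integrable lborel ?F"
    by (rule integrableI_nn_integral_finite[OF _ _ nn]) (use F0 in auto)
  show "(\<integral>y. ?F y \<partial>lborel) = ?v"
    by (rule integral_eq_nn_integral[THEN trans]) (use F0 nn v0 in auto)
qed

text \<open>
  The integral of the \<open>k\<close>-th term against the kernel is \<open>t\<^sub>k - t\<^sub>k\<^sub>+\<^sub>1\<close>, so the series telescopes to \<open>t\<^sub>0\<close>,
  the right-hand side. Interchanging sum and integral is justified by bounding the \<open>k\<close>-th term on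
  \<open>(0, x)\<close> by \<open>(x powr \<alpha>) ^ k\<close> times the first one.
\<close>

theorem sup_density_volterra: "volterra_solution \<alpha> sup_density"
  unfolding volterra_solution_def
proof (intro allI impI)
  fix x :: real assume x: "0 < x"
  let ?m = "\<lambda>k y. indicator {0<..<x} y * (K x y * y powr (\<alpha> * real (Suc k) - 2))"
  let ?F = "\<lambda>k y. sup_coeff k * ?m k y"
  let ?t = "\<lambda>k. \<alpha> * (x powr \<alpha>) ^ k * (1 / (Gamma (1 / \<alpha> - real k) * Gamma (\<alpha> * real k + 1)))"
  have iF: "integrable lborel (?F k)" for k
    using volterra_kernel_moment(1)[OF x] by (intro integrable_mult_right)
  have m0: "0 \<le> ?m k y" for k y using volterra_kernel_pos[of y x] by (cases "y \<in> {0<..<x}") (auto simp: less_imp_le)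
  have m_le: "?m k y \<le> (x powr \<alpha>) ^ k * ?m 0 y" for k y
  proof (cases "y \<in> {0<..<x}")
    case True
    have "y powr (\<alpha> * real (Suc k) - 2) \<le> y powr (\<alpha> - 2) * (x powr \<alpha>) ^ k"
      using True index_gt_1 by (subst powr_exponent) (auto intro!: mult_left_mono power_mono powr_mono2)
    then have "K x y * y powr (\<alpha> * real (Suc k) - 2) \<le> K x y * (y powr (\<alpha> - 2) * (x powr \<alpha>) ^ k)"
      using True volterra_kernel_pos[of y x] by (intro mult_left_mono) auto
    moreover have "y powr (\<alpha> - 2) = y powr (\<alpha> * real (Suc 0) - 2)" by simp
    ultimately have "K x y * y powr (\<alpha> * real (Suc k) - 2) \<le> (x powr \<alpha>) ^ k * (K x y * y powr (\<alpha> * real (Suc 0) - 2))"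
      by (simp only: ac_simps)
    then show ?thesis using True by (simp only: indicator_simps mult_1)
  qed simp
  have nF: "norm (?F k y) \<le> \<bar>sup_coeff k\<bar> * (x powr \<alpha>) ^ k * ?m 0 y" for k y
    using m_le[where k=k and y=y] m0[where k=k and y=y] by (simp add: abs_mult mult.assoc mult_left_mono del: of_nat_Suc)
  have summ: "summable (\<lambda>k. \<bar>sup_coeff k\<bar> * (x powr \<alpha>) ^ k)" by (rule summable_sup_coeff) simp
  have s1: "AE y in lborel. summable (\<lambda>k. norm (?F k y))"
  proof (rule AE_I2)
    fix y
    show "summable (\<lambda>k. norm (?F k y))"
      by (rule summable_comparison_test'[OF summable_mult2[OF summ, of "?m 0 y"]]) (use nF in simp)
  qed
  have s2: "summable (\<lambda>k. \<integral>y. norm (?F k y) \<partial>lborel)"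
  proof (rule summable_comparison_test'[OF summable_mult2[OF summ, of "\<integral>y. ?m 0 y \<partial>lborel"]])
    fix k
    have "(\<integral>y. norm (?F k y) \<partial>lborel) \<le> (\<integral>y. \<bar>sup_coeff k\<bar> * (x powr \<alpha>) ^ k * ?m 0 y \<partial>lborel)"
      by (intro integral_mono integrable_norm iF nF integrable_mult_right volterra_kernel_moment(1)[OF x])
    also have "\<dots> = \<bar>sup_coeff k\<bar> * (x powr \<alpha>) ^ k * (\<integral>y. ?m 0 y \<partial>lborel)" by (rule integral_mult_right_zero)
    finally show "norm (\<integral>y. norm (?F k y) \<partial>lborel) \<le> \<bar>sup_coeff k\<bar> * (x powr \<alpha>) ^ k * (\<integral>y. ?m 0 y \<partial>lborel)"
      by (simp del: of_nat_Suc)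
  qed
  have sumF: "(\<Sum>k. ?F k y) = indicator {0<..<x} y * (K x y * sup_density y)" for y
  proof (cases "y \<in> {0<..<x}")
    case True
    then have "(\<lambda>k. K x y * (sup_coeff k * y powr (\<alpha> * real (Suc k) - 2))) sums (K x y * sup_density y)"
      by (intro sums_mult sup_density_sums) simp
    then have "(\<lambda>k. ?F k y) sums (indicator {0<..<x} y * (K x y * sup_density y))"
      using True by (simp add: mult.left_commute del: of_nat_Suc)
    then show ?thesis by (rule sums_unique[symmetric])
  qed simp
  have int: "integrable lborel (\<lambda>y. indicator {0<..<x} y * (K x y * sup_density y))"
    using integrable_suminf[OF iF s1 s2] unfolding sumF .
  have "(\<lambda>k. \<integral>y. ?F k y \<partial>lborel) sums (\<integral>y. (\<Sum>k. ?F k y) \<partial>lborel)"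
    by (rule sums_integral[OF iF s1 s2])
  moreover have "(\<integral>y. ?F k y \<partial>lborel) = ?t k - ?t (Suc k)" for k
  proof -
    have "(\<integral>y. ?F k y \<partial>lborel) = sup_coeff k * (\<integral>y. ?m k y \<partial>lborel)" by (rule integral_mult_right_zero)
    also have "\<dots> = sup_coeff k / (\<alpha> * real (Suc k)) * x powr (\<alpha> * real (Suc k)) +
        \<alpha> * (x powr \<alpha>) ^ k * (sup_coeff k * (Gamma (\<alpha> * real (Suc k) - 1) / Gamma (\<alpha> * real k + 1)))"
      unfolding volterra_kernel_moment(2)[OF x] by (simp add: distrib_left del: of_nat_Suc)
    also have "x powr (\<alpha> * real (Suc k)) = (x powr \<alpha>) ^ Suc k" using x by (simp add: powr_power mult.commute del: of_nat_Suc power_Suc)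
    finally show ?thesis unfolding sup_coeff_telescope by (simp del: of_nat_Suc power_Suc)
  qed
  ultimately have S: "(\<lambda>k. ?t k - ?t (Suc k)) sums (\<integral>y. indicator {0<..<x} y * (K x y * sup_density y) \<partial>lborel)"
    unfolding sumF by (simp only:)
  have "(\<lambda>k. - (sup_coeff k / (\<alpha> * real (Suc k)) * (x powr \<alpha>) ^ Suc k)) \<longlonglongrightarrow> 0"
  proof (rule Lim_null_comparison)
    have "(\<lambda>k. \<bar>sup_coeff k\<bar> * (x powr \<alpha>) ^ k * (x powr \<alpha>)) \<longlonglongrightarrow> 0 * (x powr \<alpha>)"
      by (intro tendsto_mult tendsto_const summable_LIMSEQ_zero[OF summ])
    then show "(\<lambda>k. \<bar>sup_coeff k\<bar> * (x powr \<alpha>) ^ k * (x powr \<alpha>)) \<longlonglongrightarrow> 0" by simp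
    show "\<forall>\<^sub>F k in sequentially. norm (- (sup_coeff k / (\<alpha> * real (Suc k)) * (x powr \<alpha>) ^ Suc k)) \<le> \<bar>sup_coeff k\<bar> * (x powr \<alpha>) ^ k * (x powr \<alpha>)"
    proof (intro always_eventually allI)
      fix k
      have "1 \<le> \<alpha> * real (Suc k)" using index_mult_ge[of k] index_gt_1 by linarith
      then have "\<bar>sup_coeff k\<bar> / (\<alpha> * real (Suc k)) \<le> \<bar>sup_coeff k\<bar> / 1" by (intro divide_left_mono) auto
      then have "\<bar>sup_coeff k\<bar> / (\<alpha> * real (Suc k)) * (x powr \<alpha>) ^ Suc k \<le> \<bar>sup_coeff k\<bar> * (x powr \<alpha>) ^ Suc k"
        by (intro mult_right_mono) auto
      then show "norm (- (sup_coeff k / (\<alpha> * real (Suc k)) * (x powr \<alpha>) ^ Suc k)) \<le> \<bar>sup_coeff k\<bar> * (x powr \<alpha>) ^ k * (x powr \<alpha>)"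
        using index_gt_1 by (simp add: abs_mult ac_simps del: of_nat_Suc)
    qed
  qed
  also have "(\<lambda>k. - (sup_coeff k / (\<alpha> * real (Suc k)) * (x powr \<alpha>) ^ Suc k)) = (\<lambda>k. ?t (Suc k))"
    unfolding sup_coeff_telescope by (simp add: ac_simps del: of_nat_Suc power_Suc)
  finally have "?t \<longlonglongrightarrow> 0" by (rule LIMSEQ_imp_Suc)
  from telescope_sums'[OF this] have "(\<lambda>k. ?t k - ?t (Suc k)) sums (?t 0 - 0)" .
  from sums_unique2[OF S this] have val: "(\<integral>y. indicator {0<..<x} y * (K x y * sup_density y) \<partial>lborel) = \<alpha> / Gamma (1 / \<alpha>)"
    by simp
  have meas: "(\<lambda>y. indicator {0<..<x} y * (K x y * sup_density y)) \<in> borel_measurable lborel"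
    using int by (rule borel_measurable_integrable)
  have ai: "(\<lambda>y. K x y * sup_density y) absolutely_integrable_on {0<..<x}"
    unfolding set_integrable_def using int integrable_completion[OF meas] by simp
  moreover have "integral {0<..<x} (\<lambda>y. K x y * sup_density y) = \<alpha> / Gamma (1 / \<alpha>)"
    using set_lebesgue_integral_eq_integral(2)[OF ai] val integral_completion[OF meas]
    by (simp add: set_lebesgue_integral_def)
  ultimately show "(\<lambda>y. K x y * sup_density y) absolutely_integrable_on {0<..<x} \<and>
      integral {0<..<x} (\<lambda>y. K x y * sup_density y) = \<alpha> / Gamma (1 / \<alpha>)" by simp
qed

end

section \<open>The density of the supremum\<close>

lemma continuous_AE_eq_halfline:
  fixes f g :: "real \<Rightarrow> real"
  assumes g: "continuous_on {0<..} g" and eq: "AE x in lborel. 0 < x \<longrightarrow> g x = f x"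
    and x: "0 < x" and f: "continuous_on {0<..} f"
  shows "g x = f x"
proof -
  have c: "continuous_on {0<..} (\<lambda>y. g y - f y)" by (intro continuous_intros f g)
  have "open ((\<lambda>y. g y - f y) -` (- {0}) \<inter> {0<..})"
    using c[unfolded continuous_on_open_vimage[OF open_greaterThan]] by (simp add: open_Compl)
  then have cl: "closed (- ((\<lambda>y. g y - f y) -` (- {0}) \<inter> {0<..}))" by (rule closed_Compl)
  have "x \<in> - ((\<lambda>y. g y - f y) -` (- {0}) \<inter> {0<..})"
  proof (rule mem_closed_if_AE_lebesgue_open[OF open_greaterThan cl])
    show "AE y\<in>{0<..} in lebesgue. y \<in> - ((\<lambda>y. g y - f y) -` (- {0}) \<inter> {0<..})"
      using AE_completion[OF eq] by eventually_elim auto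
  qed (use x in simp)
  then show ?thesis using x by simp
qed

theorem theorem1:
  fixes M :: "'a measure" and X :: "real \<Rightarrow> 'a \<Rightarrow> real" and \<alpha> :: real
  assumes alpha: "1 < \<alpha>" "\<alpha> < 2"
    and stable: "stable_levy_process M X \<alpha>"
    and jumps: "no_negative_jumps M X"
    and char_levy: "\<And>u t. 0 \<le> t \<Longrightarrow>
      (LINT \<omega>|M. exp (\<i> * complex_of_real (u * X t \<omega>))) =
      exp (complex_of_real t *
        (LINT x:{0<..}|lborel. (exp (\<i> * complex_of_real (u * x)) - 1 - \<i> * complex_of_real (u * x))
           / complex_of_real (Gamma (- \<alpha>) * x powr (1 + \<alpha>))))"
    and char_power: "\<And>u t. 0 \<le> t \<Longrightarrow>
      (LINT \<omega>|M. exp (\<i> * complex_of_real (u * X t \<omega>))) =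
      exp (complex_of_real t * (- \<i> * complex_of_real u) powr complex_of_real \<alpha>)"
    and laplace: "\<And>u t. 0 \<le> u \<Longrightarrow> 0 \<le> t \<Longrightarrow>
      (LINT \<omega>|M. exp (- u * X t \<omega>)) = exp (t * u powr \<alpha>)"
  shows "\<exists>f :: real \<Rightarrow> real.
    continuous_on {0<..} f \<and> (\<forall>x>0. 0 \<le> f x) \<and>
    distributed M lborel (\<lambda>\<omega>. SUP t\<in>{0..1}. X t \<omega>) (\<lambda>x. ennreal (if 0 < x then f x else 0)) \<and>
    volterra_solution \<alpha> f \<and>
    (\<forall>g. volterra_solution \<alpha> g \<longrightarrow> (AE x in lborel. 0 < x \<longrightarrow> g x = f x)) \<and>
    fractional_solution \<alpha> f \<and>
    (\<forall>g. fractional_solution \<alpha> g \<longrightarrow> (\<forall>x>0. g x = f x)) \<and>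
    (\<forall>g. continuous_on {0<..} g \<longrightarrow> (volterra_solution \<alpha> g \<longleftrightarrow> fractional_solution \<alpha> g)) \<and>
    (\<forall>x>0. (\<lambda>k. let n = real (Suc k) in
       1 / (Gamma (\<alpha> * n - 1) * Gamma (- n + 1 + 1 / \<alpha>)) * x powr (\<alpha> * n - 2)) sums f x)"
proof -
  interpret stable_levy_laplace M X \<alpha>
    unfolding stable_levy_laplace_def stable_levy_laplace_axioms_def
    using stable alpha laplace[of _ 1] by simp
  interpret index: stable_index \<alpha> by standard (fact alpha)+
  let ?f = "index.sup_density"
  have volterra: "volterra_solution \<alpha> ?f" by (rule index.sup_density_volterra)
  have cont: "continuous_on {0<..} ?f" by (rule index.continuous_on_sup_density)
  have frac: "fractional_solution \<alpha> ?f"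
    by (rule index.volterra_imp_fractional[OF volterra cont index.sup_density_limit_0])
  have AE_eq: "g x = ?f x"
    if "continuous_on {0<..} g" "AE x in lborel. 0 < x \<longrightarrow> g x = ?f x" "0 < x" for g x
    using that cont by (rule continuous_AE_eq_halfline)
  define \<mu> where "\<mu> = distr M borel supremum"
  have \<mu>: "real_distribution \<mu>" unfolding \<mu>_def by (rule real_distribution_distr) measurable
  have \<mu>_nonneg: "AE x in \<mu>. 0 \<le> x"
    unfolding \<mu>_def using AE_supremum_nonneg by (subst AE_distr_iff) auto
  obtain d where d: "index.resolvent_pair d (\<lambda>_. 0)" "\<mu> = density lborel d"
  proof (rule index.laplace_identity_imp_resolvent_density[OF \<mu> \<mu>_nonneg])
    fix u :: real assume u: "0 < u"
    have 1: "(\<integral>\<^sup>+x. ennreal (exp (- u * x)) \<partial>\<mu>) = ennreal (sup_laplace u)"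
      unfolding \<mu>_def using u sup_laplace_bounds(1)[of u]
      by (subst nn_integral_distr) (auto intro!: nn_integral_eq_integral)
    have "(\<integral>\<^sup>+x. ennreal x * ennreal (exp (- u * x)) \<partial>\<mu>) = (\<integral>\<^sup>+\<omega>. ennreal (supremum \<omega> * exp (- u * supremum \<omega>)) \<partial>M)"
      unfolding \<mu>_def by (subst nn_integral_distr) (auto simp: ennreal_mult'')
    also have "\<dots> = ennreal (expectation (\<lambda>\<omega>. supremum \<omega> * exp (- u * supremum \<omega>)))"
      using AE_supremum_nonneg by (intro nn_integral_eq_integral sup_laplace_size_biased(1)[OF u]) (auto elim!: eventually_mono)
    finally have 2: "(\<integral>\<^sup>+x. ennreal x * ennreal (exp (- u * x)) \<partial>\<mu>) = ennreal (expectation (\<lambda>\<omega>. supremum \<omega> * exp (- u * supremum \<omega>)))" .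
    have 3: "0 \<le> expectation (\<lambda>\<omega>. supremum \<omega> * exp (- u * supremum \<omega>))"
      using AE_supremum_nonneg by (intro integral_nonneg_AE) (auto elim!: eventually_mono)
    show "(\<integral>\<^sup>+x. ennreal x * ennreal (exp (- u * x)) \<partial>\<mu>) +
        ennreal (\<alpha> * u powr (\<alpha> - 1)) * (\<integral>\<^sup>+x. ennreal (exp (- u * x)) \<partial>\<mu>) = ennreal (\<alpha> / Gamma (1 / \<alpha>))"
      unfolding 1 2 sup_laplace_size_biased(2)[OF u, symmetric]
      using 3 alpha sup_laplace_bounds(2)[of u] u
      by (simp add: ennreal_plus ennreal_mult)
  qed (rule that)
  have fd: "AE x in lborel. 0 < x \<longrightarrow> 0 \<le> ?f x \<and> d x = ennreal (?f x)"
    by (rule index.volterra_solution_eq_resolvent_density[OF volterra d(1)])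
  have nonneg: "0 \<le> ?f x" if "0 < x" for x
  proof -
    have "\<bar>?f x\<bar> = ?f x"
    proof (rule AE_eq[OF _ _ that])
      show "continuous_on {0<..} (\<lambda>x. \<bar>?f x\<bar>)" by (intro continuous_intros cont)
      show "AE x in lborel. 0 < x \<longrightarrow> \<bar>?f x\<bar> = ?f x" using fd by eventually_elim auto
    qed
    then show ?thesis by linarith
  qed
  have f_meas [measurable]: "(\<lambda>x. if 0 < x then ?f x else 0) \<in> borel_measurable borel"
    using borel_measurable_continuous_on_if[of "{0<..}" ?f "\<lambda>_. 0"] cont by simp
  have "distributed M lborel supremum (\<lambda>x. ennreal (if 0 < x then ?f x else 0))"
    unfolding distributed_def
  proof (intro conjI)
    have d0: "d x = 0" if "x \<le> 0" for x
      using d(1) that by (simp add: index.resolvent_pair_def index.locally_finite_def)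
    have [measurable]: "d \<in> borel_measurable borel"
      using d(1) by (simp add: index.resolvent_pair_def index.locally_finite_def)
    have "AE x in lborel. d x = ennreal (if 0 < x then ?f x else 0)"
      using fd by eventually_elim (auto simp: d0)
    then have "density lborel d = density lborel (\<lambda>x. ennreal (if 0 < x then ?f x else 0))"
      by (intro density_cong) auto
    moreover have "distr M lborel supremum = \<mu>" unfolding \<mu>_def by (intro distr_cong) auto
    ultimately show "distr M lborel supremum = density lborel (\<lambda>x. ennreal (if 0 < x then ?f x else 0))"
      using d(2) by simp
  qed auto
  moreover have "(\<lambda>k. let n = real (Suc k) in
       1 / (Gamma (\<alpha> * n - 1) * Gamma (- n + 1 + 1 / \<alpha>)) * x powr (\<alpha> * n - 2)) sums ?f x" if "0 < x" for x
    using index.sup_density_sums[OF that] unfolding index.sup_coeff_def Let_def .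
  moreover have "volterra_solution \<alpha> g \<longleftrightarrow> fractional_solution \<alpha> g" if g: "continuous_on {0<..} g" for g
  proof
    assume "volterra_solution \<alpha> g"
    then have eq: "g x = ?f x" if "0 < x" for x
      by (intro AE_eq g that index.volterra_solution_unique volterra)
    have "((\<lambda>x. x powr (2 - \<alpha>) * g x) \<longlongrightarrow> 1 / (Gamma (\<alpha> - 1) * Gamma (1 / \<alpha>))) (at_right 0)"
      using index.sup_density_limit_0
      by (rule Lim_transform_eventually) (use eventually_at_right_less[of "0::real"] in \<open>auto elim!: eventually_mono simp: eq\<close>)
    with \<open>volterra_solution \<alpha> g\<close> g show "fractional_solution \<alpha> g"
      by (intro index.volterra_imp_fractional)
  qed (rule index.fractional_imp_volterra)
  moreover have "AE x in lborel. 0 < x \<longrightarrow> g x = ?f x" if "volterra_solution \<alpha> g" for g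
    by (rule index.volterra_solution_unique[OF volterra that])
  moreover have "g x = ?f x" if "fractional_solution \<alpha> g" "0 < x" for g x
    by (rule index.fractional_solution_unique[OF frac that])
  ultimately show ?thesis
    using volterra cont frac nonneg by (intro exI[of _ ?f]) blast
qed

end
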